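(* Let $n\ge 2$, let $F_n$ be the free group with free basis $A=\{a_1,\ldots,a_n\}$, and let $s\in F_n$ be one of the following: (1) $s=a_1^2a_2^2\cdots a_n^2$; or (2) $n$ is even and $s=[a_1,a_2][a_3,a_4]\cdots[a_{n-1},a_n]$. Then $\mathrm{Cay}(F_n;\{s,s^{-1}\})$ is the unique hamiltonian circle in $\mathrm{Cay}(F_n;A^{\pm1}\cup\{s^{\pm1}\})$.
   Context: $[x,y]=xyx^{-1}y^{-1}$ and $A^{\pm1}=\{a_1^{\pm1},\ldots,a_n^{\pm1}\}$. For a group $G$ and symmetric subset $S$ ($S=S^{-1}$), the Cayley graph $\mathrm{Cay}(G;S)$ has vertex set $G$, with $x$ adjacent to $y$ iff $x^{-1}y\in S$. For a connected locally finite graph $X$, the Freudenthal compactification $|X|$ is obtained from $X$ (as a 1-dimensional complex) by adding a point for each end of $X$; a hamiltonian circle is a subspace of $|X|$ homeomorphic to $S^1$ containing all vertices, identified with the spanning 2-regular subgraph it meets $X$ in. A subgraph being "a hamiltonian circle" means its closure in $|X|$ is such a circle. *)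

theory Defs
  imports "HOL-Analysis.Analysis" "HOL-Algebra.Group"
begin

section \<open>Free groups\<close>

text \<open>
  Elements are the reduced words in the letters \<open>b\<^sup>\<plusminus>\<^sup>1\<close> with \<open>b \<in> B\<close>; the letter \<open>(b, True)\<close> stands
  for \<open>b\<close> and \<open>(b, False)\<close> for its inverse.
\<close>

type_synonym 'b letter = "'b \<times> bool"

definition flip :: "'b letter \<Rightarrow> 'b letter" where
  "flip x = (fst x, \<not> snd x)"

definition reduced_word :: "'b letter list \<Rightarrow> bool" where
  "reduced_word w \<longleftrightarrow> successively (\<lambda>x y. y \<noteq> flip x) w"

definition push :: "'b letter \<Rightarrow> 'b letter list \<Rightarrow> 'b letter list" where
  "push x w = (case w of [] \<Rightarrow> [x] | y # ys \<Rightarrow> if y = flip x then ys else x # w)"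

definition free_group :: "'b set \<Rightarrow> 'b letter list monoid" where
  "free_group B =
     \<lparr>carrier = {w. reduced_word w \<and> fst ` set w \<subseteq> B}, mult = foldr push, one = []\<rparr>"

definition gen :: "'b \<Rightarrow> 'b letter list" where
  "gen b = [(b, True)]"

lemma flip_flip [simp]: "flip (flip x) = x"
  by (simp add: flip_def)

lemma fst_flip [simp]: "fst (flip x) = fst x"
  by (simp add: flip_def)

lemma reduced_word_Nil [simp]: "reduced_word []"
  by (simp add: reduced_word_def)

lemma reduced_word_Cons:
  "reduced_word (x # w) \<longleftrightarrow> reduced_word w \<and> (w = [] \<or> hd w \<noteq> flip x)"
  by (auto simp: reduced_word_def successively_Cons)

lemma reduced_word_push: "reduced_word w \<Longrightarrow> reduced_word (push x w)"
  by (auto simp: push_def reduced_word_Cons split: list.split)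

lemma set_push: "fst ` set (push x w) \<subseteq> insert (fst x) (fst ` set w)"
  by (auto simp: push_def split: list.split)

lemma push_flip: "reduced_word w \<Longrightarrow> push x (push (flip x) w) = w"
  by (cases w; cases "tl w") (auto simp: push_def reduced_word_Cons)

lemma reduced_word_foldr_push: "reduced_word w \<Longrightarrow> reduced_word (foldr push v w)"
  by (induction v) (auto simp: reduced_word_push)

lemma set_foldr_push: "fst ` set (foldr push v w) \<subseteq> fst ` set v \<union> fst ` set w"
proof (induction v)
  case (Cons x v)
  have "fst ` set (push x (foldr push v w)) \<subseteq> insert (fst x) (fst ` set (foldr push v w))"
    by (rule set_push)
  also have "\<dots> \<subseteq> insert (fst x) (fst ` set v \<union> fst ` set w)"
    using Cons by (rule insert_mono)
  finally show ?case by simp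
qed simp

lemma foldr_push_push:
  assumes "reduced_word w"
  shows "foldr push (push x v) w = push x (foldr push v w)"
proof (cases "v \<noteq> [] \<and> hd v = flip x")
  case True
  then obtain ys where v: "v = flip x # ys" by (cases v) auto
  show ?thesis
    using push_flip[OF reduced_word_foldr_push[OF assms]] by (simp add: v) (simp add: push_def)
next
  case False
  then have "push x v = x # v" by (cases v) (auto simp: push_def)
  then show ?thesis by simp
qed

lemma foldr_push_assoc:
  assumes "reduced_word w"
  shows "foldr push (foldr push u v) w = foldr push u (foldr push v w)"
  using assms by (induction u) (auto simp: foldr_push_push)

lemma foldr_push_Nil: "reduced_word v \<Longrightarrow> foldr push v [] = v"
proof (induction v)
  case (Cons x v)
  then show ?case by (cases v) (auto simp: push_def reduced_word_Cons)
qed simp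

lemma foldr_push_inverse: "reduced_word w \<Longrightarrow> foldr push (rev (map flip v)) (foldr push v w) = w"
proof (induction v)
  case (Cons x v)
  have "push (flip x) (push x (foldr push v w)) = foldr push v w"
    using push_flip[of "foldr push v w" "flip x"] Cons.prems by (simp add: reduced_word_foldr_push)
  then show ?case using Cons by simp
qed simp

lemma reduced_word_inverse: "reduced_word v \<Longrightarrow> reduced_word (rev (map flip v))"
  unfolding reduced_word_def successively_rev successively_map
  by (erule successively_mono) (metis flip_flip)

lemma group_free_group: "group (free_group B)"
proof (rule groupI)
  fix x assume "x \<in> carrier (free_group B)"
  then have x: "reduced_word x" "fst ` set x \<subseteq> B" by (auto simp: free_group_def)
  have "rev (map flip x) \<in> carrier (free_group B)"
    using x reduced_word_inverse[of x] by (auto simp: free_group_def)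
  moreover have "rev (map flip x) \<otimes>\<^bsub>free_group B\<^esub> x = \<one>\<^bsub>free_group B\<^esub>"
    using foldr_push_inverse[of "[]" x] x by (simp add: free_group_def foldr_push_Nil)
  ultimately show "\<exists>y\<in>carrier (free_group B). y \<otimes>\<^bsub>free_group B\<^esub> x = \<one>\<^bsub>free_group B\<^esub>"
    by blast
next
  fix x y assume "x \<in> carrier (free_group B)" "y \<in> carrier (free_group B)"
  then show "x \<otimes>\<^bsub>free_group B\<^esub> y \<in> carrier (free_group B)"
    using subset_trans[OF set_foldr_push[of x y], of B]
    by (simp add: free_group_def reduced_word_foldr_push)
qed (auto simp: free_group_def foldr_push_assoc)

lemma gen_in_free_group: "b \<in> B \<Longrightarrow> gen b \<in> carrier (free_group B)"
  by (simp add: gen_def free_group_def reduced_word_def)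

lemma inv_gen:
  assumes "b \<in> B"
  shows "inv\<^bsub>free_group B\<^esub> (gen b) = [(b, False)]"
proof -
  interpret group "free_group B" by (rule group_free_group)
  show ?thesis
    by (rule inv_equality)
      (use assms in \<open>auto simp: free_group_def gen_def push_def flip_def reduced_word_def\<close>)
qed

text \<open>The universal property of the free group with free basis \<open>gen ` B\<close>.\<close>

lemma free_group_hom_unique:
  assumes "group G" "h \<in> hom (free_group B) G" "k \<in> hom (free_group B) G"
    and gens: "\<And>b. b \<in> B \<Longrightarrow> h (gen b) = k (gen b)"
    and "w \<in> carrier (free_group B)"
  shows "h w = k w"
proof -
  interpret F: group "free_group B" by (rule group_free_group)
  interpret G: group G by fact
  interpret h: group_hom "free_group B" G h
    using assms(2) by unfold_locales
  interpret k: group_hom "free_group B" G k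
    using assms(3) by unfold_locales
  have letter: "h [x] = k [x]" if "fst x \<in> B" for x
  proof (cases "snd x")
    case True
    then show ?thesis using gens[OF that] by (cases x) (simp add: gen_def)
  next
    case False
    then have "[x] = inv\<^bsub>free_group B\<^esub> (gen (fst x))"
      using inv_gen[OF that] by (cases x) simp
    then show ?thesis using gens[OF that] gen_in_free_group[OF that] by simp
  qed
  show ?thesis
    using assms(5)
  proof (induction w)
    case Nil
    then show ?case using h.hom_one k.hom_one by (simp add: free_group_def)
  next
    case (Cons x w)
    then have x: "fst x \<in> B" "[x] \<in> carrier (free_group B)"
      and w: "w \<in> carrier (free_group B)"
      by (auto simp: free_group_def reduced_word_Cons)
    have "x # w = [x] \<otimes>\<^bsub>free_group B\<^esub> w"
      using Cons.prems by (cases w) (auto simp: free_group_def push_def reduced_word_Cons)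
    then show ?case using x w Cons.IH letter by simp
  qed
qed

lemma free_group_hom_exists:
  assumes "group G" "f \<in> B \<rightarrow> carrier G"
  shows "\<exists>h\<in>hom (free_group B) G. \<forall>b\<in>B. h (gen b) = f b"
proof -
  interpret G: group G by fact
  define l where "l x = (if snd x then f (fst x) else inv\<^bsub>G\<^esub> f (fst x))" for x
  define h where "h w = foldr (\<lambda>x y. l x \<otimes>\<^bsub>G\<^esub> y) w \<one>\<^bsub>G\<^esub>" for w
  have l: "l x \<in> carrier G" if "fst x \<in> B" for x
    using assms(2) that by (auto simp: l_def)
  have h: "h w \<in> carrier G" if "fst ` set w \<subseteq> B" for w
    using that by (induction w) (auto simp: h_def l)
  have l_flip: "l x \<otimes>\<^bsub>G\<^esub> l (flip x) = \<one>\<^bsub>G\<^esub>" if "fst x \<in> B" for x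
    using assms(2) that by (auto simp: l_def flip_def Pi_iff)
  have push: "h (push x w) = l x \<otimes>\<^bsub>G\<^esub> h w" if "fst x \<in> B" "fst ` set w \<subseteq> B" for x w
  proof (cases "w \<noteq> [] \<and> hd w = flip x")
    case True
    then obtain ys where w: "w = flip x # ys" by (cases w) auto
    have "l x \<otimes>\<^bsub>G\<^esub> (l (flip x) \<otimes>\<^bsub>G\<^esub> h ys) = h ys"
      using that l l_flip h by (simp add: w G.m_assoc[symmetric])
    then show ?thesis by (simp add: w push_def) (simp add: h_def)
  next
    case False
    then have "push x w = x # w" by (cases w) (auto simp: push_def)
    then show ?thesis by (simp add: h_def)
  qed
  have "h (foldr push v w) = h v \<otimes>\<^bsub>G\<^esub> h w" if "fst ` set v \<subseteq> B" "fst ` set w \<subseteq> B" for v w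
    using that
  proof (induction v)
    case Nil
    then show ?case using h by (simp add: h_def[of "[]"])
  next
    case (Cons x v)
    have "fst ` set (foldr push v w) \<subseteq> B"
      using Cons.prems subset_trans[OF set_foldr_push[of v w], of B] by simp
    then have "h (foldr push (x # v) w) = l x \<otimes>\<^bsub>G\<^esub> h (foldr push v w)"
      using Cons.prems push by simp
    also have "\<dots> = (l x \<otimes>\<^bsub>G\<^esub> h v) \<otimes>\<^bsub>G\<^esub> h w"
      using Cons l h by (simp add: G.m_assoc)
    finally show ?case by (simp add: h_def[of "x # v"] h_def[of v])
  qed
  then have "h \<in> hom (free_group B) G"
    using h by (auto simp: hom_def free_group_def)
  moreover have "\<forall>b\<in>B. h (gen b) = f b"
    using assms(2) by (simp add: h_def gen_def l_def Pi_iff)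
  ultimately show ?thesis by blast
qed

definition commutator :: "('g, 'm) monoid_scheme \<Rightarrow> 'g \<Rightarrow> 'g \<Rightarrow> 'g" where
  "commutator G x y = x \<otimes>\<^bsub>G\<^esub> y \<otimes>\<^bsub>G\<^esub> inv\<^bsub>G\<^esub> x \<otimes>\<^bsub>G\<^esub> inv\<^bsub>G\<^esub> y"

definition list_product :: "('g, 'm) monoid_scheme \<Rightarrow> 'g list \<Rightarrow> 'g" where
  "list_product G xs = foldr (mult G) xs \<one>\<^bsub>G\<^esub>"

definition with_inverses :: "('g, 'm) monoid_scheme \<Rightarrow> 'g set \<Rightarrow> 'g set" where
  "with_inverses G T = T \<union> m_inv G ` T"


section \<open>Graphs\<close>

text \<open>Simple undirected graphs: an edge joining \<open>u\<close> and \<open>v\<close> is the set \<open>{u, v}\<close>.\<close>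

record 'a ugraph =
  verts :: "'a set"
  edges :: "'a set set"

definition subgraph :: "'a ugraph \<Rightarrow> 'a ugraph \<Rightarrow> bool" where
  "subgraph H X \<longleftrightarrow>
     verts H \<subseteq> verts X \<and> edges H \<subseteq> edges X \<and> (\<forall>e\<in>edges H. e \<subseteq> verts H)"

definition del_verts :: "'a ugraph \<Rightarrow> 'a set \<Rightarrow> 'a ugraph" where
  "del_verts X S = \<lparr>verts = verts X - S, edges = {e \<in> edges X. e \<inter> S = {}}\<rparr>"

definition graph_component :: "'a ugraph \<Rightarrow> 'a \<Rightarrow> 'a set" where
  "graph_component X v = {w. (v, w) \<in> {(x, y). {x, y} \<in> edges X}\<^sup>*}"

definition graph_components :: "'a ugraph \<Rightarrow> 'a set set" where
  "graph_components X = graph_component X ` verts X"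

text \<open>For a symmetric set \<open>S\<close>; edges are loop-free if \<open>S\<close> does not contain the identity.\<close>

definition cayley_graph :: "('g, 'm) monoid_scheme \<Rightarrow> 'g set \<Rightarrow> 'g ugraph" where
  "cayley_graph G S =
     \<lparr>verts = carrier G,
      edges = {{x, y} |x y. x \<in> carrier G \<and> y \<in> carrier G \<and> inv\<^bsub>G\<^esub> x \<otimes>\<^bsub>G\<^esub> y \<in> S}\<rparr>"


section \<open>Ends and the Freudenthal compactification\<close>

definition ray :: "'a ugraph \<Rightarrow> (nat \<Rightarrow> 'a) \<Rightarrow> bool" where
  "ray X r \<longleftrightarrow> inj r \<and> (\<forall>i. r i \<in> verts X) \<and> (\<forall>i. {r i, r (Suc i)} \<in> edges X)"

definition has_tail_in :: "(nat \<Rightarrow> 'a) \<Rightarrow> 'a set \<Rightarrow> bool" where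
  "has_tail_in r C \<longleftrightarrow> (\<exists>N. \<forall>i\<ge>N. r i \<in> C)"

text \<open>Two rays are equivalent if no finite set of vertices separates them.\<close>

definition ray_equiv :: "'a ugraph \<Rightarrow> ((nat \<Rightarrow> 'a) \<times> (nat \<Rightarrow> 'a)) set" where
  "ray_equiv X = {(r, r'). ray X r \<and> ray X r' \<and>
     (\<forall>S. finite S \<and> S \<subseteq> verts X \<longrightarrow>
       (\<exists>C\<in>graph_components (del_verts X S). has_tail_in r C \<and> has_tail_in r' C))}"

definition ends :: "'a ugraph \<Rightarrow> (nat \<Rightarrow> 'a) set set" where
  "ends X = {r. ray X r} // ray_equiv X"

text \<open>
  The underlying 1-dimensional complex is realised by barycentric coordinates: the point at
  parameter \<open>t\<close> on the edge \<open>{u, v}\<close> is the formal convex combination \<open>(1 - t) u + t v\<close>.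
  It carries the weak topology: a set is open iff its trace on every closed edge is open.
\<close>

definition vertex_point :: "'a \<Rightarrow> 'a \<Rightarrow> real" where
  "vertex_point v = (\<lambda>w. of_bool (w = v))"

definition edge_point :: "'a \<Rightarrow> 'a \<Rightarrow> real \<Rightarrow> 'a \<Rightarrow> real" where
  "edge_point u v t = (\<lambda>w. (1 - t) * of_bool (w = u) + t * of_bool (w = v))"

definition complex_points :: "'a ugraph \<Rightarrow> ('a \<Rightarrow> real) set" where
  "complex_points X = vertex_point ` verts X \<union>
     {edge_point u v t |u v t. {u, v} \<in> edges X \<and> 0 \<le> t \<and> t \<le> 1}"

definition complex_open :: "'a ugraph \<Rightarrow> ('a \<Rightarrow> real) set \<Rightarrow> bool" where
  "complex_open X U \<longleftrightarrow> U \<subseteq> complex_points X \<and>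
     (\<forall>u v. {u, v} \<in> edges X \<longrightarrow>
        openin (top_of_set {0..1}) {t \<in> {0..1}. edge_point u v t \<in> U})"

datatype 'a fpoint = Pt "'a \<Rightarrow> real" | End "(nat \<Rightarrow> 'a) set"

text \<open>
  For a component \<open>C\<close> of \<open>X - S\<close>, the basic open set consists of \<open>C\<close>, the edges within \<open>C\<close>, the
  open edges between \<open>C\<close> and \<open>S\<close> (together: the open star of \<open>C\<close>), and the ends with a ray in \<open>C\<close>.
\<close>

definition end_nbhd :: "'a ugraph \<Rightarrow> 'a set \<Rightarrow> 'a fpoint set" where
  "end_nbhd X C = Pt ` {p \<in> complex_points X. \<exists>v\<in>C. p v > 0} \<union>
     End ` {\<omega> \<in> ends X. \<exists>r\<in>\<omega>. has_tail_in r C}"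

text \<open>The compactification \<open>|X|\<close> of a connected locally finite graph \<open>X\<close>.\<close>

definition freudenthal :: "'a ugraph \<Rightarrow> 'a fpoint topology" where
  "freudenthal X = topology_generated_by
     ({Pt ` U |U. complex_open X U} \<union>
      {end_nbhd X C |S C. finite S \<and> S \<subseteq> verts X \<and> C \<in> graph_components (del_verts X S)})"

lemma topspace_freudenthal:
  "topspace (freudenthal X) = Pt ` complex_points X \<union> End ` ends X"
proof
  show "topspace (freudenthal X) \<subseteq> Pt ` complex_points X \<union> End ` ends X"
    unfolding freudenthal_def topology_generated_by_topspace
    by (auto simp: complex_open_def end_nbhd_def)
next
  have cx: "complex_open X (complex_points X)"
  proof -
    have "{t \<in> {0..1}. edge_point u v t \<in> complex_points X} = {0..1}"
      if "{u, v} \<in> edges X" for u v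
      using that by (auto simp: complex_points_def)
    then show ?thesis by (simp add: complex_open_def)
  qed
  have en: "\<exists>C\<in>graph_components (del_verts X {}). End \<omega> \<in> end_nbhd X C"
    if "\<omega> \<in> ends X" for \<omega>
  proof -
    obtain r where r: "ray X r" and \<omega>: "\<omega> = ray_equiv X `` {r}"
      using \<open>\<omega> \<in> ends X\<close> by (auto simp: ends_def elim: quotientE)
    have "\<exists>C\<in>graph_components (del_verts X S). has_tail_in r C"
      if S: "finite S" "S \<subseteq> verts X" for S
    proof -
      have "finite (r -` S)"
        using r S by (auto simp: ray_def intro: finite_vimageI)
      then obtain N where N: "\<And>i. i \<ge> N \<Longrightarrow> r i \<notin> S"
        by (metis finite_nat_set_iff_bounded linorder_not_less vimageI)
      have "r (N + k) \<in> graph_component (del_verts X S) (r N)" for k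
      proof (induction k)
        case 0
        show ?case by (simp add: graph_component_def)
      next
        case (Suc k)
        have "{r (N + k), r (N + Suc k)} \<in> edges (del_verts X S)"
          using r N[of "N + k"] N[of "N + Suc k"] by (auto simp: ray_def del_verts_def)
        then show ?case
          using Suc by (auto simp: graph_component_def intro: rtrancl_into_rtrancl)
      qed
      then have "has_tail_in r (graph_component (del_verts X S) (r N))"
        unfolding has_tail_in_def by (metis le_Suc_ex)
      moreover have "r N \<in> verts (del_verts X S)"
        using r N[of N] by (auto simp: ray_def del_verts_def)
      ultimately show ?thesis by (auto simp: graph_components_def)
    qed
    note comp = this
    then have "(r, r) \<in> ray_equiv X"
      using r by (fastforce simp: ray_equiv_def)
    then have "r \<in> \<omega>" by (simp add: \<omega>)
    moreover obtain C where "C \<in> graph_components (del_verts X {})" "has_tail_in r C"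
      using comp[of "{}"] by auto
    ultimately show ?thesis
      using that by (intro bexI[of _ C]) (unfold end_nbhd_def, rule UnI2, rule imageI, blast+)
  qed
  show "Pt ` complex_points X \<union> End ` ends X \<subseteq> topspace (freudenthal X)"
    unfolding freudenthal_def topology_generated_by_topspace
  proof (intro Un_least)
    let ?\<B> = "{Pt ` U |U. complex_open X U} \<union>
      {end_nbhd X C |S C. finite S \<and> S \<subseteq> verts X \<and> C \<in> graph_components (del_verts X S)}"
    have "Pt ` complex_points X \<in> ?\<B>" using cx by blast
    then show "Pt ` complex_points X \<subseteq> \<Union> ?\<B>" by (rule Union_upper)
    show "End ` ends X \<subseteq> \<Union> ?\<B>"
    proof (intro subsetI, elim imageE)
      fix x \<omega> assume x: "x = End \<omega>" "\<omega> \<in> ends X"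
      obtain C where C: "C \<in> graph_components (del_verts X {})" "End \<omega> \<in> end_nbhd X C"
        using en[OF x(2)] by blast
      have "end_nbhd X C \<in> ?\<B>" using C(1) by (intro UnI2 CollectI exI[of _ "{}"] exI[of _ C]) simp
      then show "x \<in> \<Union> ?\<B>" using C(2) unfolding x(1) by (rule UnionI)
    qed
  qed
qed


section \<open>Hamiltonian circles\<close>

definition hamiltonian_circle :: "'a ugraph \<Rightarrow> 'a fpoint set \<Rightarrow> bool" where
  "hamiltonian_circle X K \<longleftrightarrow>
     K \<subseteq> topspace (freudenthal X) \<and>
     subtopology (freudenthal X) K homeomorphic_space top_of_set (sphere (0::complex) 1) \<and>
     Pt ` vertex_point ` verts X \<subseteq> K"

definition closure_in :: "'a ugraph \<Rightarrow> 'a ugraph \<Rightarrow> 'a fpoint set" where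
  "closure_in X H = freudenthal X closure_of (Pt ` complex_points H)"

definition hamiltonian_circle_subgraph :: "'a ugraph \<Rightarrow> 'a ugraph \<Rightarrow> bool" where
  "hamiltonian_circle_subgraph X H \<longleftrightarrow> subgraph H X \<and> hamiltonian_circle X (closure_in X H)"

end

theory Submission
  imports Defs
begin

text \<open>
  In both cases the Whitehead graph of \<open>s\<close> is a single cycle through all \<open>2n\<close> letters: \<open>s\<close> is the
  boundary word of a compact surface with one boundary component. The letters at a vertex of the
  tree \<open>Cay(F, A)\<close> are thereby cyclically ordered (by \<open>pos\<close>; the vertex itself takes the place
  \<open>0\<close>), every other vertex having the opposite orientation if the surface is non-orientable
  (\<open>eps = -1\<close>). This orders the reduced words and the ends, which are embedded in a real interval by
  an expansion in base \<open>4n - 1\<close> with even digits; the gaps of the resulting set correspond exactly to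
  the edges \<open>{g, gs}\<close>. Filling each gap with its edge and identifying the end points of the interval
  gives a continuous injection of the circle whose image is the closure of \<open>Cay(F, {s, s\<inverse>})\<close>.

  For uniqueness, removing a tree edge together with the two line edges over it separates the graph,
  so a hamiltonian circle contains at least two of these three edges. If it misses a line edge
  \<open>{g, gs}\<close>, it contains the whole tree path from \<open>g\<close> to \<open>gs\<close>; at the second vertex of this path no
  further line edge can be used, which forces three tree edges there.
\<close>

section \<open>Circles in topological spaces\<close>

text \<open>On the tree path from \<open>g\<close> to \<open>g s\<close> each of the
  \<open>2n + 1\<close> vertices is left through an item cyclically adjacent to the one through
  which it was entered; at both ends of the path the vertex itself is one of the two items. So
  nothing lies between \<open>g\<close> and \<open>g s\<close> in the order. Conversely, a path that
  keeps turning to the side of a gap reaches a vertex after at most \<open>2n\<close> letters, so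
  gaps are bounded by vertices and never by ends; this is why edges can fill them. The base
  \<open>4n - 1\<close> counts equal pieces: away from the root, one of the \<open>2n + 1\<close>
  items is the direction back to the root, and the remaining \<open>2n\<close> slots are separated
  by \<open>2n - 1\<close> gaps. The lines do not merge ends of the tree, because a line edge
  changes at most the last \<open>2n\<close> letters of a word. For uniqueness, each generator
  occurs twice in \<open>s\<close>, so at most two lines cross a tree edge. The cut then has three
  edges, and it must still be crossed after one point of the circle is removed, since a punctured
  circle is connected.\<close>

definition circle_in :: "'a topology \<Rightarrow> 'a set \<Rightarrow> bool" where
  "circle_in Y K \<longleftrightarrow>
     K \<subseteq> topspace Y \<and> subtopology Y K homeomorphic_space top_of_set (sphere (0::complex) 1)"

lemma punctured_circle_homeomorphism:
  assumes "z \<in> sphere (0::complex) 1"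
  obtains h k where "homeomorphism (sphere 0 1 - {z}) (UNIV :: real set) h k"
proof -
  have "(sphere (0::complex) 1 - {z}) homeomorphic (UNIV :: real set)"
    using assms by (intro homeomorphic_punctured_sphere_affine) auto
  then show ?thesis using that unfolding homeomorphic_def by blast
qed

lemma connected_punctured_circle:
  assumes "z \<in> sphere (0::complex) 1"
  shows "connected (sphere 0 1 - {z})"
proof -
  obtain h k where "homeomorphism (sphere 0 1 - {z}) (UNIV :: real set) h k"
    using punctured_circle_homeomorphism[OF assms] .
  then have "sphere 0 1 - {z} = k ` (UNIV :: real set)" "continuous_on (UNIV :: real set) k"
    by (auto simp: homeomorphism_def)
  then show ?thesis by (metis connected_UNIV connected_continuous_image)
qed

lemma homeomorphism_closure_point:
  fixes h :: "'a::metric_space \<Rightarrow> 'b::metric_space"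
  assumes "continuous_on S h" "T \<subseteq> S" "q \<in> S" "q \<in> closure T"
  shows "h q \<in> closure (h ` T)"
proof -
  obtain x where x: "\<And>n. x n \<in> T" "x \<longlonglongrightarrow> q"
    using assms(4) by (auto simp: closure_sequential)
  then have "(h \<circ> x) \<longlonglongrightarrow> h q"
    using assms(1-3) unfolding continuous_on_sequentially by blast
  then show ?thesis
    unfolding closure_sequential using x(1) by (intro exI[of _ "h \<circ> x"]) auto
qed

text \<open>Puncturing at \<open>p\<close> turns the circle into a line. There a connected set that
  misses the images of \<open>q\<close> and \<open>r\<close> but accumulates at both lies between
  them, hence inside a compact arc that avoids \<open>p\<close>; so \<open>p\<close> cannot be in
  its closure.\<close>

lemma no_triod_circle:
  fixes T :: "complex set"
  assumes T: "connected T" "T \<subseteq> sphere 0 1 - {p, q, r}"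
    and S: "p \<in> sphere 0 1" "q \<in> sphere 0 1" "r \<in> sphere 0 1"
    and ne: "p \<noteq> q" "p \<noteq> r" "q \<noteq> r"
    and cl: "p \<in> closure T" "q \<in> closure T" "r \<in> closure T"
  shows False
proof -
  obtain h k where hk: "homeomorphism (sphere 0 1 - {p}) (UNIV :: real set) h k"
    using punctured_circle_homeomorphism[OF S(1)] .
  have h: "continuous_on (sphere 0 1 - {p}) h" and k: "continuous_on UNIV k"
    and kh: "\<And>x. x \<in> sphere 0 1 - {p} \<Longrightarrow> k (h x) = x" and kim: "k ` UNIV = sphere 0 1 - {p}"
    using hk by (auto simp: homeomorphism_def)
  have T': "connected (h ` T)"
    using T by (intro connected_continuous_image continuous_on_subset[OF h]) auto
  have cl': "h x \<in> closure (h ` T)" if "x \<in> {q, r}" for x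
    using T(2) S ne cl that by (intro homeomorphism_closure_point[OF h]) auto
  have notin: "h x \<notin> h ` T" if "x \<in> {q, r}" for x
  proof
    assume "h x \<in> h ` T"
    then obtain y where "y \<in> T" "h x = h y" by auto
    then have "x = y" using kh[of x] kh[of y] T(2) that S ne by auto
    then show False using \<open>y \<in> T\<close> T(2) that by auto
  qed
  have key: False if "{a, b} = {q, r}" "h a < h b" for a b
  proof -
    have ab: "a \<in> {q, r}" "b \<in> {q, r}" using that(1) by auto
    note lt = that(2)
    have sub: "h ` T \<subseteq> {h a..h b}"
    proof
      fix t assume t: "t \<in> h ` T"
      show "t \<in> {h a..h b}"
      proof (rule ccontr)
        assume "t \<notin> {h a..h b}"
        then consider "t < h a" | "t > h b" by fastforce
        then show False
        proof cases
          case 1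
          \<comment> \<open>\<open>T\<close> has points close to the image of \<open>b\<close>,
            beyond that of \<open>a\<close>; by connectedness it would have to contain the image of
            \<open>a\<close>.\<close>
          obtain t' where "t' \<in> h ` T" "dist t' (h b) < h b - h a"
            using cl'[OF ab(2)] lt unfolding closure_approachable by (metis diff_gt_0_iff_gt)
          then have "h a \<in> h ` T"
            using connectedD_interval[OF T' t, of t' "h a"] 1 by (auto simp: dist_real_def)
          then show False using notin ab by blast
        next
          case 2
          obtain t' where "t' \<in> h ` T" "dist t' (h a) < h b - h a"
            using cl'[OF ab(1)] lt unfolding closure_approachable by (metis diff_gt_0_iff_gt)
          then have "h b \<in> h ` T"
            using connectedD_interval[OF T' _ t, of t' "h b"] 2 by (auto simp: dist_real_def)
          then show False using notin ab by blast
        qed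
      qed
    qed
    have "T \<subseteq> k ` {h a..h b}"
    proof
      fix x assume "x \<in> T"
      then show "x \<in> k ` {h a..h b}"
        using sub T(2) kh[of x] by (intro image_eqI[of _ _ "h x"]) auto
    qed
    moreover have "closed (k ` {h a..h b})"
      by (intro compact_imp_closed compact_continuous_image continuous_on_subset[OF k]) auto
    ultimately have "closure T \<subseteq> k ` {h a..h b}" by (rule closure_minimal)
    then show False using cl(1) kim by auto
  qed
  have "h q \<noteq> h r" using kh[of q] kh[of r] S ne by auto
  then show False using key[of q r] key[of r q] by (metis insert_commute linorder_neq_iff)
qed

text \<open>A proper subset misses some point, and the punctured circle is a line, so
  \<open>A\<close> becomes an interval and any point strictly between two of its points separates
  it. A full circle has no such point.\<close>

lemma proper_subcontinuum_circle_cut: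
  fixes A :: "complex set"
  assumes A: "connected A" "A \<subset> sphere 0 1" and ab: "a \<in> A" "b \<in> A" "a \<noteq> b"
  shows "\<exists>c\<in>A. \<not> connected (A - {c})"
proof -
  obtain p where p: "p \<in> sphere 0 1" "p \<notin> A" using A(2) by blast
  obtain h k where hk: "homeomorphism (sphere 0 1 - {p}) (UNIV :: real set) h k"
    using punctured_circle_homeomorphism[OF p(1)] .
  have h: "continuous_on (sphere 0 1 - {p}) h"
    and kh: "\<And>x. x \<in> sphere 0 1 - {p} \<Longrightarrow> k (h x) = x"
    using hk by (auto simp: homeomorphism_def)
  have sub: "A \<subseteq> sphere 0 1 - {p}" using A p by auto
  have inj: "x = y" if "x \<in> A" "y \<in> A" "h x = h y" for x y
    using kh[of x] kh[of y] sub that by (metis subsetD)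
  have conn: "connected (h ` B)" if "connected B" "B \<subseteq> A" for B
    using that sub by (intro connected_continuous_image continuous_on_subset[OF h]) auto
  have key: "\<exists>c\<in>A. \<not> connected (A - {c})" if "x \<in> A" "y \<in> A" "h x < h y" for x y
  proof -
    define z where "z = (h x + h y) / 2"
    have z: "h x < z" "z < h y" using that(3) by (auto simp: z_def field_simps)
    have "z \<in> h ` A"
      using connectedD_interval[OF conn[OF A(1) subset_refl], of "h x" "h y" z] that z by auto
    then obtain c where c: "c \<in> A" "h c = z" by auto
    have "\<not> connected (A - {c})"
    proof
      assume "connected (A - {c})"
      then have "connected (h ` (A - {c}))" by (intro conn) auto
      then have "z \<in> h ` (A - {c})"
        using connectedD_interval[of "h ` (A - {c})" "h x" "h y" z] that z c by auto
      then show False using inj c by auto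
    qed
    then show ?thesis using c by blast
  qed
  have "h a \<noteq> h b" using inj ab by blast
  then show ?thesis using key ab by (cases "h a < h b") (auto simp: not_less order_le_less)
qed

lemma circle_in_maps:
  assumes "circle_in Y K"
  obtains f g where "homeomorphic_maps (subtopology Y K) (top_of_set (sphere (0::complex) 1)) f g"
    "continuous_map (subtopology Y K) euclidean f" "f ` K = sphere 0 1" "inj_on f K"
    "\<And>x. x \<in> K \<Longrightarrow> g (f x) = x" "continuous_map (top_of_set (sphere 0 1)) Y g"
proof -
  have K: "topspace (subtopology Y K) = K"
    using assms by (auto simp: circle_in_def)
  obtain f g where fg: "homeomorphic_maps (subtopology Y K) (top_of_set (sphere (0::complex) 1)) f g"
    using assms by (auto simp: circle_in_def homeomorphic_space_def)
  have "homeomorphic_map (subtopology Y K) (top_of_set (sphere (0::complex) 1)) f"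
    using fg homeomorphic_maps_map by blast
  then have "f ` K = sphere 0 1" "inj_on f K"
    using K by (auto simp: homeomorphic_eq_everything_map)
  moreover have "continuous_map (subtopology Y K) euclidean f" "continuous_map (top_of_set (sphere 0 1)) Y g"
    "\<And>x. x \<in> K \<Longrightarrow> g (f x) = x"
    using fg K by (auto simp: homeomorphic_maps_def continuous_map_in_subtopology)
  ultimately show ?thesis using that fg by blast
qed

lemma connectedin_circle_minus_point:
  assumes "circle_in Y K"
  shows "connectedin Y (K - {x})"
proof -
  obtain f g where fg: "f ` K = sphere 0 1" "inj_on f K" "\<And>x. x \<in> K \<Longrightarrow> g (f x) = x"
      "continuous_map (top_of_set (sphere (0::complex) 1)) Y g"
    using circle_in_maps[OF assms] by metis
  have "connectedin (top_of_set (sphere 0 1)) (f ` (K - {x}))"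
  proof (cases "x \<in> K")
    case True
    have "f ` (K - {x}) = sphere 0 1 - {f x}"
      using fg(1,2) True by (auto simp: inj_on_def)
    moreover have "f x \<in> sphere 0 1" using fg(1) True by blast
    ultimately show ?thesis
      using connected_punctured_circle[of "f x"] by (simp add: connectedin_subtopology)
  next
    case False
    then show ?thesis using fg(1) by (simp add: connectedin_subtopology connected_sphere)
  qed
  then have "connectedin Y (g ` f ` (K - {x}))"
    by (rule connectedin_continuous_map_image[OF fg(4)])
  moreover have "g ` f ` (K - {x}) = K - {x}" using fg(3) by force
  ultimately show ?thesis by simp
qed

lemma compactin_circle:
  assumes "circle_in Y K"
  shows "compactin Y K"
proof -
  have "compact_space (subtopology Y K)"
    using assms unfolding circle_in_def
    by (metis compact_sphere compact_space_subtopology compactin_euclidean_iff homeomorphic_compact_space)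
  then show ?thesis using assms by (simp add: circle_in_def compactin_subspace)
qed

text \<open>This is the source of the degree bound: \<open>T\<close> will consist of three
  half-edges at a common vertex, with \<open>p\<close>, \<open>q\<close>, \<open>r\<close> the
  midpoints of the edges.\<close>

lemma no_triod:
  assumes K: "circle_in Y K" and T: "connectedin Y T" "T \<subseteq> K - {p, q, r}"
    and S: "p \<in> K" "q \<in> K" "r \<in> K"
    and ne: "p \<noteq> q" "p \<noteq> r" "q \<noteq> r"
    and cl: "{p, q, r} \<subseteq> Y closure_of T"
  shows False
proof -
  obtain f g where fg: "f ` K = sphere 0 1" "inj_on f K" "\<And>x. x \<in> K \<Longrightarrow> g (f x) = x"
      "continuous_map (subtopology Y K) (euclidean :: complex topology) f"
    using circle_in_maps[OF K] by metis
  have "connectedin (subtopology Y K) T" using T by (auto simp: connectedin_subtopology)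
  then have conn: "connected (f ` T)"
    using connectedin_continuous_map_image[OF fg(4)] by force
  have KT: "K \<inter> T = T" using T(2) by auto
  have "{p, q, r} \<subseteq> subtopology Y K closure_of T"
    using cl S \<open>T \<subseteq> K - {p, q, r}\<close> by (auto simp: closure_of_subtopology KT)
  then have "f ` {p, q, r} \<subseteq> euclidean closure_of (f ` T)"
    using continuous_map_image_closure_subset[OF fg(4), of T] by blast
  then have cl': "f p \<in> closure (f ` T)" "f q \<in> closure (f ` T)" "f r \<in> closure (f ` T)" by auto
  show False
  proof (rule no_triod_circle[OF conn])
    show "f ` T \<subseteq> sphere 0 1 - {f p, f q, f r}"
      using T(2) fg(1,2) S by (auto simp: inj_on_def)
  qed (use fg(1,2) S ne cl' in \<open>auto simp: inj_on_def\<close>)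
qed

text \<open>If \<open>L\<close> were a proper subset, its image in the model circle would be a
  proper connected set with at least two points, hence with a cut point; but a circle stays
  connected when a point is removed.\<close>

lemma circle_subset_circle:
  assumes K: "circle_in Y K" and L: "circle_in Y L" and "L \<subseteq> K"
  shows "L = K"
proof (rule ccontr)
  assume "L \<noteq> K"
  obtain f g where fg: "f ` K = sphere 0 1" "inj_on f K"
      "continuous_map (subtopology Y K) (euclidean :: complex topology) f"
    using circle_in_maps[OF K] by metis
  obtain f' where f': "f' ` L = sphere (0::complex) 1" "inj_on f' L"
    using circle_in_maps[OF L] by metis
  have conn: "connected (f ` (L - {x}))" for x
  proof -
    have "connectedin (subtopology Y K) (L - {x})"
      using connectedin_circle_minus_point[OF L] \<open>L \<subseteq> K\<close> by (auto simp: connectedin_subtopology)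
    then show ?thesis using connectedin_continuous_map_image[OF fg(3)] by force
  qed
  have "{1, - 1} \<subseteq> f' ` L" unfolding f'(1) by auto
  then obtain a b where ab: "a \<in> L" "b \<in> L" "f' a = 1" "f' b = -1"
    unfolding image_iff insert_subset by (metis)
  then have "a \<noteq> b" by auto
  have "f ` L \<subset> sphere 0 1"
    using \<open>L \<noteq> K\<close> \<open>L \<subseteq> K\<close> fg(1,2) by (metis image_mono inj_on_image_eq_iff psubsetI subset_refl)
  moreover have "connected (f ` L)"
  proof -
    obtain z where "z \<notin> L" using \<open>L \<noteq> K\<close> \<open>L \<subseteq> K\<close> by blast
    then show ?thesis using conn[of z] by simp
  qed
  ultimately obtain c where c: "c \<in> f ` L" "\<not> connected (f ` L - {c})"
    using proper_subcontinuum_circle_cut[of "f ` L" "f a" "f b"] ab \<open>a \<noteq> b\<close> fg(2) \<open>L \<subseteq> K\<close>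
    by (metis image_eqI inj_onD subsetD)
  then obtain x where x: "x \<in> L" "c = f x" by auto
  have "f ` L - {c} = f ` (L - {x})" using x fg(2) \<open>L \<subseteq> K\<close> by (auto simp: inj_on_def)
  then show False using conn[of x] c(2) by simp
qed

text \<open>Wrapping the interval once around the unit circle is a quotient map, being a continuous
  surjection from a compact onto a Hausdorff space. Since \<open>f\<close> agrees at the two ends it
  factors through this map, and the factor is a continuous injection from a compact into a Hausdorff
  space, hence an embedding.\<close>

lemma circle_in_closed_path:
  fixes f :: "real \<Rightarrow> 'a"
  assumes f: "continuous_map (top_of_set {a..b}) Y f" and "a < b" and eq: "f a = f b"
    and inj: "inj_on f {a..<b}" and Y: "Hausdorff_space Y"
  shows "circle_in Y (f ` {a..b})"
proof -
  define q where "q t = cis (2 * pi * ((t - a) / (b - a)))" for t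
  have q_cont: "continuous_map (top_of_set {a..b}) (top_of_set (sphere 0 1)) q"
    unfolding q_def using \<open>a < b\<close> by (auto intro!: continuous_intros)
  have q_onto: "q ` {a..b} = sphere 0 1"
  proof
    show "q ` {a..b} \<subseteq> sphere 0 1" by (auto simp: q_def)
    show "sphere 0 1 \<subseteq> q ` {a..b}"
    proof
      fix z :: complex assume "z \<in> sphere 0 1"
      then obtain u where u: "0 \<le> u" "u < 2 * pi" "z = cis u"
        using complex_unimodular_polar[of z] by (metis cis.ctr mem_sphere_0)
      show "z \<in> q ` {a..b}"
      proof
        show "z = q (a + u / (2 * pi) * (b - a))" using u \<open>a < b\<close> by (simp add: q_def)
        have "u / (2 * pi) * (b - a) \<le> 1 * (b - a)"
          using u \<open>a < b\<close> by (intro mult_right_mono) (auto simp: field_simps)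
        then show "a + u / (2 * pi) * (b - a) \<in> {a..b}"
          using u \<open>a < b\<close> by auto
      qed
    qed
  qed
  have quot: "quotient_map (top_of_set {a..b}) (top_of_set (sphere 0 1)) q"
    using q_cont q_onto
    by (intro T1_Spaces.continuous_imp_quotient_map)
      (auto simp: compact_space_subtopology Hausdorff_space_subtopology)
  have q_inj: "t = t'" if "q t = q t'" "t \<in> {a..<b}" "t' \<in> {a..<b}" for t t'
  proof -
    define u u' where "u = (t - a) / (b - a)" "u' = (t' - a) / (b - a)"
    have u: "0 \<le> u" "u < 1" "0 \<le> u'" "u' < 1"
      using that \<open>a < b\<close> by (auto simp: u_u'_def field_simps)
    have "sin (2 * pi * u) = sin (2 * pi * u')" "cos (2 * pi * u) = cos (2 * pi * u')"
      using that(1) by (auto simp: q_def u_u'_def complex_eq_iff)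
    then obtain n where "2 * pi * u = 2 * pi * u' + 2 * pi * of_int n"
      using sin_cos_eq_iff[of "2 * pi * u" "2 * pi * u'"] by blast
    then have "2 * pi * u = 2 * pi * (u' + of_int n)" by (simp add: algebra_simps)
    then have "u = u' + of_int n" by simp
    then have "n = 0" using u by linarith
    then have "u = u'" using \<open>u = u' + of_int n\<close> by simp
    then show ?thesis using \<open>a < b\<close> by (simp add: u_u'_def)
  qed
  have q_b: "q b = q a" using \<open>a < b\<close> by (simp add: q_def)
  \<comment> \<open>\<open>r\<close> replaces the right end point by the left one, so that
    injectivity on the half-open interval settles all cases.\<close>
  define r where "r t = (if t = b then a else t)" for t
  have r: "r t \<in> {a..<b}" "q (r t) = q t" "f (r t) = f t" if "t \<in> {a..b}" for t
    using that \<open>a < b\<close> eq q_b by (auto simp: r_def)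
  obtain g where g: "continuous_map (top_of_set (sphere 0 1)) Y g"
    "g ` sphere 0 1 = f ` {a..b}" "\<And>t. t \<in> {a..b} \<Longrightarrow> g (q t) = f t"
  proof (rule quotient_map_lift_exists[OF quot f])
    fix x y assume "x \<in> topspace (top_of_set {a..b})" "y \<in> topspace (top_of_set {a..b})" "q x = q y"
    then show "f x = f y" using r[of x] r[of y] q_inj[of "r x" "r y"] by simp
  qed (use that in auto)
  have g_inj: "inj_on g (sphere 0 1)"
  proof (rule inj_onI)
    fix x y assume "x \<in> sphere 0 1" "y \<in> sphere 0 1" and eq: "g x = g y"
    then obtain t t' where t: "t \<in> {a..b}" "t' \<in> {a..b}" "x = q t" "y = q t'"
      using q_onto by (metis imageE)
    then have "f (r t) = f (r t')" using g(3) eq r by metis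
    then have "r t = r t'" using inj r t by (metis inj_onD)
    then show "x = y" using t r by metis
  qed
  have sub: "f ` {a..b} \<subseteq> topspace Y"
    using continuous_map_image_subset_topspace[OF f] by simp
  have "homeomorphic_map (top_of_set (sphere 0 1)) (subtopology Y (f ` {a..b})) g"
    using g g_inj sub Y
    by (intro continuous_imp_homeomorphic_map)
      (auto simp: compact_space_subtopology Hausdorff_space_subtopology continuous_map_in_subtopology Int_absorb1)
  then show ?thesis
    unfolding circle_in_def
    using sub homeomorphic_map_imp_homeomorphic_space homeomorphic_space_sym by blast
qed

section \<open>The Freudenthal compactification of a locally finite graph\<close>

text \<open>The total barycentric weight on \<open>A\<close>. Summing over the support only keeps
  the sum finite for infinite \<open>A\<close>. Open stars of components and the two sides of a cut
  become preimages of half-lines under this function.\<close>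

definition mass :: "'a set \<Rightarrow> ('a \<Rightarrow> real) \<Rightarrow> real" where
  "mass A p = sum p {v \<in> A. p v \<noteq> 0}"

lemma mass_eq_sum:
  assumes "finite S" "\<And>v. p v \<noteq> 0 \<Longrightarrow> v \<in> S"
  shows "mass A p = sum p (A \<inter> S)"
  unfolding mass_def using assms by (intro sum.mono_neutral_left) auto

lemma mass_edge_point:
  assumes "u \<noteq> v"
  shows "mass A (edge_point u v t) = (1 - t) * of_bool (u \<in> A) + t * of_bool (v \<in> A)"
proof -
  have "mass A (edge_point u v t) = sum (edge_point u v t) (A \<inter> {u, v})"
    by (rule mass_eq_sum) (auto simp: edge_point_def split: if_splits)
  also have "A \<inter> {u, v} = (if u \<in> A then {u} else {}) \<union> (if v \<in> A then {v} else {})" by auto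
  finally show ?thesis using assms by (auto simp: edge_point_def)
qed

lemma vertex_point_eq_edge_point: "vertex_point v = edge_point v w 0"
  by (auto simp: vertex_point_def edge_point_def)

lemma edge_point_1: "edge_point v w 1 = vertex_point w"
  by (auto simp: vertex_point_def edge_point_def)

lemma edge_point_swap: "edge_point v u t = edge_point u v (1 - t)"
  by (auto simp: edge_point_def algebra_simps)

lemma mass_vertex_point: "mass A (vertex_point v) = of_bool (v \<in> A)"
proof -
  have "mass A (vertex_point v) = sum (vertex_point v) (A \<inter> {v})"
    by (rule mass_eq_sum) (auto simp: vertex_point_def split: if_splits)
  then show ?thesis by (auto simp: vertex_point_def)
qed

lemma mass_singleton [simp]: "mass {w} p = p w"
  by (auto simp: mass_def Collect_conv_if)

lemma edge_point_inj:
  assumes "u \<noteq> v" "edge_point u v t = edge_point u v t'"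
  shows "t = t'"
  using fun_cong[OF assms(2), of v] assms(1) by (simp add: edge_point_def)

section \<open>Components, rays and ends\<close>

lemma component_self: "v \<in> graph_component X v"
  by (simp add: graph_component_def)

lemma sym_adjacency: "sym {(x, y). {x, y} \<in> edges X}"
  by (auto simp: sym_def insert_commute)

lemma graph_component_eq:
  assumes "w \<in> graph_component X v"
  shows "graph_component X w = graph_component X v"
proof -
  let ?R = "{(x, y). {x, y} \<in> edges X}\<^sup>*"
  have "(v, w) \<in> ?R" "(w, v) \<in> ?R"
    using assms symD[OF sym_rtrancl[OF sym_adjacency[of X]]] by (auto simp: graph_component_def)
  then show ?thesis unfolding graph_component_def by (blast intro: rtrancl_trans)
qed

lemma graph_components_eq:
  assumes "C \<in> graph_components X" "C' \<in> graph_components X" "x \<in> C" "x \<in> C'"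
  shows "C = C'"
  using assms graph_component_eq unfolding graph_components_def by (metis imageE)

lemma graph_components_closed:
  assumes "C \<in> graph_components X" "u \<in> C" "{u, v} \<in> edges X"
  shows "v \<in> C"
  using assms unfolding graph_components_def graph_component_def
  by (auto intro: rtrancl_into_rtrancl)

lemma graph_component_induct:
  assumes "y \<in> graph_component X x" "P x"
    and "\<And>u v. P u \<Longrightarrow> {u, v} \<in> edges X \<Longrightarrow> P v"
  shows "P y"
proof -
  have "(x, y) \<in> {(x, y). {x, y} \<in> edges X}\<^sup>*" using assms(1) by (simp add: graph_component_def)
  then show ?thesis by (induction rule: rtrancl_induct) (use assms(2,3) in auto)
qed

lemma verts_del_verts [simp]: "verts (del_verts X S) = verts X - S"
  by (simp add: del_verts_def)

lemma edges_del_verts: "{u, v} \<in> edges (del_verts X S) \<longleftrightarrow> {u, v} \<in> edges X \<and> u \<notin> S \<and> v \<notin> S"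
  by (auto simp: del_verts_def)

lemma ray_inverse_finite:
  assumes "ray X r" "finite S"
  obtains N where "\<And>i. i \<ge> N \<Longrightarrow> r i \<notin> S"
proof -
  have "finite (r -` S)" using assms by (auto simp: ray_def intro: finite_vimageI)
  then obtain N where N: "\<And>i. r i \<in> S \<Longrightarrow> i < N" using finite_nat_set_iff_bounded by (metis vimageI)
  show ?thesis
  proof (rule that)
    fix i assume "N \<le> i"
    then show "r i \<notin> S" using N[of i] by linarith
  qed
qed

lemma ray_component:
  assumes r: "ray X r" and S: "finite S"
  obtains C where "C \<in> graph_components (del_verts X S)" "has_tail_in r C"
proof -
  obtain N where N: "\<And>i. i \<ge> N \<Longrightarrow> r i \<notin> S" using ray_inverse_finite[OF r S] by blast
  have "r (N + k) \<in> graph_component (del_verts X S) (r N)" for k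
  proof (induction k)
    case 0
    show ?case by (simp add: component_self)
  next
    case (Suc k)
    have "{r (N + k), r (N + Suc k)} \<in> edges (del_verts X S)"
      using r N[of "N + k"] N[of "N + Suc k"] by (auto simp: ray_def edges_del_verts)
    then show ?case
      using Suc by (auto simp: graph_component_def intro: rtrancl_into_rtrancl)
  qed
  then have "has_tail_in r (graph_component (del_verts X S) (r N))"
    unfolding has_tail_in_def by (metis le_Suc_ex)
  moreover have "r N \<in> verts (del_verts X S)" using r N[of N] by (auto simp: ray_def)
  ultimately show ?thesis using that by (auto simp: graph_components_def)
qed

lemma has_tail_in_unique:
  assumes "C \<in> graph_components Y" "C' \<in> graph_components Y" "has_tail_in r C" "has_tail_in r C'"
  shows "C = C'"
proof -
  obtain N N' where "\<And>i. i \<ge> N \<Longrightarrow> r i \<in> C" "\<And>i. i \<ge> N' \<Longrightarrow> r i \<in> C'"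
    using assms(3,4) by (auto simp: has_tail_in_def)
  then have "r (max N N') \<in> C" "r (max N N') \<in> C'" by auto
  then show ?thesis by (rule graph_components_eq[OF assms(1,2)])
qed

lemma equiv_ray_equiv: "equiv {r. ray X r} (ray_equiv X)"
proof (rule equivI)
  show "ray_equiv X \<subseteq> {r. ray X r} \<times> {r. ray X r}" by (auto simp: ray_equiv_def)
  have "(r, r) \<in> ray_equiv X" if "ray X r" for r
  proof -
    have "\<exists>C\<in>graph_components (del_verts X S). has_tail_in r C" if "finite S" for S
      by (rule ray_component[OF \<open>ray X r\<close> that]) blast
    then show ?thesis using \<open>ray X r\<close> by (simp add: ray_equiv_def)
  qed
  then show "refl_on {r. ray X r} (ray_equiv X)"
    by (auto simp: refl_on_def)
  show "sym (ray_equiv X)"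
  proof (rule symI)
    fix a b assume ab: "(a, b) \<in> ray_equiv X"
    have "\<exists>C\<in>graph_components (del_verts X S). has_tail_in b C \<and> has_tail_in a C"
      if "finite S" "S \<subseteq> verts X" for S
      using ab that unfolding ray_equiv_def by blast
    then show "(b, a) \<in> ray_equiv X" using ab by (simp add: ray_equiv_def)
  qed
  \<comment> \<open>A tail of \<open>b\<close> lies in only one component of the graph without
    \<open>S\<close>, so the components witnessing the two equivalences coincide.\<close>
  show "trans (ray_equiv X)"
  proof (rule transI)
    fix a b c assume ab: "(a, b) \<in> ray_equiv X" and bc: "(b, c) \<in> ray_equiv X"
    have "\<exists>C\<in>graph_components (del_verts X S). has_tail_in a C \<and> has_tail_in c C"
      if S: "finite S" "S \<subseteq> verts X" for S
    proof -
      obtain C where C: "C \<in> graph_components (del_verts X S)" "has_tail_in a C" "has_tail_in b C"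
        using ab S by (auto simp: ray_equiv_def)
      obtain D where D: "D \<in> graph_components (del_verts X S)" "has_tail_in b D" "has_tail_in c D"
        using bc S by (auto simp: ray_equiv_def)
      have "C = D" using has_tail_in_unique C D by blast
      then show ?thesis using C D by blast
    qed
    then show "(a, c) \<in> ray_equiv X" using ab bc by (auto simp: ray_equiv_def)
  qed
qed

lemma ends_ray: "\<omega> \<in> ends X \<Longrightarrow> r \<in> \<omega> \<Longrightarrow> ray X r"
  using in_quotient_imp_subset[OF equiv_ray_equiv, of \<omega> X] by (auto simp: ends_def)

lemma ends_ray_equiv: "\<omega> \<in> ends X \<Longrightarrow> r \<in> \<omega> \<Longrightarrow> r' \<in> \<omega> \<Longrightarrow> (r, r') \<in> ray_equiv X"
  using in_quotient_imp_in_rel[OF equiv_ray_equiv, of \<omega> X r r'] by (simp add: ends_def)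

lemma ends_nonempty: "\<omega> \<in> ends X \<Longrightarrow> \<exists>r. r \<in> \<omega>"
  using in_quotient_imp_non_empty[OF equiv_ray_equiv, of \<omega> X] by (auto simp: ends_def)

lemma ends_component:
  assumes "\<omega> \<in> ends X" "finite S"
  obtains C where "C \<in> graph_components (del_verts X S)" "End \<omega> \<in> end_nbhd X C"
proof -
  obtain r where r: "r \<in> \<omega>" using ends_nonempty assms(1) by blast
  obtain C where "C \<in> graph_components (del_verts X S)" "has_tail_in r C"
    using ray_component[OF ends_ray[OF assms(1) r] assms(2)] .
  moreover from this have "End \<omega> \<in> end_nbhd X C" using r assms(1) by (auto simp: end_nbhd_def)
  ultimately show ?thesis using that by blast
qed

lemma End_in_end_nbhd_unique:
  assumes S: "finite S" "S \<subseteq> verts X"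
    and C: "C \<in> graph_components (del_verts X S)" "C' \<in> graph_components (del_verts X S)"
    and \<omega>: "End \<omega> \<in> end_nbhd X C" "End \<omega> \<in> end_nbhd X C'"
  shows "C = C'"
proof -
  obtain r r' where r: "\<omega> \<in> ends X" "r \<in> \<omega>" "has_tail_in r C" "r' \<in> \<omega>" "has_tail_in r' C'"
    using \<omega> by (auto simp: end_nbhd_def)
  then obtain D where "D \<in> graph_components (del_verts X S)" "has_tail_in r D" "has_tail_in r' D"
    using ends_ray_equiv[of \<omega> X r r'] S unfolding ray_equiv_def by blast
  then show ?thesis using r C has_tail_in_unique by metis
qed

lemma openin_Pt: "complex_open X U \<Longrightarrow> openin (freudenthal X) (Pt ` U)"
  unfolding freudenthal_def by (rule topology_generated_by_Basis) blast

lemma openin_end_nbhd: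
  assumes "finite S" "S \<subseteq> verts X" "C \<in> graph_components (del_verts X S)"
  shows "openin (freudenthal X) (end_nbhd X C)"
  unfolding freudenthal_def using assms by (intro topology_generated_by_Basis) blast

lemma continuous_map_into_freudenthal:
  assumes f: "f \<in> topspace T \<rightarrow> topspace (freudenthal X)"
    and 1: "\<And>U. complex_open X U \<Longrightarrow> openin T {x \<in> topspace T. f x \<in> Pt ` U}"
    and 2: "\<And>S C. finite S \<Longrightarrow> S \<subseteq> verts X \<Longrightarrow> C \<in> graph_components (del_verts X S) \<Longrightarrow>
      openin T {x \<in> topspace T. f x \<in> end_nbhd X C}"
  shows "continuous_map T (freudenthal X) f"
  unfolding freudenthal_def
proof (rule continuous_on_generated_topo)
  fix U assume "U \<in> {Pt ` U |U. complex_open X U} \<union>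
      {end_nbhd X C |S C. finite S \<and> S \<subseteq> verts X \<and> C \<in> graph_components (del_verts X S)}"
  then have "openin T {x \<in> topspace T. f x \<in> U}"
  proof (elim UnE CollectE exE conjE)
    fix V assume "U = Pt ` V" "complex_open X V"
    then show ?thesis using 1 by simp
  next
    fix S C assume "U = end_nbhd X C" "finite S" "S \<subseteq> verts X" "C \<in> graph_components (del_verts X S)"
    then show ?thesis using 2 by simp
  qed
  moreover have "f -` U \<inter> topspace T = {x \<in> topspace T. f x \<in> U}" by auto
  ultimately show "openin T (f -` U \<inter> topspace T)" by simp
next
  show "f ` topspace T \<subseteq> \<Union> ({Pt ` U |U. complex_open X U} \<union>
      {end_nbhd X C |S C. finite S \<and> S \<subseteq> verts X \<and> C \<in> graph_components (del_verts X S)})"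
    using f unfolding freudenthal_def topology_generated_by_topspace by (rule funcset_image)
qed

locale lf_graph =
  fixes X :: "'a ugraph"
  assumes edge_pair: "e \<in> edges X \<Longrightarrow> \<exists>u\<in>verts X. \<exists>v\<in>verts X. u \<noteq> v \<and> e = {u, v}"
    and locally_finite: "v \<in> verts X \<Longrightarrow> finite {w. {v, w} \<in> edges X}"
begin

lemma edgeD: "{u, v} \<in> edges X \<Longrightarrow> u \<in> verts X \<and> v \<in> verts X \<and> u \<noteq> v"
  using edge_pair[of "{u, v}"] by (auto simp: doubleton_eq_iff)

lemma complex_point_cases:
  assumes "p \<in> complex_points X"
  obtains v where "v \<in> verts X" "p = vertex_point v"
  | u v t where "{u, v} \<in> edges X" "u \<noteq> v" "0 < t" "t < 1" "p = edge_point u v t"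
proof -
  consider v where "v \<in> verts X" "p = vertex_point v"
    | u v t where "{u, v} \<in> edges X" "0 \<le> t" "t \<le> 1" "p = edge_point u v t"
    using assms by (auto simp: complex_points_def)
  then show ?thesis
  proof cases
    case (2 u v t)
    consider "t = 0" | "t = 1" | "0 < t" "t < 1" using 2 by linarith
    then show ?thesis
    proof cases
      case 1
      then show ?thesis using that(1)[of u] 2 edgeD by (metis vertex_point_eq_edge_point)
    next
      case a: 2
      then show ?thesis using that(1)[of v] 2 edgeD by (metis edge_point_1)
    next
      case 3
      then show ?thesis using that(2) 2 edgeD by blast
    qed
  qed (use that in blast)
qed

lemma complex_point_nonneg: "p \<in> complex_points X \<Longrightarrow> 0 \<le> p v"
  by (erule complex_point_cases) (auto simp: vertex_point_def edge_point_def)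

lemma complex_point_support:
  assumes "p \<in> complex_points X"
  shows "finite {v. p v \<noteq> 0}" "{v. p v \<noteq> 0} \<subseteq> verts X" "{v. p v \<noteq> 0} \<noteq> {}"
  using assms
proof (atomize (full), cases rule: complex_point_cases)
  case (1 v)
  then show "finite {v. p v \<noteq> 0} \<and> {v. p v \<noteq> 0} \<subseteq> verts X \<and> {v. p v \<noteq> 0} \<noteq> {}"
    by (auto simp: vertex_point_def)
next
  case (2 u v t)
  have "{v. p v \<noteq> 0} = {u, v}" using 2 by (auto simp: edge_point_def)
  then show "finite {v. p v \<noteq> 0} \<and> {v. p v \<noteq> 0} \<subseteq> verts X \<and> {v. p v \<noteq> 0} \<noteq> {}"
    using edgeD 2 by auto
qed

lemma complex_point_adjacent:
  assumes "p \<in> complex_points X" "p u \<noteq> 0" "p v \<noteq> 0" "u \<noteq> v"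
  shows "{u, v} \<in> edges X"
  using assms(1)
proof (cases rule: complex_point_cases)
  case (1 w)
  then show ?thesis using assms by (auto simp: vertex_point_def)
next
  case (2 a b t)
  then have "{u, v} = {a, b}" using assms by (auto simp: edge_point_def split: if_splits)
  then show ?thesis using 2 by simp
qed

lemma mass_pos_iff:
  assumes "p \<in> complex_points X"
  shows "mass A p > 0 \<longleftrightarrow> (\<exists>v\<in>A. p v > 0)"
proof -
  have fin: "finite {v \<in> A. p v \<noteq> 0}" using complex_point_support(1)[OF assms] by simp
  have "mass A p \<ge> 0" unfolding mass_def using complex_point_nonneg[OF assms] by (intro sum_nonneg)
  moreover have "mass A p = 0 \<longleftrightarrow> (\<forall>v\<in>A. p v = 0)"
    unfolding mass_def using complex_point_nonneg[OF assms] fin by (subst sum_nonneg_eq_0_iff) auto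
  ultimately show ?thesis
    using complex_point_nonneg[OF assms] by (metis less_le order_less_irrefl)
qed

lemma mass_compl:
  assumes "p \<in> complex_points X"
  shows "mass A p + mass (verts X - A) p = 1"
  using assms
proof (cases rule: complex_point_cases)
  case (2 u v t)
  then show ?thesis using edgeD[of u v] by (simp add: mass_edge_point)
qed (auto simp: mass_vertex_point)

lemma edge_point_in_complex:
  "{u, v} \<in> edges X \<Longrightarrow> 0 \<le> t \<Longrightarrow> t \<le> 1 \<Longrightarrow> edge_point u v t \<in> complex_points X"
  by (auto simp: complex_points_def)

text \<open>Along an edge the weight is an affine function of the parameter, by
  \<open>mass_edge_point\<close>, so preimages of open sets have open trace on every closed
  edge.\<close>

lemma complex_open_mass:
  assumes "open W"
  shows "complex_open X {p \<in> complex_points X. mass A p \<in> W}"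
  unfolding complex_open_def
proof (intro conjI allI impI)
  fix u v assume uv: "{u, v} \<in> edges X"
  have "{t \<in> {0..1}. edge_point u v t \<in> {p \<in> complex_points X. mass A p \<in> W}} =
      {0..1} \<inter> (\<lambda>t. (1 - t) * of_bool (u \<in> A) + t * of_bool (v \<in> A)) -` W"
    using edgeD[OF uv] edge_point_in_complex[OF uv] by (auto simp: mass_edge_point)
  then show "openin (top_of_set {0..1}) {t \<in> {0..1}. edge_point u v t \<in> {p \<in> complex_points X. mass A p \<in> W}}"
    using assms by (auto intro!: continuous_openin_preimage_gen continuous_intros)
qed auto

lemma openin_mass:
  "open W \<Longrightarrow> openin (freudenthal X) (Pt ` {p \<in> complex_points X. mass A p \<in> W})"
  by (rule openin_Pt, rule complex_open_mass)

lemma end_nbhd_Pt: "Pt p \<in> end_nbhd X C \<longleftrightarrow> p \<in> complex_points X \<and> mass C p \<in> {0<..}"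
  using mass_pos_iff[of p C] by (auto simp: end_nbhd_def)

text \<open>A common point of the complex would lie on an edge joining the two components, and that
  edge avoids \<open>S\<close>, so the components would be equal. For a common end, all its rays
  have their tails in a single component.\<close>

lemma end_nbhd_disjoint:
  assumes S: "finite S" "S \<subseteq> verts X"
    and C: "C \<in> graph_components (del_verts X S)" "C' \<in> graph_components (del_verts X S)" "C \<noteq> C'"
  shows "end_nbhd X C \<inter> end_nbhd X C' = {}"
proof (rule ccontr)
  assume "end_nbhd X C \<inter> end_nbhd X C' \<noteq> {}"
  then obtain z where z: "z \<in> end_nbhd X C" "z \<in> end_nbhd X C'" by blast
  show False
  proof (cases z)
    case (Pt p)
    then obtain u v where p: "p \<in> complex_points X" and uv: "u \<in> C" "v \<in> C'" "p u > 0" "p v > 0"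
      using z by (auto simp: end_nbhd_def)
    have notS: "x \<notin> S" if "x \<in> D" and D: "D \<in> graph_components (del_verts X S)" for x D
    proof -
      obtain y where y: "y \<in> verts X - S" "D = graph_component (del_verts X S) y"
        using D by (auto simp: graph_components_def)
      show ?thesis
        by (rule graph_component_induct[of x "del_verts X S" y "\<lambda>x. x \<notin> S"])
          (use that y in \<open>auto simp: edges_del_verts\<close>)
    qed
    have "u \<noteq> v" using graph_components_eq[of C _ C' u] C uv by blast
    then have "{u, v} \<in> edges X" using complex_point_adjacent[OF p] uv by force
    then have "{u, v} \<in> edges (del_verts X S)"
      using notS uv C by (auto simp: edges_del_verts)
    then have "v \<in> C" using graph_components_closed C uv by metis
    then show False using graph_components_eq C uv by metis
  next
    case (End \<omega>)
    then show ?thesis using End_in_end_nbhd_unique[OF S] C z by blast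
  qed
qed

lemma separate_Pt_Pt:
  assumes p: "p \<in> complex_points X" and q: "q \<in> complex_points X" and "p \<noteq> q"
  shows "\<exists>U V. openin (freudenthal X) U \<and> openin (freudenthal X) V \<and> Pt p \<in> U \<and> Pt q \<in> V \<and> disjnt U V"
proof -
  have "\<exists>w. p w \<noteq> q w" using \<open>p \<noteq> q\<close> by (simp add: fun_eq_iff)
  then obtain w where w: "p w \<noteq> q w" by blast
  define c where "c = (p w + q w) / 2"
  have *: "openin (freudenthal X) (Pt ` {r \<in> complex_points X. mass {w} r \<in> {..<c}})"
    "openin (freudenthal X) (Pt ` {r \<in> complex_points X. mass {w} r \<in> {c<..}})"
    by (rule openin_mass, simp)+
  show ?thesis
  proof (cases "p w < q w")
    case True
    then show ?thesis using * p q
      by (intro exI[of _ "Pt ` {r \<in> complex_points X. mass {w} r \<in> {..<c}}"]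
        exI[of _ "Pt ` {r \<in> complex_points X. mass {w} r \<in> {c<..}}"])
        (auto simp: disjnt_def c_def)
  next
    case False
    then show ?thesis using * p q w
      by (intro exI[of _ "Pt ` {r \<in> complex_points X. mass {w} r \<in> {c<..}}"]
        exI[of _ "Pt ` {r \<in> complex_points X. mass {w} r \<in> {..<c}}"])
        (auto simp: disjnt_def c_def)
  qed
qed

text \<open>Deleting just the support \<open>S\<close> of \<open>p\<close> is not enough, since
  edges from \<open>S\<close> into the component of the end belong to both stars. With the
  neighbours of \<open>S\<close> deleted too, which is still a finite set, an edge starting in
  \<open>S\<close> ends in \<open>S'\<close> and so never reaches that component.\<close>

lemma separate_Pt_End:
  assumes p: "p \<in> complex_points X" and \<omega>: "\<omega> \<in> ends X"
  shows "\<exists>U V. openin (freudenthal X) U \<and> openin (freudenthal X) V \<and> Pt p \<in> U \<and> End \<omega> \<in> V \<and> disjnt U V"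
proof -
  define S where "S = {v. p v \<noteq> 0}"
  define S' where "S' = S \<union> (\<Union>v\<in>S. {w. {v, w} \<in> edges X})"
  have S: "finite S" "S \<subseteq> verts X" "S \<noteq> {}"
    unfolding S_def using complex_point_support[OF p] by auto
  have S': "finite S'" "S' \<subseteq> verts X"
    using S locally_finite edgeD by (auto simp: S'_def)
  obtain C where C: "C \<in> graph_components (del_verts X S')" "End \<omega> \<in> end_nbhd X C"
    using ends_component[OF \<omega> S'(1)] .
  have notS: "x \<notin> S'" if "x \<in> C" for x
  proof -
    obtain y where y: "y \<in> verts X - S'" "C = graph_component (del_verts X S') y"
      using C(1) by (auto simp: graph_components_def)
    show ?thesis
      by (rule graph_component_induct[of x "del_verts X S'" y "\<lambda>x. x \<notin> S'"])
        (use that y in \<open>auto simp: edges_del_verts\<close>)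
  qed
  have U: "openin (freudenthal X) (Pt ` {q \<in> complex_points X. mass S q \<in> {0<..}})"
    by (rule openin_mass) simp
  have "\<exists>v\<in>S. p v > 0"
    using S(3) complex_point_nonneg[OF p] unfolding S_def by (auto simp: less_le)
  then have "mass S p > 0" using mass_pos_iff[OF p] by blast
  moreover have False if q: "q \<in> complex_points X" "mass S q \<in> {0<..}" "Pt q \<in> end_nbhd X C" for q
  proof -
    obtain v u where vu: "v \<in> S" "q v > 0" "u \<in> C" "q u > 0"
      using q mass_pos_iff[OF q(1)] by (auto simp: end_nbhd_Pt)
    have "u \<noteq> v" using notS[OF vu(3)] vu(1) by (auto simp: S'_def)
    then have "{v, u} \<in> edges X" using complex_point_adjacent[OF q(1), of v u] vu by auto
    then have "u \<in> S'" using vu by (auto simp: S'_def)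
    then show False using notS vu by blast
  qed
  ultimately show ?thesis
    using U openin_end_nbhd[OF S' C(1)] C(2) p
    by (intro exI[of _ "Pt ` {q \<in> complex_points X. mass S q \<in> {0<..}}"] exI[of _ "end_nbhd X C"])
      (auto simp: disjnt_def)
qed

lemma separate_End_End:
  assumes "\<omega> \<in> ends X" "\<eta> \<in> ends X" "\<omega> \<noteq> \<eta>"
  shows "\<exists>U V. openin (freudenthal X) U \<and> openin (freudenthal X) V \<and> End \<omega> \<in> U \<and> End \<eta> \<in> V \<and> disjnt U V"
proof -
  obtain r r' where r: "r \<in> \<omega>" "r' \<in> \<eta>" using ends_nonempty assms by metis
  have rays: "ray X r" "ray X r'" using ends_ray assms r by metis+
  have "(r, r') \<notin> ray_equiv X"
    using quotient_eq_iff[OF equiv_ray_equiv, of \<omega> X \<eta> r r'] assms r by (auto simp: ends_def)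
  then obtain S where S: "finite S" "S \<subseteq> verts X"
    "\<And>C. C \<in> graph_components (del_verts X S) \<Longrightarrow> has_tail_in r C \<Longrightarrow> \<not> has_tail_in r' C"
    using rays by (auto simp: ray_equiv_def)
  obtain C where C: "C \<in> graph_components (del_verts X S)" "has_tail_in r C"
    using ray_component[OF rays(1) S(1)] .
  obtain D where D: "D \<in> graph_components (del_verts X S)" "has_tail_in r' D"
    using ray_component[OF rays(2) S(1)] .
  have "C \<noteq> D" using S(3) C D by blast
  then have "disjnt (end_nbhd X C) (end_nbhd X D)"
    using end_nbhd_disjoint[OF S(1,2) C(1) D(1)] by (simp add: disjnt_def)
  moreover have "End \<omega> \<in> end_nbhd X C" "End \<eta> \<in> end_nbhd X D"
    using assms r C D by (auto simp: end_nbhd_def)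
  ultimately show ?thesis using openin_end_nbhd[OF S(1,2)] C(1) D(1) by blast
qed

theorem Hausdorff_freudenthal: "Hausdorff_space (freudenthal X)"
  unfolding Hausdorff_space_def topspace_freudenthal
proof (intro allI impI, elim conjE)
  fix x y assume x: "x \<in> Pt ` complex_points X \<union> End ` ends X"
    and y: "y \<in> Pt ` complex_points X \<union> End ` ends X" and ne: "x \<noteq> y"
  show "\<exists>U V. openin (freudenthal X) U \<and> openin (freudenthal X) V \<and> x \<in> U \<and> y \<in> V \<and> disjnt U V"
  proof (cases x; cases y)
    fix p q assume "x = Pt p" "y = Pt q"
    then show ?thesis using x y ne separate_Pt_Pt by auto
  next
    fix p \<omega> assume "x = Pt p" "y = End \<omega>"
    then show ?thesis using x y separate_Pt_End by auto
  next
    fix p \<omega> assume "x = End \<omega>" "y = Pt p"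
    then show ?thesis using x y separate_Pt_End[of p \<omega>] by (auto simp: disjnt_sym) (metis disjnt_sym)
  next
    fix \<eta> \<omega> assume "x = End \<omega>" "y = End \<eta>"
    then show ?thesis using x y ne separate_End_End by auto
  qed
qed

lemma continuous_map_edge_point:
  assumes uv: "{u, v} \<in> edges X"
  shows "continuous_map (top_of_set {0..1}) (freudenthal X) (\<lambda>t. Pt (edge_point u v t))"
proof -
  have Pt: "openin (top_of_set {0..1}) {t \<in> {0..1}. edge_point u v t \<in> V}" if "complex_open X V" for V
    using that uv unfolding complex_open_def by blast
  show ?thesis
  proof (rule continuous_map_into_freudenthal)
    show "(\<lambda>t. Pt (edge_point u v t)) \<in> topspace (top_of_set {0..1}) \<rightarrow> topspace (freudenthal X)"
      using edge_point_in_complex[OF uv] by (auto simp: topspace_freudenthal)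
  next
    fix V assume V: "complex_open X V"
    have "{t \<in> {0..1}. Pt (edge_point u v t) \<in> Pt ` V} = {t \<in> {0..1}. edge_point u v t \<in> V}" by auto
    then show "openin (top_of_set {0..1}) {t \<in> topspace (top_of_set {0..1}). Pt (edge_point u v t) \<in> Pt ` V}"
      using Pt[OF V] by simp
  next
    fix C
    have "{t \<in> {0..1}. Pt (edge_point u v t) \<in> end_nbhd X C} =
        {t \<in> {0..1}. edge_point u v t \<in> {p \<in> complex_points X. mass C p \<in> {0<..}}}"
      by (auto simp: end_nbhd_Pt)
    then show "openin (top_of_set {0..1}) {t \<in> topspace (top_of_set {0..1}). Pt (edge_point u v t) \<in> end_nbhd X C}"
      using Pt[OF complex_open_mass[of "{0<..}" C]] by simp
  qed
qed

end

section \<open>Hamiltonian circles, edges and cuts\<close>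

context lf_graph
begin

section \<open>Edges on a hamiltonian circle and the degree bound\<close>

lemma edge_point_coords:
  "u \<noteq> v \<Longrightarrow> edge_point u v t u = 1 - t" "u \<noteq> v \<Longrightarrow> edge_point u v t v = t"
  by (auto simp: edge_point_def)

lemma edge_point_nonzero: "edge_point a b t w \<noteq> 0 \<Longrightarrow> w = a \<or> w = b"
  by (auto simp: edge_point_def of_bool_def split: if_splits)

text \<open>The segment is cut out by two weight conditions: positive weight at \<open>u\<close>
  together with weight in \<open>W\<close> at \<open>v\<close> forces the support to be
  \<open>{u, v}\<close>.\<close>

lemma openin_edge_segment:
  assumes uv: "{u, v} \<in> edges X" and W: "open W" "W \<subseteq> {0<..<1}"
  shows "openin (freudenthal X) ((\<lambda>t. Pt (edge_point u v t)) ` W)"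
proof -
  have ne: "u \<noteq> v" using edgeD[OF uv] by simp
  have "(\<lambda>t. Pt (edge_point u v t)) ` W =
      Pt ` {p \<in> complex_points X. mass {u} p \<in> {0<..}} \<inter> Pt ` {p \<in> complex_points X. mass {v} p \<in> W}"
    (is "?L = ?R")
  proof
    show "?L \<subseteq> ?R"
    proof
      fix z assume "z \<in> ?L"
      then obtain t where t: "t \<in> W" "z = Pt (edge_point u v t)" by blast
      then have "0 < t" "t < 1" using W(2) by auto
      then show "z \<in> ?R" using t edge_point_in_complex[OF uv, of t] edge_point_coords[OF ne, of t] by simp
    qed
    show "?R \<subseteq> ?L"
    proof
      fix z assume "z \<in> ?R"
      then obtain p where p: "z = Pt p" "p \<in> complex_points X" "p u > 0" "p v \<in> W" by auto
      have pv: "0 < p v" "p v < 1" using p(4) W(2) by auto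
      from p(2) show "z \<in> ?L"
      proof (cases rule: complex_point_cases)
        case (1 w)
        then show ?thesis using p pv by (auto simp: vertex_point_def of_bool_def split: if_splits)
      next
        case (2 a b t)
        have "u = a \<or> u = b" "v = a \<or> v = b"
          using 2 p(3) pv edge_point_nonzero[of a b t] by auto
        then have "{u, v} = {a, b}" using ne by auto
        then consider "a = u" "b = v" | "a = v" "b = u" by (auto simp: doubleton_eq_iff)
        then have "p = edge_point u v (p v)"
        proof cases
          case 1
          then show ?thesis using 2 edge_point_coords[OF ne] by simp
        next
          case a: 2
          then have "p = edge_point u v (1 - t)" using 2(5) edge_point_swap by metis
          then show ?thesis using edge_point_coords(2)[OF ne, of "1 - t"] by simp
        qed
        then show ?thesis using p by blast
      qed
    qed
  qed
  moreover have "openin (freudenthal X) ?R"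
    by (rule openin_Int; rule openin_mass) (use W in auto)
  ultimately show ?thesis by simp
qed

lemma closedin_edge_segment:
  assumes uv: "{u, v} \<in> edges X" and "0 \<le> a" "b \<le> 1"
  shows "closedin (freudenthal X) ((\<lambda>t. Pt (edge_point u v t)) ` {a..b})"
proof -
  have "compactin (top_of_set {0..1}) {a..b}"
    using assms by (auto simp: compactin_subtopology)
  then show ?thesis
    using image_compactin[OF _ continuous_map_edge_point[OF uv]]
      compactin_imp_closedin[OF Hausdorff_freudenthal] by blast
qed

lemma ham_circle_vertices:
  "hamiltonian_circle X K \<longleftrightarrow> circle_in (freudenthal X) K \<and> Pt ` vertex_point ` verts X \<subseteq> K"
  by (auto simp: hamiltonian_circle_def circle_in_def)

text \<open>If the point at \<open>s\<close> is missing, the part of \<open>K\<close> on the edge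
  below \<open>s\<close> is attached to the rest only from the side of \<open>u\<close>. Then
  removing one of its points would cut off everything of \<open>K\<close> between that point and
  \<open>s\<close>, although a punctured circle is connected.\<close>

lemma circle_edge_no_gap:
  assumes K: "hamiltonian_circle X K" and uv: "{u, v} \<in> edges X"
    and t: "0 < t" "t < s" "s < 1"
    and mem: "Pt (edge_point u v t) \<in> K" "Pt (edge_point u v s) \<notin> K"
  shows False
proof -
  let ?f = "\<lambda>t. Pt (edge_point u v t)"
  let ?Y = "freudenthal X"
  have ne: "u \<noteq> v" using edgeD[OF uv] by simp
  have K1: "circle_in ?Y K" using K ham_circle_vertices by blast
  have fu: "?f 0 \<in> K"
    using K edgeD[OF uv] by (auto simp: ham_circle_vertices vertex_point_eq_edge_point[symmetric])
  have inj: "edge_point u v a = edge_point u v b \<longleftrightarrow> a = b" for a b using edge_point_inj[OF ne] by auto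
  have Ksub: "K \<subseteq> topspace ?Y" using K1 by (simp add: circle_in_def)
  \<comment> \<open>With the point at \<open>r\<close> removed, \<open>K\<close> splits into the
    part strictly between \<open>r\<close> and \<open>s\<close> and the part outside the closed
    stretch, because nothing of \<open>K\<close> lies at \<open>s\<close>.\<close>
  have no: "?f t' \<notin> K" if "0 < r" "r < t'" "t' < s" "?f r \<in> K" for r t'
  proof
    assume t': "?f t' \<in> K"
    have C: "closedin ?Y (?f ` {r..s})" using closedin_edge_segment[OF uv] that t by simp
    have O: "openin ?Y (?f ` {r<..<s})" using that t by (intro openin_edge_segment[OF uv]) auto
    show False
    proof (rule connectedinD[OF connectedin_circle_minus_point[OF K1, of "?f r"] O openin_diff[OF openin_topspace C]])
      show "K - {?f r} \<subseteq> ?f ` {r<..<s} \<union> (topspace ?Y - ?f ` {r..s})"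
      proof
        fix x assume x: "x \<in> K - {?f r}"
        show "x \<in> ?f ` {r<..<s} \<union> (topspace ?Y - ?f ` {r..s})"
        proof (cases "x \<in> ?f ` {r..s}")
          case True
          then obtain w where w: "w \<in> {r..s}" "x = ?f w" by blast
          then have "w \<noteq> r" "w \<noteq> s" using x mem by auto
          then show ?thesis using w by auto
        qed (use x Ksub in auto)
      qed
      show "?f ` {r<..<s} \<inter> (topspace ?Y - ?f ` {r..s}) \<inter> (K - {?f r}) = {}" by auto
      have "?f t' \<in> ?f ` {r<..<s}" "?f t' \<in> K - {?f r}" using that t' inj by auto
      then show "?f ` {r<..<s} \<inter> (K - {?f r}) \<noteq> {}" by blast
      have "?f 0 \<notin> ?f ` {r..s}" "?f 0 \<noteq> ?f r" using inj that by auto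
      then show "(topspace ?Y - ?f ` {r..s}) \<inter> (K - {?f r}) \<noteq> {}" using fu Ksub by blast
    qed
  qed
  \<comment> \<open>By \<open>no\<close>, \<open>t\<close> is the only inner parameter below
    \<open>s\<close> that belongs to \<open>K\<close>, so its point would be isolated in the
    connected set \<open>K\<close>, which also contains the vertex \<open>u\<close>.\<close>
  have O: "openin ?Y (?f ` {0<..<s})" using t by (intro openin_edge_segment[OF uv]) auto
  have C: "closedin ?Y (?f ` {t..t})"
    by (rule closedin_edge_segment[OF uv]) (use t in auto)
  have "connectedin ?Y K" using connectedin_circle_minus_point[OF K1, of "?f s"] mem by simp
  then show False
  proof (rule connectedinD[OF _ O openin_diff[OF openin_topspace C]])
    show "K \<subseteq> ?f ` {0<..<s} \<union> (topspace ?Y - ?f ` {t..t})" using Ksub t by auto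
    show "?f ` {0<..<s} \<inter> (topspace ?Y - ?f ` {t..t}) \<inter> K = {}"
    proof (rule ccontr)
      assume "\<not> ?thesis"
      then obtain w where "w \<in> {0<..<s}" "?f w \<in> K" "?f w \<notin> ?f ` {t..t}" by blast
      then have w: "0 < w" "w < s" "?f w \<in> K" "w \<noteq> t" by auto
      then show False using no[of w t] no[of t w] mem t by (cases "w < t") auto
    qed
    have "?f t \<in> ?f ` {0<..<s}" using t by auto
    then show "?f ` {0<..<s} \<inter> K \<noteq> {}" using mem by blast
    have "?f 0 \<notin> ?f ` {t..t}" using inj t by auto
    then show "(topspace ?Y - ?f ` {t..t}) \<inter> K \<noteq> {}" using fu Ksub by blast
  qed
qed

lemma circle_contains_edge:
  assumes K: "hamiltonian_circle X K" and uv: "{u, v} \<in> edges X"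
    and mem: "Pt (edge_point u v (1/2)) \<in> K" and t: "0 \<le> t" "t \<le> 1"
  shows "Pt (edge_point u v t) \<in> K"
proof (rule ccontr)
  assume not: "Pt (edge_point u v t) \<notin> K"
  have "Pt (vertex_point w) \<in> K" if "w \<in> verts X" for w
    using K that by (auto simp: ham_circle_vertices)
  then have "t \<noteq> 0" "t \<noteq> 1"
    using not edgeD[OF uv] by (auto simp: vertex_point_eq_edge_point[symmetric] edge_point_1)
  moreover have "t \<noteq> 1/2" using not mem by metis
  ultimately consider "1/2 < t" "t < 1" | "0 < t" "t < 1/2" using t by linarith
  then show False
  proof cases
    case 1
    then show ?thesis using circle_edge_no_gap[OF K uv, of "1/2" t] mem not by simp
  next
    case 2
    then show ?thesis
      using circle_edge_no_gap[OF K, of v u "1/2" "1 - t"] uv mem not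
      by (simp add: insert_commute edge_point_swap[of v u])
  qed
qed

text \<open>The circle contains the three edges completely. Their halves from \<open>v\<close> up
  to, but not including, the midpoints form a connected set with all three midpoints in its closure,
  which \<open>no_triod\<close> forbids.\<close>

lemma circle_degree_le_2:
  assumes K: "hamiltonian_circle X K"
    and e: "{v, a} \<in> edges X" "{v, b} \<in> edges X" "{v, c} \<in> edges X"
    and ne: "a \<noteq> b" "a \<noteq> c" "b \<noteq> c"
    and mem: "Pt (edge_point v a (1/2)) \<in> K" "Pt (edge_point v b (1/2)) \<in> K" "Pt (edge_point v c (1/2)) \<in> K"
  shows False
proof -
  let ?Y = "freudenthal X"
  define f where "f w t = Pt (edge_point v w t)" for w t
  define T where "T = (\<Union>w\<in>{a, b, c}. f w ` {0..<1/2})"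
  have cont: "continuous_map (top_of_set {0..1}) ?Y (f w)" if "w \<in> {a, b, c}" for w
    using that e continuous_map_edge_point unfolding f_def by blast
  have ne': "w \<noteq> v" if "w \<in> {a, b, c}" for w using that e edgeD by blast
  have fK: "f w t \<in> K" if "w \<in> {a, b, c}" "0 \<le> t" "t \<le> 1" for w t
    using that circle_contains_edge[OF K _ _ that(2,3), of v w] e mem unfolding f_def by blast
  have f0: "f w 0 = Pt (vertex_point v)" for w by (simp add: f_def vertex_point_eq_edge_point[symmetric])
  have conn: "connectedin ?Y (f w ` {0..<1/2})" if "w \<in> {a, b, c}" for w
    by (rule connectedin_continuous_map_image[OF cont[OF that]])
      (auto simp: connectedin_subtopology)
  have "connectedin ?Y T"
    unfolding T_def
  proof (rule connectedin_Union)
    have "Pt (vertex_point v) \<in> f w ` {0..<1/2}" for w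
      using f0[of w] by (intro image_eqI[of _ _ 0]) auto
    then show "\<Inter> ((\<lambda>w. f w ` {0..<1/2}) ` {a, b, c}) \<noteq> {}" by blast
  qed (use conn in blast)
  moreover have mid: "f w t \<noteq> f w' (1/2)" if "w \<in> {a, b, c}" "w' \<in> {a, b, c}" "0 \<le> t" "t < 1/2" for w w' t
  proof
    assume "f w t = f w' (1/2)"
    then have "edge_point v w t = edge_point v w' (1/2)" by (simp add: f_def)
    then have "edge_point v w t v = edge_point v w' (1/2) v" by simp
    moreover have "w \<noteq> v" "w' \<noteq> v" using ne' that by blast+
    ultimately show False using that by (simp add: edge_point_def)
  qed
  moreover have mid2: "f w (1/2) \<noteq> f w' (1/2)" if "w \<in> {a, b, c}" "w' \<in> {a, b, c}" "w \<noteq> w'" for w w'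
  proof
    assume "f w (1/2) = f w' (1/2)"
    then have "edge_point v w (1/2) w = edge_point v w' (1/2) w" by (simp add: f_def)
    moreover have "w \<noteq> v" "w' \<noteq> v" using ne' that by blast+
    ultimately show False using that by (simp add: edge_point_def)
  qed
  moreover have "f w (1/2) \<in> ?Y closure_of T" if "w \<in> {a, b, c}" for w
  proof -
    have "{0..1} \<inter> {0..<1/2} = {0..<1/2::real}" by auto
    then have "1/2 \<in> top_of_set {0..1} closure_of {0..<1/2::real}"
      by (simp add: closure_of_subtopology)
    then have "f w (1/2) \<in> ?Y closure_of (f w ` {0..<1/2})"
      using continuous_map_image_closure_subset[OF cont[OF that]] by blast
    then show ?thesis
      using closure_of_mono[of "f w ` {0..<1/2}" T ?Y] that by (auto simp: T_def)
  qed
  moreover have "T \<subseteq> K - {f a (1/2), f b (1/2), f c (1/2)}"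
  proof
    fix x assume "x \<in> T"
    then obtain w where w: "w \<in> {a, b, c}" "x \<in> f w ` {0..<1/2}" unfolding T_def by blast
    then obtain t where "0 \<le> t" "t < 1/2" "x = f w t" by auto
    then have "x \<in> K" "x \<noteq> f a (1/2)" "x \<noteq> f b (1/2)" "x \<noteq> f c (1/2)"
      using fK[of w t] mid[of w _ t] w(1) by auto
    then show "x \<in> K - {f a (1/2), f b (1/2), f c (1/2)}" by blast
  qed
  moreover have "f w (1/2) \<in> K" if "w \<in> {a, b, c}" for w using fK[OF that, of "1/2"] by simp
  ultimately show False
    using no_triod[of ?Y K T "f a (1/2)" "f b (1/2)" "f c (1/2)"] K ne
    unfolding ham_circle_vertices by simp
qed

section \<open>Finite cuts\<close>

lemma closedin_circle:
  assumes "circle_in (freudenthal X) K"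
  shows "closedin (freudenthal X) K"
  using compactin_imp_closedin[OF Hausdorff_freudenthal compactin_circle[OF assms]] .

definition cut :: "'a set \<Rightarrow> ('a \<times> 'a) set" where
  "cut A = {(u, v). {u, v} \<in> edges X \<and> u \<in> A \<and> v \<notin> A}"

text \<open>A point of the complex goes to the side that carries more than half of its weight, which
  leaves only midpoints of cut edges undecided. The neighbourhoods of components inside
  \<open>A\<close> serve to distribute the ends.\<close>

definition cut_side :: "'a set \<Rightarrow> 'a set \<Rightarrow> 'a fpoint set" where
  "cut_side S A = Pt ` {p \<in> complex_points X. mass A p \<in> {1/2<..}} \<union>
     (\<Union>C\<in>{C \<in> graph_components (del_verts X S). C \<subseteq> A}. end_nbhd X C)"

lemma openin_cut_side:
  assumes "finite S" "S \<subseteq> verts X"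
  shows "openin (freudenthal X) (cut_side S A)"
  unfolding cut_side_def
  by (intro openin_Un openin_Union openin_mass)
    (use openin_end_nbhd[OF assms] in auto)

lemma component_avoids: 
  assumes "C \<in> graph_components (del_verts X S)" "x \<in> C"
  shows "x \<in> verts X - S"
proof -
  obtain y where y: "y \<in> verts X - S" "C = graph_component (del_verts X S) y"
    using assms(1) by (auto simp: graph_components_def)
  show ?thesis
    by (rule graph_component_induct[of x "del_verts X S" y])
      (use assms y edgeD in \<open>auto simp: edges_del_verts\<close>)
qed

text \<open>When \<open>S\<close> contains every vertex of \<open>A\<close> with a neighbour
  outside, no edge leaves \<open>A\<close> from a component of the rest. So the neighbourhoods used
  in \<open>cut_side\<close> only add points whose whole weight is on \<open>A\<close>, in agreement
  with the rule of more than half.\<close>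

lemma end_nbhd_mass:
  assumes S: "\<And>u v. {u, v} \<in> edges X \<Longrightarrow> u \<in> A \<Longrightarrow> v \<notin> A \<Longrightarrow> u \<in> S"
    and C: "C \<in> graph_components (del_verts X S)" "C \<subseteq> A" and p: "Pt p \<in> end_nbhd X C"
  shows "mass A p = 1" "p \<in> complex_points X"
proof -
  obtain v where v: "p \<in> complex_points X" "v \<in> C" "p v > 0"
    using p by (auto simp: end_nbhd_def)
  have "p w = 0" if "w \<notin> A" for w
  proof (rule ccontr)
    assume "p w \<noteq> 0"
    then have "{v, w} \<in> edges X" using complex_point_adjacent[OF v(1), of v w] v C that by auto
    then have "v \<in> S" using S that v C by blast
    then show False using component_avoids C v by blast
  qed
  then have "mass (verts X - A) p = 0" by (simp add: mass_def)
  then show "mass A p = 1" using mass_compl[OF v(1), of A] by simp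
  show "p \<in> complex_points X" by fact
qed

text \<open>Removing \<open>z\<close> leaves the circle connected, so the two open sides of the cut
  cannot cover what remains; both sides are inhabited because \<open>z\<close> is not a vertex. With
  \<open>z\<close> the midpoint of one cut edge, the circle must pass through another one.\<close>

theorem circle_crosses_cut_twice:
  assumes K: "hamiltonian_circle X K" and fin: "finite (cut A)"
    and A: "a \<in> A" "A \<subseteq> verts X" "b \<in> verts X - A"
    and z: "z \<notin> Pt ` vertex_point ` verts X"
  shows "\<exists>(u, v)\<in>cut A. Pt (edge_point u v (1/2)) \<in> K - {z}"
proof (rule ccontr)
  assume contra: "\<not> ?thesis"
  let ?Y = "freudenthal X"
  define S where "S = fst ` cut A \<union> snd ` cut A"
  define B where "B = verts X - A"
  have S: "finite S" "S \<subseteq> verts X"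
    using fin edgeD by (auto simp: S_def cut_def)
  have inS: "u \<in> S \<and> v \<in> S" if "{u, v} \<in> edges X" "u \<in> A" "v \<notin> A" for u v
    using that unfolding S_def cut_def by force
  have SA: "\<And>u v. {u, v} \<in> edges X \<Longrightarrow> u \<in> A \<Longrightarrow> v \<notin> A \<Longrightarrow> u \<in> S" using inS by blast
  have SB: "\<And>u v. {u, v} \<in> edges X \<Longrightarrow> u \<in> B \<Longrightarrow> v \<notin> B \<Longrightarrow> u \<in> S"
    using inS edgeD unfolding B_def by (metis DiffD2 DiffI insert_commute)
  have side: "C \<subseteq> A \<or> C \<subseteq> B" if C: "C \<in> graph_components (del_verts X S)" for C
  proof -
    obtain y where y: "y \<in> verts X - S" "C = graph_component (del_verts X S) y"
      using C by (auto simp: graph_components_def)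
    have "x \<in> A \<longleftrightarrow> y \<in> A" if "x \<in> C" for x
      by (rule graph_component_induct[of x "del_verts X S" y])
        (use that y inS in \<open>auto simp: edges_del_verts insert_commute\<close>)
    then show ?thesis using component_avoids[OF C] unfolding B_def by blast
  qed
  have massB: "mass B p = 1 - mass A p" if "p \<in> complex_points X" for p
    using mass_compl[OF that, of A] by (simp add: B_def)
  have K1: "circle_in ?Y K" using K ham_circle_vertices by blast
  have vK: "Pt (vertex_point w) \<in> K" if "w \<in> verts X" for w
    using K that by (auto simp: ham_circle_vertices)
  have zv: "Pt (vertex_point w) \<in> cut_side S D" if "w \<in> D" "w \<in> verts X" for w D
    using that by (auto simp: cut_side_def mass_vertex_point complex_points_def)
  have halfA: "mass A p > 1/2 \<and> p \<in> complex_points X" if "Pt p \<in> cut_side S A" for p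
    using that end_nbhd_mass[OF SA] by (fastforce simp: cut_side_def)
  have halfB: "mass B p > 1/2 \<and> p \<in> complex_points X" if "Pt p \<in> cut_side S B" for p
    using that end_nbhd_mass[OF SB] by (fastforce simp: cut_side_def)
  show False
  proof (rule connectedinD[OF connectedin_circle_minus_point[OF K1, of z]
        openin_cut_side[OF S, of A] openin_cut_side[OF S, of B]])
    show "K - {z} \<subseteq> cut_side S A \<union> cut_side S B"
    proof
      fix x assume x: "x \<in> K - {z}"
      then have "x \<in> topspace ?Y" using K1 by (auto simp: circle_in_def)
      then consider p where "x = Pt p" "p \<in> complex_points X" | \<omega> where "x = End \<omega>" "\<omega> \<in> ends X"
        by (auto simp: topspace_freudenthal)
      then show "x \<in> cut_side S A \<union> cut_side S B"
      proof cases
        case (1 p)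
        \<comment> \<open>Weight exactly one half on \<open>A\<close> occurs only at the midpoint of
          an edge with one end on each side, and such midpoints are excluded by
          \<open>contra\<close>.\<close>
        have "mass A p \<noteq> 1/2"
        proof
          assume half: "mass A p = 1/2"
          from 1(2) show False
          proof (cases rule: complex_point_cases)
            case (1 v)
            then show ?thesis using half by (simp add: mass_vertex_point of_bool_def split: if_splits)
          next
            case (2 u v t)
            have t: "t = 1/2" "(u \<in> A) \<noteq> (v \<in> A)"
              using half 2 by (auto simp: mass_edge_point of_bool_def split: if_splits)
            then have "(u, v) \<in> cut A \<or> (v, u) \<in> cut A"
              using 2(1) by (auto simp: cut_def insert_commute)
            moreover have "p = edge_point u v (1/2)" "p = edge_point v u (1/2)"
              using 2 t edge_point_swap[of v u "1/2"] by auto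
            ultimately show ?thesis using contra x \<open>x = Pt p\<close> by fastforce
          qed
        qed
        then consider "mass A p > 1/2" | "mass B p > 1/2" using massB[OF 1(2)] by linarith
        then show ?thesis using 1 by cases (auto simp: cut_side_def)
      next
        case (2 \<omega>)
        obtain C where "C \<in> graph_components (del_verts X S)" "End \<omega> \<in> end_nbhd X C"
          using ends_component[OF 2(2) S(1)] .
        then show ?thesis using side 2 unfolding cut_side_def by blast
      qed
    qed
    show "cut_side S A \<inter> cut_side S B \<inter> (K - {z}) = {}"
    proof (rule ccontr)
      assume "\<not> ?thesis"
      then obtain x where x: "x \<in> cut_side S A" "x \<in> cut_side S B" by blast
      show False
      proof (cases x)
        case (Pt p)
        then show ?thesis using halfA[of p] halfB[of p] massB[of p] x by auto
      next
        case (End \<omega>)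
        then obtain C D where CD: "C \<in> graph_components (del_verts X S)" "C \<subseteq> A" "End \<omega> \<in> end_nbhd X C"
          "D \<in> graph_components (del_verts X S)" "D \<subseteq> B" "End \<omega> \<in> end_nbhd X D"
          using x by (auto simp: cut_side_def)
        then have "C = D" using End_in_end_nbhd_unique[OF S] by blast
        moreover obtain y where "y \<in> C"
          using CD(1) component_self by (fastforce simp: graph_components_def)
        ultimately show False using CD by (auto simp: B_def)
      qed
    qed
    show "cut_side S A \<inter> (K - {z}) \<noteq> {}"
      using zv[of a A] vK[of a] A z by blast
    show "cut_side S B \<inter> (K - {z}) \<noteq> {}"
      using zv[of b B] vK[of b] A z unfolding B_def by blast
  qed
qed

lemma subgraph_complex_points:
  assumes "subgraph H X"
  shows "complex_points H \<subseteq> complex_points X"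
proof
  have H: "verts H \<subseteq> verts X" "edges H \<subseteq> edges X" using assms by (auto simp: subgraph_def)
  fix p assume "p \<in> complex_points H"
  then consider v where "v \<in> verts H" "p = vertex_point v"
    | u v t where "{u, v} \<in> edges H" "0 \<le> t" "t \<le> 1" "p = edge_point u v t"
    by (auto simp: complex_points_def)
  then show "p \<in> complex_points X"
  proof cases
    case 1
    then show ?thesis using H by (auto simp: complex_points_def)
  next
    case 2
    then show ?thesis using H edge_point_in_complex by blast
  qed
qed

text \<open>The interior of an edge of \<open>X\<close> is open in the compactification. If its
  midpoint is in the closure of \<open>H'\<close>, then \<open>H'\<close> has a point in that
  interior, and the support of this point identifies the edge.\<close>

lemma closure_in_edges_subset:
  assumes H: "subgraph H X" "subgraph H' X" and sub: "closure_in X H \<subseteq> closure_in X H'"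
  shows "edges H \<subseteq> edges H'"
proof
  fix e assume e: "e \<in> edges H"
  then have "e \<in> edges X" using H(1) by (auto simp: subgraph_def)
  then obtain u v where uv: "e = {u, v}" "{u, v} \<in> edges X" "u \<noteq> v"
    using edge_pair[of e] by metis
  let ?O = "(\<lambda>t. Pt (edge_point u v t)) ` {0<..<1}"
  have O: "openin (freudenthal X) ?O" using uv by (intro openin_edge_segment) auto
  have mid: "Pt (edge_point u v (1/2)) \<in> ?O" by (rule image_eqI[of _ _ "1/2"]) auto
  have "Pt (edge_point u v (1/2)) \<in> Pt ` complex_points H"
    using e uv by (force simp: complex_points_def)
  moreover have "Pt ` complex_points H \<subseteq> closure_in X H"
    unfolding closure_in_def
    by (rule closure_of_subset) (use subgraph_complex_points[OF H(1)] in \<open>auto simp: topspace_freudenthal\<close>)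
  ultimately have "Pt (edge_point u v (1/2)) \<in> closure_in X H'" using sub by blast
  then obtain y where y: "y \<in> Pt ` complex_points H'" "y \<in> ?O"
    using O mid unfolding closure_in_def in_closure_of by metis
  then obtain p t where p: "p \<in> complex_points H'" "p = edge_point u v t" "0 < t" "t < 1" by auto
  then have pos: "p u \<noteq> 0" "p v \<noteq> 0" using uv by (auto simp: edge_point_def)
  consider w where "p = vertex_point w" | a b s where "{a, b} \<in> edges H'" "p = edge_point a b s"
    using p(1) by (auto simp: complex_points_def)
  then have "\<exists>a b. {a, b} \<in> edges H' \<and> {u, v} \<subseteq> {a, b}"
  proof cases
    case 1
    then show ?thesis using pos uv(3) by (auto simp: vertex_point_def)
  next
    case (2 a b s)
    then show ?thesis using edge_point_nonzero[of a b s] pos by blast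
  qed
  then obtain a b where "{a, b} \<in> edges H'" "{u, v} \<subseteq> {a, b}" by blast
  then have "{a, b} = {u, v}" using uv(3) by auto
  then show "e \<in> edges H'" using \<open>{a, b} \<in> edges H'\<close> uv(1) by simp
qed

end

section \<open>Nested intervals indexed by reduced words\<close>

abbreviation winv :: "'b letter list \<Rightarrow> 'b letter list" where
  "winv w \<equiv> rev (map flip w)"

lemma flip_eq_iff [simp]: "flip x = flip y \<longleftrightarrow> x = y"
  by (metis flip_flip)

lemma flip_neq [simp]: "flip x \<noteq> x" "x \<noteq> flip x"
  by (auto simp: flip_def prod_eq_iff)

lemma reduced_word_append:
  "reduced_word (u @ v) \<longleftrightarrow>
     reduced_word u \<and> reduced_word v \<and> (u = [] \<or> v = [] \<or> hd v \<noteq> flip (last u))"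
  by (auto simp: reduced_word_def successively_append_iff)

lemma foldr_push_reduced: "reduced_word (u @ v) \<Longrightarrow> foldr push u v = u @ v"
proof (induction u)
  case (Cons x u)
  then show ?case by (cases "u @ v") (auto simp: reduced_word_Cons push_def)
qed simp

text \<open>The factors \<open>winv p\<close> and \<open>p\<close> are what cancels. In the tree,
  \<open>w\<close> is the last common vertex of the paths from the root to \<open>u\<close> and to
  the product, which is the place where the order of the two is decided.\<close>

lemma foldr_push_cancel:
  assumes "reduced_word u" "reduced_word v"
  obtains w p q where "u = w @ winv p" "v = p @ q" "foldr push u v = w @ q" "reduced_word (w @ q)"
proof -
  have "\<exists>w p q. u = w @ winv p \<and> v = p @ q \<and> foldr push u v = w @ q \<and> reduced_word (w @ q)"
    using assms
  proof (induction u arbitrary: v rule: rev_induct)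
    case Nil
    show ?case
    proof (intro exI conjI)
      show "[] = [] @ winv []" "v = [] @ v" by simp_all
    qed (use Nil in simp_all)
  next
    case (snoc x u)
    show ?case
    proof (cases "v \<noteq> [] \<and> hd v = flip x")
      case True
      then obtain v' where v: "v = flip x # v'" by (cases v) auto
      have px: "push x (flip x # v') = v'" by (simp add: push_def)
      have "reduced_word u" "reduced_word v'"
        using snoc.prems v by (auto simp: reduced_word_append reduced_word_Cons)
      then obtain w p q where IH: "u = w @ winv p" "v' = p @ q" "foldr push u v' = w @ q" "reduced_word (w @ q)"
        using snoc.IH[of v'] by blast
      show ?thesis
      proof (intro exI conjI)
        show "u @ [x] = w @ winv (flip x # p)" "v = (flip x # p) @ q" using IH v by simp_all
        show "foldr push (u @ [x]) v = w @ q" using IH(3) v px by simp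
      qed fact
    next
      case False
      then have red: "reduced_word ((u @ [x]) @ v)" using snoc.prems by (subst reduced_word_append) auto
      show ?thesis
      proof (intro exI conjI)
        show "u @ [x] = (u @ [x]) @ winv []" "v = [] @ v" by simp_all
      qed (use red foldr_push_reduced[OF red] in simp_all)
    qed
  qed
  then show ?thesis using that by blast
qed

lemma carrier_free_group: "w \<in> carrier (free_group B) \<longleftrightarrow> reduced_word w \<and> fst ` set w \<subseteq> B"
  by (auto simp: free_group_def)

lemma mult_free_group: "u \<otimes>\<^bsub>free_group B\<^esub> v = foldr push u v"
  by (simp add: free_group_def)

lemma one_free_group: "\<one>\<^bsub>free_group B\<^esub> = []"
  by (simp add: free_group_def)

lemma fst_set_winv [simp]: "fst ` set (winv w) = fst ` set w"
  by (auto simp: image_image)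

lemma winv_carrier: "w \<in> carrier (free_group B) \<Longrightarrow> winv w \<in> carrier (free_group B)"
  using fst_set_winv[of w] reduced_word_inverse[of w] unfolding carrier_free_group by metis

lemma inv_free_group:
  assumes "w \<in> carrier (free_group B)"
  shows "inv\<^bsub>free_group B\<^esub> w = winv w"
proof -
  interpret group "free_group B" by (rule group_free_group)
  show ?thesis
  proof (rule inv_equality)
    show "winv w \<otimes>\<^bsub>free_group B\<^esub> w = \<one>\<^bsub>free_group B\<^esub>"
      using foldr_push_inverse[of "[]" w] assms
      by (simp add: mult_free_group one_free_group carrier_free_group foldr_push_Nil)
  qed (use assms winv_carrier in auto)
qed

lemma carrier_append:
  "u @ v \<in> carrier (free_group B) \<longleftrightarrow> u \<in> carrier (free_group B) \<and> v \<in> carrier (free_group B) \<and>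
     (u = [] \<or> v = [] \<or> hd v \<noteq> flip (last u))"
  by (auto simp: carrier_free_group reduced_word_append)

lemma carrier_Nil [simp]: "[] \<in> carrier (free_group B)"
  by (simp add: carrier_free_group)

lemma carrier_take: "w \<in> carrier (free_group B) \<Longrightarrow> take k w \<in> carrier (free_group B)"
  using carrier_append[of "take k w" "drop k w" B] by simp

text \<open>The data of the cyclic order. By \<open>turn\<close>, the direction back along
  \<open>s ! j\<close> and the next letter \<open>s ! Suc j\<close> are adjacent, on a side that
  depends on the number of letters read; \<open>pos_first\<close> and \<open>pos_last\<close> are
  the same condition with the vertex itself, at position \<open>0\<close>, as one of the two items.
  By \<open>corner\<close>, every pair of adjacent positions \<open>c\<close> and
  \<open>c + 1\<close> is passed by some turn of \<open>s\<close>. \<open>twice\<close> bounds the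
  number of lines over a tree edge, and \<open>fst_ends\<close> keeps apart the tree edges that meet
  in the final contradiction of the uniqueness proof.\<close>

locale surface_word =
  fixes n :: nat and s :: "nat letter list" and pos :: "nat letter \<Rightarrow> int" and eps :: int
  assumes n_ge: "2 \<le> n"
    and length_s: "length s = 2 * n"
    and letters_s: "fst ` set s \<subseteq> {1..n}"
    and eps: "eps = 1 \<or> eps = - 1"
    and pos_bij: "bij_betw pos {x. fst x \<in> {1..n}} {1..2 * int n}"
    and pos_first: "pos (s ! 0) = 1"
    and pos_last: "pos (flip (s ! (2 * n - 1))) = 2 * int n"
    and turn: "Suc j < 2 * n \<Longrightarrow> pos (s ! Suc j) = pos (flip (s ! j)) + eps ^ Suc j"
    and corner: "1 \<le> c \<Longrightarrow> c < 2 * int n \<Longrightarrow>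
      \<exists>j. 0 < j \<and> j < 2 * n \<and> (if eps ^ j = 1 then pos (flip (s ! (j - 1))) = c else pos (s ! j) = c)"
    and twice: "j < 2 * n \<Longrightarrow> \<exists>j'. \<forall>i<2 * n. fst (s ! i) = fst (s ! j) \<longrightarrow> i = j \<or> i = j'"
    and fst_ends: "fst (s ! 0) \<noteq> fst (s ! (2 * n - 1))"
begin

definition base :: "nat set" where "base = {1..n}"

abbreviation F where "F \<equiv> free_group base"
abbreviation G where "G \<equiv> carrier F"

text \<open>\<open>M\<close> counts the items at a vertex, namely the \<open>2n\<close> letters and
  the vertex itself; \<open>W\<close> counts the \<open>2n\<close> slots and the
  \<open>2n - 1\<close> gaps between them.\<close>

definition M :: int where "M = 2 * int n + 1"
definition W :: real where "W = 4 * real n - 1"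

lemma eps_sq [simp]: "eps * eps = 1" and eps_abs: "eps ^ k = 1 \<or> eps ^ k = - 1"
proof -
  show "eps * eps = 1" using eps by auto
  show "eps ^ k = 1 \<or> eps ^ k = - 1"
    using eps by (cases "even k") auto
qed

lemma eps_even [simp]: "eps ^ (2 * k) = 1"
  using eps by (auto simp: power_mult)

lemma eps_pow_sq [simp]: "eps ^ k * eps ^ k = 1"
  using eps_abs[of k] by auto

lemma pos_letter:
  assumes "fst x \<in> base"
  shows "1 \<le> pos x" "pos x \<le> 2 * int n"
  using bij_betwE[OF pos_bij, rule_format, of x] assms unfolding base_def by auto

lemma pos_inj: "fst x \<in> base \<Longrightarrow> fst y \<in> base \<Longrightarrow> pos x = pos y \<longleftrightarrow> x = y"
  using bij_betw_imp_inj_on[OF pos_bij] unfolding base_def inj_on_def by blast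

lemma pos_surj: "1 \<le> c \<Longrightarrow> c \<le> 2 * int n \<Longrightarrow> \<exists>x. fst x \<in> base \<and> pos x = c"
proof -
  assume "1 \<le> c" "c \<le> 2 * int n"
  then have "c \<in> pos ` {x. fst x \<in> base}"
    unfolding base_def bij_betw_imp_surj_on[OF pos_bij] by simp
  then show ?thesis by blast
qed

lemma letter_s: "j < 2 * n \<Longrightarrow> fst (s ! j) \<in> base"
  using letters_s length_s nth_mem[of j s] unfolding base_def by (metis image_subset_iff)

lemma s_carrier: "s \<in> G"
proof -
  have "s ! Suc j \<noteq> flip (s ! j)" if "Suc j < 2 * n" for j
    using turn[OF that] eps_abs[of "Suc j"] by auto
  then show ?thesis
    using letters_s length_s unfolding base_def[symmetric] by (auto simp: carrier_free_group reduced_word_def successively_conv_nth)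
qed

definition q :: "nat letter list \<Rightarrow> int" where
  "q w = (if w = [] then 0 else pos (flip (last w)))"

text \<open>
  The interval of a word \<open>w\<close> is cut into \<open>2n\<close> slots separated by \<open>2n - 1\<close> gaps. The slot of an item
  \<open>i\<close> (a letter, or \<open>0\<close> for the vertex \<open>w\<close> itself) is its distance from the direction \<open>q w\<close> back to the
  root, in the orientation of \<open>w\<close>. At the root, the vertex itself gets the digit \<open>0\<close>, one slot to the left
  of the unit interval; the other end point of the circle is its translate by \<open>per\<close>.
\<close>

definition dig :: "nat letter list \<Rightarrow> int \<Rightarrow> int" where
  "dig w i = (eps ^ length w * (i - q w)) mod M"

definition lo :: "nat letter list \<Rightarrow> real" where
  "lo w = (\<Sum>k<length w. 2 * (of_int (dig (take k w) (pos (w ! k))) - 1) / W ^ Suc k)"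

definition wid :: "nat \<Rightarrow> real" where "wid k = 1 / W ^ k"

definition item :: "nat letter list \<Rightarrow> int \<Rightarrow> real" where
  "item w i = lo w + 2 * (of_int (dig w i) - 1) * wid (Suc (length w))"

text \<open>\<open>node w\<close> is shared by all reduced words and ends that continue
  \<open>w\<close> by a letter, whereas \<open>leaf w\<close> is reserved for the vertex
  \<open>w\<close> alone. At the root the leaf lies outside the node, to the left of the unit
  interval.\<close>

definition node :: "nat letter list \<Rightarrow> real set" where
  "node w = {lo w..lo w + wid (length w)}"

definition leaf :: "nat letter list \<Rightarrow> real set" where
  "leaf w = {item w 0..item w 0 + wid (Suc (length w))}"

section \<open>Nesting and disjointness of the intervals\<close>

lemma W_gt: "W \<ge> 7"
  using n_ge by (simp add: W_def)

lemma wid_pos [simp]: "wid k > 0"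
  using W_gt by (simp add: wid_def)

lemma wid_nonneg [simp]: "wid k \<ge> 0"
  using wid_pos[of k] by linarith

lemma wid_Suc: "wid k = W * wid (Suc k)"
  using W_gt by (simp add: wid_def)

lemma M_pos [simp]: "M > 0"
  by (simp add: M_def)

lemma lo_Nil [simp]: "lo [] = 0"
  by (simp add: lo_def)

lemma lo_snoc: "lo (w @ [x]) = item w (pos x)"
proof -
  have "lo (w @ [x]) = (\<Sum>k<length w. 2 * (of_int (dig (take k w) (pos (w ! k))) - 1) / W ^ Suc k)
      + 2 * (of_int (dig w (pos x)) - 1) / W ^ Suc (length w)"
    by (simp add: lo_def nth_append)
  then show ?thesis by (simp add: item_def lo_def wid_def)
qed

lemma dig_range: "0 \<le> dig w i" "dig w i \<le> 2 * int n"
  using pos_mod_bound[OF M_pos, of "eps ^ length w * (i - q w)"] by (auto simp: dig_def M_def)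

lemma dig_0_iff: "dig w i = 0 \<longleftrightarrow> i mod M = q w mod M"
proof -
  have "dig w i = 0 \<longleftrightarrow> M dvd eps ^ length w * (i - q w)" by (simp add: dig_def dvd_eq_mod_eq_0)
  also have "\<dots> \<longleftrightarrow> M dvd i - q w" using eps_abs[of "length w"] by (metis dvd_minus_iff minus_mult_left mult_1)
  also have "\<dots> \<longleftrightarrow> i mod M = q w mod M" by (simp add: mod_eq_dvd_iff)
  finally show ?thesis .
qed

lemma dig_eq_iff: "dig w i = dig w j \<longleftrightarrow> i mod M = j mod M"
proof -
  have "dig w i = dig w j \<longleftrightarrow> M dvd eps ^ length w * (i - q w) - eps ^ length w * (j - q w)"
    by (simp add: dig_def mod_eq_dvd_iff)
  also have "eps ^ length w * (i - q w) - eps ^ length w * (j - q w) = eps ^ length w * (i - j)"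
    by (simp add: algebra_simps)
  also have "M dvd \<dots> \<longleftrightarrow> M dvd i - j" using eps_abs[of "length w"] by (metis dvd_minus_iff minus_mult_left mult_1)
  finally show ?thesis by (simp add: mod_eq_dvd_iff)
qed

lemma small_mod [simp]: "0 \<le> i \<Longrightarrow> i \<le> 2 * int n \<Longrightarrow> i mod M = i"
  by (simp add: M_def)

lemma fst_last: "w \<in> G \<Longrightarrow> w \<noteq> [] \<Longrightarrow> fst (flip (last w)) \<in> base"
  using last_in_set[of w] by (auto simp: carrier_free_group)

lemma q_range: "w \<in> G \<Longrightarrow> 0 \<le> q w \<and> q w \<le> 2 * int n"
proof (cases "w = []")
  case False
  assume "w \<in> G"
  then have "fst (flip (last w)) \<in> base" using False fst_last by blast
  then show ?thesis using pos_letter[of "flip (last w)"] False by (auto simp: q_def)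
qed (simp add: q_def)

lemma snoc_carrier:
  "w @ [x] \<in> G \<longleftrightarrow> w \<in> G \<and> fst x \<in> base \<and> pos x \<noteq> q w"
proof (cases "fst x \<in> base")
  case True
  have "[x] \<in> G" using True by (simp add: carrier_free_group reduced_word_def)
  moreover have "w = [] \<or> x \<noteq> flip (last w) \<longleftrightarrow> pos x \<noteq> q w" if "w \<in> G"
  proof (cases "w = []")
    case False
    then have "fst (flip (last w)) \<in> base" using False that fst_last by blast
    then show ?thesis using pos_inj[OF True, of "flip (last w)"] False by (simp add: q_def)
  qed (use pos_letter[OF True] in \<open>simp add: q_def\<close>)
  ultimately show ?thesis using True by (auto simp: carrier_append)
qed (auto simp: carrier_free_group)

lemma snoc_carrierD:
  assumes "w @ [x] \<in> G"
  shows "w \<in> G" "fst x \<in> base" "pos x \<noteq> q w"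
  using assms unfolding snoc_carrier by blast+

lemma dig_child:
  assumes "w @ [x] \<in> G"
  shows "1 \<le> dig w (pos x)"
proof -
  have "dig w (pos x) \<noteq> 0"
    using q_range[of w] pos_letter[of x] snoc_carrierD[OF assms] by (simp add: dig_0_iff)
  then show ?thesis using dig_range(1)[of w "pos x"] by linarith
qed

lemma dig_vertex: "w \<in> G \<Longrightarrow> w \<noteq> [] \<Longrightarrow> 1 \<le> dig w 0"
proof -
  assume w: "w \<in> G" "w \<noteq> []"
  then have "fst (flip (last w)) \<in> base" using fst_last by blast
  then have "dig w 0 \<noteq> 0"
    using w pos_letter[of "flip (last w)"] by (simp add: dig_0_iff q_def)
  then show ?thesis using dig_range(1)[of w 0] by linarith
qed

lemma item_in_node:
  assumes "1 \<le> dig w i"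
  shows "lo w \<le> item w i" "item w i + wid (Suc (length w)) \<le> lo w + wid (length w)"
proof -
  let ?d = "wid (Suc (length w))" and ?e = "real_of_int (dig w i)"
  have e: "1 \<le> ?e" "?e \<le> 2 * real n" using assms dig_range(2)[of w i] by linarith+
  have "0 \<le> 2 * (?e - 1) * ?d" using e by (intro mult_nonneg_nonneg) auto
  then show "lo w \<le> item w i" by (simp add: item_def)
  have "(2 * (?e - 1) + 1) * ?d \<le> W * ?d" using e by (intro mult_right_mono) (auto simp: W_def)
  then show "item w i + ?d \<le> lo w + wid (length w)"
    by (simp add: item_def wid_Suc[of "length w"] algebra_simps)
qed

lemma node_snoc: "node (w @ [x]) = {item w (pos x)..item w (pos x) + wid (Suc (length w))}"
  by (simp add: node_def lo_snoc)

lemma node_snoc_subset: "w @ [x] \<in> G \<Longrightarrow> node (w @ [x]) \<subseteq> node w"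
  using item_in_node[OF dig_child] by (simp add: node_snoc) (simp add: node_def)

lemma node_append_subset: "w @ v \<in> G \<Longrightarrow> node (w @ v) \<subseteq> node w"
proof (induction v rule: rev_induct)
  case (snoc x v)
  then have "node ((w @ v) @ [x]) \<subseteq> node (w @ v)" by (intro node_snoc_subset) simp
  moreover have "w @ v \<in> G" using snoc.prems carrier_append[of "w @ v" "[x]"] by simp
  ultimately show ?case using snoc.IH by simp
qed simp

lemma leaf_subset_node: "w \<in> G \<Longrightarrow> w \<noteq> [] \<Longrightarrow> leaf w \<subseteq> node w"
  using item_in_node[OF dig_vertex] by (simp add: leaf_def node_def)

text \<open>In units of \<open>d\<close> the slots start at even offsets and have length one, so two
  different slots are at least one unit apart.\<close>

lemma slots_disjoint:
  fixes d L :: real and e e' :: int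
  assumes "d > 0" "x \<in> {L + 2 * (of_int e - 1) * d..L + 2 * (of_int e - 1) * d + d}"
    "x \<in> {L + 2 * (of_int e' - 1) * d..L + 2 * (of_int e' - 1) * d + d}"
  shows "e = e'"
proof -
  have *: "e \<le> e'" if "L + 2 * (of_int e - 1) * d \<le> x" "x \<le> L + 2 * (of_int e' - 1) * d + d" for e e' :: int
  proof -
    have "(2 * (of_int e - 1)) * d \<le> (2 * (of_int e' - 1) + 1) * d"
      using that by (simp add: algebra_simps)
    then have "real_of_int (2 * (e - 1)) \<le> of_int (2 * (e' - 1) + 1)" using assms(1) by simp
    then show ?thesis unfolding of_int_le_iff by presburger
  qed
  show ?thesis using *[of e e'] *[of e' e] assms by auto
qed

lemma items_disjoint:
  assumes "x \<in> {item w i..item w i + wid (Suc (length w))}" "x \<in> {item w j..item w j + wid (Suc (length w))}"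
  shows "dig w i = dig w j"
  using slots_disjoint[OF wid_pos] assms unfolding item_def by blast

lemma node_disjoint:
  assumes "u \<in> G" "v \<in> G" "length u = length v" "x \<in> node u" "x \<in> node v"
  shows "u = v"
  using assms
proof (induction u arbitrary: v rule: rev_induct)
  case (snoc a u)
  then obtain v' b where v: "v = v' @ [b]" by (metis length_0_conv length_append_singleton nat.distinct(1) rev_exhaust)
  have "u \<in> G" "v' \<in> G" using snoc.prems(1,2) unfolding v by (blast dest: snoc_carrierD)+
  moreover have "x \<in> node u" "x \<in> node v'" using snoc.prems v node_snoc_subset by blast+
  ultimately have uv: "u = v'" using snoc.IH[of v'] snoc.prems v by simp
  then have "dig u (pos a) = dig u (pos b)"
    using snoc.prems v items_disjoint[of x u "pos a" "pos b"] by (simp add: node_snoc)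
  then have "pos a = pos b"
    using pos_letter[of a] pos_letter[of b] snoc_carrierD(2)[OF snoc.prems(1)]
      snoc_carrierD(2)[OF snoc.prems(2)[unfolded v]] by (simp add: dig_eq_iff)
  then have "a = b"
    using pos_inj snoc_carrierD(2)[OF snoc.prems(1)] snoc_carrierD(2)[OF snoc.prems(2)[unfolded v]] by blast
  then show ?case using uv v by simp
qed simp

lemma leaf_node:
  assumes "v \<in> G" "u \<in> G" "x \<in> leaf v" "x \<in> node u"
  shows "\<exists>z. v = u @ z"
proof (cases "length u \<le> length v")
  case True
  show ?thesis
  proof (cases "v = []")
    case False
    have t: "take (length u) v \<in> G" using carrier_take assms by blast
    have "x \<in> node (take (length u) v)"
      using node_append_subset[of "take (length u) v" "drop (length u) v"] leaf_subset_node[OF assms(1) False] assms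
      by auto
    then have "u = take (length u) v" using node_disjoint[OF assms(2) t] True assms by simp
    then show ?thesis by (metis append_take_drop_id)
  qed (use True in simp)
next
  case False
  define u' where "u' = take (length v) u"
  define a where "a = u ! length v"
  obtain r where u: "u = (u' @ [a]) @ r"
    using False unfolding u'_def a_def by (metis append_take_drop_id not_le take_Suc_conv_app_nth)
  have uG: "u' @ [a] \<in> G" using assms(2) u carrier_append by metis
  have xa: "x \<in> node (u' @ [a])" using assms(2,4) node_append_subset[of "u' @ [a]" r] unfolding u by blast
  then have xu: "x \<in> node u'" using node_snoc_subset[OF uG] by blast
  have "u' \<in> G" using uG by (rule snoc_carrierD)
  have "u' = v"
  proof (cases "v = []")
    case False
    then have "x \<in> node v" using leaf_subset_node assms by blast
    then show ?thesis using node_disjoint[OF \<open>u' \<in> G\<close> assms(1) _ xu] \<open>\<not> length u \<le> length v\<close> by (simp add: u'_def)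
  qed (simp add: u'_def)
  \<comment> \<open>The point lies in the slot of a child of \<open>v\<close> and in the slot of
    \<open>v\<close> itself. These items would be congruent modulo \<open>M\<close>, but letters
    have positions from \<open>1\<close> to \<open>2n\<close>.\<close>
  then have "dig v (pos a) = dig v 0"
    using xa assms(3) items_disjoint[of x v "pos a" 0] by (simp add: node_snoc leaf_def)
  then have "pos a = 0" using pos_letter[OF snoc_carrierD(2)[OF uG]] by (simp add: dig_eq_iff)
  then show ?thesis using pos_letter[OF snoc_carrierD(2)[OF uG]] by simp
qed

lemma leaf_disjoint:
  assumes "u \<in> G" "v \<in> G" "x \<in> leaf u" "x \<in> leaf v"
  shows "u = v"
proof -
  have *: "u = v" if "length u \<le> length v" "u \<in> G" "v \<in> G" "x \<in> leaf u" "x \<in> leaf v" for u v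
  proof (cases "v = []")
    case False
    then have "x \<in> node v" using leaf_subset_node that by blast
    then show ?thesis using leaf_node[of u v x] that by auto
  qed (use that in simp)
  show ?thesis using *[of u v] *[of v u] assms by (metis nat_le_linear)
qed

text \<open>Gap \<open>e\<close> follows the slot with digit \<open>e\<close>. The two extra values
  at the root are the gaps adjoining the unit interval: \<open>0\<close> after the slot of the root,
  and \<open>2n\<close> before the translate of that slot.\<close>

definition gap_digit :: "nat letter list \<Rightarrow> int \<Rightarrow> bool" where
  "gap_digit w e \<longleftrightarrow> w = [] \<and> 0 \<le> e \<and> e \<le> 2 * int n \<or> 1 \<le> e \<and> e < 2 * int n"

definition gap :: "nat letter list \<Rightarrow> int \<Rightarrow> real set" where
  "gap w e = {lo w + (2 * of_int e - 1) * wid (Suc (length w))<..<lo w + 2 * of_int e * wid (Suc (length w))}"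

lemma gap_not_slot:
  fixes L d :: real and e e' :: int
  assumes "d > 0" "x \<in> {L + (2 * of_int e - 1) * d<..<L + 2 * of_int e * d}"
  shows "x \<notin> {L + 2 * (of_int e' - 1) * d..L + 2 * (of_int e' - 1) * d + d}"
proof
  assume x: "x \<in> {L + 2 * (of_int e' - 1) * d..L + 2 * (of_int e' - 1) * d + d}"
  have "(2 * of_int e - 1) * d < 2 * (of_int e' - 1) * d + d" "2 * (of_int e' - 1) * d < 2 * of_int e * d"
    using x assms(2) by auto
  then have "(2 * of_int e - 1) * d < (2 * (of_int e' - 1) + 1) * d" "2 * (of_int e' - 1) * d < 2 * of_int e * d"
    by (simp_all only: distrib_right mult_1)
  then have "real_of_int (2 * e - 1) < of_int (2 * (e' - 1) + 1)" "real_of_int (2 * (e' - 1)) < of_int (2 * e)"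
    using assms(1) by (simp_all add: mult_less_cancel_right_pos)
  then show False unfolding of_int_less_iff by presburger
qed

lemma gap_not_item: "x \<in> gap w e \<Longrightarrow> x \<notin> {item w i..item w i + wid (Suc (length w))}"
  using gap_not_slot[OF wid_pos] unfolding gap_def item_def by blast

lemma gap_subset_node: "1 \<le> e \<Longrightarrow> e < 2 * int n \<Longrightarrow> gap w e \<subseteq> node w"
proof -
  assume e: "1 \<le> e" "e < 2 * int n"
  let ?d = "wid (Suc (length w))"
  have e': "1 \<le> real_of_int e" "real_of_int e \<le> 2 * real n - 1" using e by linarith+
  have nn: "0 \<le> (2 * real_of_int e - 1) * ?d" using e' by (intro mult_nonneg_nonneg) auto
  have up: "2 * real_of_int e * ?d \<le> W * ?d"
    using e' by (intro mult_right_mono) (auto simp: W_def)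
  show ?thesis
  proof
    fix x assume "x \<in> gap w e"
    then have "lo w + (2 * real_of_int e - 1) * ?d < x" "x < lo w + 2 * real_of_int e * ?d"
      by (simp_all add: gap_def)
    then have "lo w \<le> x" "x \<le> lo w + W * ?d" using nn up by linarith+
    then show "x \<in> node w" by (simp add: node_def wid_Suc[of "length w"])
  qed
qed

lemma gap_not_leaf:
  assumes "w \<in> G" "v \<in> G" "gap_digit w e" "x \<in> gap w e"
  shows "x \<notin> leaf v"
proof
  assume x: "x \<in> leaf v"
  have "\<exists>z. v = w @ z"
  proof (cases "w = []")
    case False
    then have "x \<in> node w" using assms gap_subset_node by (auto simp: gap_digit_def)
    then show ?thesis using leaf_node assms x by blast
  qed simp
  then obtain z where z: "v = w @ z" by blast
  show False
  proof (cases z)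
    case Nil
    then show ?thesis using x gap_not_item[OF assms(4), of 0] z by (simp add: leaf_def)
  next
    case (Cons a z')
    then have v: "v = (w @ [a]) @ z'" using z by simp
    then have "x \<in> node (w @ [a])"
      using leaf_subset_node[OF assms(2)] node_append_subset[of "w @ [a]" z'] assms(2) x by auto
    then show ?thesis using gap_not_item[OF assms(4), of "pos a"] by (simp add: node_snoc)
  qed
qed

lemma gap_not_node:
  assumes "w \<in> G" "u \<in> G" "gap_digit w e" "x \<in> gap w e" "length w < length u"
  shows "x \<notin> node u"
proof
  assume x: "x \<in> node u"
  define u' where "u' = take (length w) u"
  define a where "a = u ! length w"
  obtain r where u: "u = (u' @ [a]) @ r"
    using assms(5) unfolding u'_def a_def by (metis append_take_drop_id take_Suc_conv_app_nth)
  have uG: "u' @ [a] \<in> G" using assms(2) u carrier_append by metis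
  have xa: "x \<in> node (u' @ [a])" using assms(2) x node_append_subset[of "u' @ [a]" r] unfolding u by blast
  then have xu: "x \<in> node u'" using node_snoc_subset[OF uG] by blast
  have "u' \<in> G" using uG by (rule snoc_carrierD)
  have "u' = w"
  proof (cases "w = []")
    case False
    then have "x \<in> node w" using assms gap_subset_node by (auto simp: gap_digit_def)
    then show ?thesis using node_disjoint[OF \<open>u' \<in> G\<close> assms(1) _ xu] assms(5) by (simp add: u'_def)
  qed (simp add: u'_def)
  then show False using gap_not_item[OF assms(4), of "pos a"] xa by (simp add: node_snoc)
qed

end

section \<open>Lines as gaps between intervals\<close>

context surface_word
begin

section \<open>Turns along the lines\<close>

lemma eps_cancel [simp]: "eps * (eps * x) = x" "eps ^ k * (eps ^ k * x) = x"
  by (simp_all flip: mult.assoc)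

text \<open>At its \<open>j\<close>-th vertex the path spelled by \<open>s\<close> comes from the
  item \<open>inn j\<close> and leaves by \<open>out j\<close>; the value \<open>0\<close>, the
  vertex itself, marks the start and the end of the path.\<close>

definition inn :: "nat \<Rightarrow> int" where
  "inn j = (if j = 0 then 0 else pos (flip (s ! (j - 1))))"

definition out :: "nat \<Rightarrow> int" where
  "out j = (if j < 2 * n then pos (s ! j) else 0)"

lemma inn_range: "j \<le> 2 * n \<Longrightarrow> 0 \<le> inn j \<and> inn j \<le> 2 * int n \<and> (inn j = 0 \<longleftrightarrow> j = 0)"
  using pos_letter[of "flip (s ! (j - 1))"] letter_s[of "j - 1"] by (auto simp: inn_def)

lemma out_range: "0 \<le> out j \<and> out j \<le> 2 * int n \<and> (out j = 0 \<longleftrightarrow> 2 * n \<le> j)"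
  using pos_letter[of "s ! j"] letter_s[of j] by (auto simp: out_def)

text \<open>This makes one congruence out of \<open>pos_first\<close>, \<open>turn\<close> and
  \<open>pos_last\<close>: every turn, including the degenerate ones at both ends, moves by one
  position in the cyclic order modulo \<open>M\<close>.\<close>

lemma turn_mod:
  assumes "j \<le> 2 * n"
  shows "M dvd out j - inn j - eps ^ j"
proof -
  consider "j = 0" | "0 < j" "j < 2 * n" | "j = 2 * n" using assms by linarith
  then show ?thesis
  proof cases
    case 1
    then show ?thesis using n_ge pos_first by (simp add: out_def inn_def)
  next
    case 2
    then show ?thesis using turn[of "j - 1"] by (simp add: out_def inn_def)
  next
    case 3
    \<comment> \<open>The difference is \<open>0 - 2n - 1\<close>, since \<open>s\<close> has even
      length and so the sign at its end is \<open>1\<close>.\<close>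
    then have "out j - inn j - eps ^ j = - M" using n_ge pos_last by (simp add: out_def inn_def M_def)
    then show ?thesis by simp
  qed
qed

definition hd_pos :: "nat letter list \<Rightarrow> int" where
  "hd_pos v = (case v of [] \<Rightarrow> 0 | y # _ \<Rightarrow> pos y)"

text \<open>
  A path that always turns to the neighbouring item on the side \<open>\<kappa>\<close> descends to the leaf at an end point
  of its interval; the lines \<open>g, gs, gs\<^sup>2, ...\<close> consist of such turns.
\<close>

primrec hug :: "int \<Rightarrow> nat letter list \<Rightarrow> bool" where
  "hug \<kappa> [] = True"
| "hug \<kappa> (x # v) = (M dvd hd_pos v - pos (flip x) - \<kappa> \<and> hug (eps * \<kappa>) v)"

lemma dig_turn:
  assumes "M dvd i - pos (flip x) - \<kappa>"
  shows "dig (u @ [x]) i = (eps ^ Suc (length u) * \<kappa>) mod M"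
proof -
  let ?E = "eps ^ Suc (length u)"
  have "M dvd ?E * (i - pos (flip x) - \<kappa>)" using assms by simp
  then have "M dvd ?E * (i - pos (flip x)) - ?E * \<kappa>" by (simp add: algebra_simps)
  then show ?thesis by (simp add: dig_def q_def mod_eq_dvd_iff)
qed

lemma item_first: "dig w i = 1 \<Longrightarrow> item w i = lo w"
  by (simp add: item_def)

lemma item_last: "dig w i = 2 * int n \<Longrightarrow> item w i + wid (Suc (length w)) = lo w + wid (length w)"
  by (simp add: item_def wid_Suc[of "length w"] W_def algebra_simps)

lemma M_mods: "1 mod M = 1" "(- 1) mod M = 2 * int n"
proof -
  show "1 mod M = 1" using n_ge by (simp add: M_def)
  have "(- 1) mod M = (M - 1) mod M" by (metis add.commute minus_mod_self2 uminus_add_conv_diff mod_add_self2)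
  then show "(- 1) mod M = 2 * int n" by (simp add: M_def)
qed

text \<open>Every turn takes the first slot, digit \<open>1\<close>, so the left end point never
  moves. Deepening by one letter multiplies both the orientation and the side by \<open>eps\<close>,
  which keeps their product equal to \<open>1\<close>.\<close>

lemma hug_lo:
  "u @ x # v \<in> G \<Longrightarrow> hug \<kappa> (x # v) \<Longrightarrow> eps ^ Suc (length u) * \<kappa> = 1 \<Longrightarrow>
    item u (pos x) = item (u @ x # v) 0"
proof (induction v arbitrary: u x \<kappa>)
  case Nil
  then have "dig (u @ [x]) 0 = 1" using dig_turn[of 0 x \<kappa> u] by (simp add: hd_pos_def M_mods)
  then show ?case using item_first lo_snoc by simp
next
  case (Cons y v)
  have "dig (u @ [x]) (pos y) = 1"
    using dig_turn[of "pos y" x \<kappa> u] Cons.prems by (simp add: hd_pos_def M_mods)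
  then have "item u (pos x) = item (u @ [x]) (pos y)" using item_first lo_snoc by simp
  also have "\<dots> = item ((u @ [x]) @ y # v) 0"
  proof (rule Cons.IH)
    have "eps ^ Suc (length (u @ [x])) * (eps * \<kappa>) = (eps * eps) * (eps ^ Suc (length u) * \<kappa>)"
      by (simp add: mult.left_commute)
    then show "eps ^ Suc (length (u @ [x])) * (eps * \<kappa>) = 1"
      using Cons.prems(3) by (simp only: eps_sq mult_1)
  qed (use Cons.prems in auto)
  finally show ?case by simp
qed

text \<open>The mirror image: \<open>-1\<close> modulo \<open>M\<close> is \<open>2n\<close>, so
  every turn takes the last slot and the right end points coincide.\<close>

lemma hug_hi:
  "u @ x # v \<in> G \<Longrightarrow> hug \<kappa> (x # v) \<Longrightarrow> eps ^ Suc (length u) * \<kappa> = - 1 \<Longrightarrow>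
    item u (pos x) + wid (Suc (length u)) = item (u @ x # v) 0 + wid (Suc (length (u @ x # v)))"
proof (induction v arbitrary: u x \<kappa>)
  case Nil
  then have "dig (u @ [x]) 0 = 2 * int n" using dig_turn[of 0 x \<kappa> u] by (simp add: hd_pos_def M_mods)
  then show ?case using item_last[of "u @ [x]" 0] lo_snoc by simp
next
  case (Cons y v)
  have "dig (u @ [x]) (pos y) = 2 * int n"
    using dig_turn[of "pos y" x \<kappa> u] Cons.prems by (simp add: hd_pos_def M_mods)
  then have "item u (pos x) + wid (Suc (length u)) = item (u @ [x]) (pos y) + wid (Suc (length (u @ [x])))"
    using item_last[of "u @ [x]" "pos y"] lo_snoc[of u x] by simp
  also have "\<dots> = item ((u @ [x]) @ y # v) 0 + wid (Suc (length ((u @ [x]) @ y # v)))"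
  proof (rule Cons.IH)
    have "eps ^ Suc (length (u @ [x])) * (eps * \<kappa>) = (eps * eps) * (eps ^ Suc (length u) * \<kappa>)"
      by (simp add: mult.left_commute)
    then show "eps ^ Suc (length (u @ [x])) * (eps * \<kappa>) = - 1"
      using Cons.prems(3) by (simp only: eps_sq mult_1)
  qed (use Cons.prems in auto)
  finally show ?case by simp
qed

lemma hug_drop: "j \<le> 2 * n \<Longrightarrow> hug (eps ^ Suc j) (drop j s)"
proof (induction rule: inc_induct)
  case base
  then show ?case using length_s by simp
next
  case (step j)
  have "drop j s = s ! j # drop (Suc j) s" using step length_s by (simp add: Cons_nth_drop_Suc)
  moreover have "hd_pos (drop (Suc j) s) = out (Suc j)"
  proof (cases "Suc j < 2 * n")
    case True
    then have "drop (Suc j) s = s ! Suc j # drop (Suc (Suc j)) s" using length_s by (simp add: Cons_nth_drop_Suc)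
    then show ?thesis using True by (simp add: hd_pos_def out_def)
  qed (use length_s in \<open>simp add: hd_pos_def out_def\<close>)
  ultimately show ?case
    using step turn_mod[of "Suc j"] by (simp add: inn_def)
qed

lemma winv_take_Suc: "j < 2 * n \<Longrightarrow> winv (take (Suc j) s) = flip (s ! j) # winv (take j s)"
  using length_s by (simp add: take_Suc_conv_app_nth)

text \<open>Reading a prefix of \<open>s\<close> backwards exchanges the incoming and the outgoing
  item at every vertex, so the turns are again between neighbours but to the opposite side.\<close>

lemma hug_take: "j < 2 * n \<Longrightarrow> hug (- (eps ^ j)) (winv (take (Suc j) s))"
proof (induction j)
  case 0
  have "M dvd - (out 0 - inn 0 - eps ^ 0)" using turn_mod[of 0] by (simp only: dvd_minus_iff)
  then show ?case using 0 winv_take_Suc[OF 0] by (simp add: hd_pos_def out_def inn_def)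
next
  case (Suc j)
  have "M dvd - (out (Suc j) - inn (Suc j) - eps ^ Suc j)"
    using turn_mod[of "Suc j"] Suc.prems by (simp only: dvd_minus_iff)
  then have "M dvd inn (Suc j) - out (Suc j) - - (eps ^ Suc j)" by (simp add: algebra_simps)
  moreover have "hd_pos (winv (take (Suc j) s)) = inn (Suc j)"
    using winv_take_Suc[of j] Suc.prems by (simp add: hd_pos_def inn_def)
  moreover have "eps * - (eps ^ Suc j) = - (eps ^ j)"
    using eps_sq by (metis minus_mult_right mult.assoc mult_1 power_Suc)
  ultimately show ?case
    using Suc winv_take_Suc[OF Suc.prems] by (simp add: out_def)
qed

text \<open>The neighbour on the right in the order of the real line. A vertex with orientation
  \<open>-1\<close> sees its line reversed, so there the right neighbour is reached by the inverse
  of \<open>s\<close>.\<close>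

definition nxt :: "nat letter list \<Rightarrow> nat letter list" where
  "nxt g = (if eps ^ length g = 1 then foldr push g s else foldr push g (winv s))"

definition prv :: "nat letter list \<Rightarrow> nat letter list" where
  "prv g = (if eps ^ length g = 1 then foldr push g (winv s) else foldr push g s)"

text \<open>The vertex \<open>w\<close> is the one nearest to the root on the tree path from
  \<open>g = w @ winv (take j s)\<close> to \<open>g s = w @ drop j s\<close>, and \<open>j\<close>
  is the number of letters read when the path gets there.\<close>

definition corner_at :: "nat letter list \<Rightarrow> nat \<Rightarrow> bool" where
  "corner_at w j \<longleftrightarrow> w \<in> G \<and> j \<le> 2 * n \<and> w @ winv (take j s) \<in> G \<and> w @ drop j s \<in> G"

lemma reduced_G: "w \<in> G \<Longrightarrow> reduced_word w"
  by (simp add: carrier_free_group)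

lemma winv_s_G: "winv s \<in> G"
  using winv_carrier[OF s_carrier] .

lemma mult_G: "u \<in> G \<Longrightarrow> v \<in> G \<Longrightarrow> foldr push u v \<in> G"
  using monoid.m_closed[OF group.is_monoid[OF group_free_group[of base]], of u v]
  by (simp add: mult_free_group)

lemma mult_s_cancel:
  assumes "g \<in> G"
  shows "foldr push (foldr push g s) (winv s) = g" "foldr push (foldr push g (winv s)) s = g"
proof -
  interpret group F by (rule group_free_group)
  have inv: "inv\<^bsub>F\<^esub> s = winv s" by (rule inv_free_group[OF s_carrier])
  show "foldr push (foldr push g s) (winv s) = g"
    using inv_solve_right[of g "foldr push g s" s] assms s_carrier mult_G inv
    by (simp add: mult_free_group)
  show "foldr push (foldr push g (winv s)) s = g"
    using assms s_carrier inv winv_s_G m_assoc[of g "winv s" s] l_inv[of s]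
    by (metis mult_free_group r_one)
qed

lemma corner_mult:
  assumes "corner_at w j"
  shows "foldr push (w @ winv (take j s)) s = w @ drop j s"
proof -
  have red: "reduced_word (w @ drop j s)" using assms reduced_G by (auto simp: corner_at_def)
  then have red': "reduced_word (drop j s)" by (simp add: reduced_word_append)
  have "foldr push (take j s) (drop j s) = s"
    using foldr_push_reduced[of "take j s" "drop j s"] s_carrier reduced_G by simp
  then have "foldr push (winv (take j s)) s = drop j s"
    using foldr_push_inverse[OF red', of "take j s"] by simp
  then show ?thesis using foldr_push_reduced[OF red] by simp
qed

text \<open>Because \<open>s\<close> has even length, \<open>g\<close> and \<open>g s\<close> have
  the same orientation; it is determined by \<open>w\<close> and \<open>j\<close>. This is also why
  \<open>nxt\<close> and \<open>prv\<close> undo each other.\<close>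

lemma corner_parity:
  assumes "corner_at w j"
  shows "eps ^ length (w @ winv (take j s)) = eps ^ (length w + j)"
    "eps ^ length (w @ drop j s) = eps ^ (length w + j)"
proof -
  have j: "j \<le> 2 * n" using assms by (simp add: corner_at_def)
  then show "eps ^ length (w @ winv (take j s)) = eps ^ (length w + j)" using length_s by simp
  have "eps ^ (2 * n - j) * eps ^ j = 1" using j by (simp flip: power_add)
  then have "eps ^ (2 * n - j) = eps ^ j" using eps_abs[of j] by auto
  then show "eps ^ length (w @ drop j s) = eps ^ (length w + j)"
    using length_s by (simp add: power_add)
qed

lemma corner_nxt:
  assumes "corner_at w j"
  shows "eps ^ (length w + j) = 1 \<Longrightarrow> nxt (w @ winv (take j s)) = w @ drop j s"
    "eps ^ (length w + j) = - 1 \<Longrightarrow> nxt (w @ drop j s) = w @ winv (take j s)"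
proof -
  have A: "w @ winv (take j s) \<in> G" using assms by (simp add: corner_at_def)
  show "eps ^ (length w + j) = 1 \<Longrightarrow> nxt (w @ winv (take j s)) = w @ drop j s"
    unfolding nxt_def corner_parity[OF assms] using corner_mult[OF assms] by presburger
  assume "eps ^ (length w + j) = - 1"
  then show "nxt (w @ drop j s) = w @ winv (take j s)"
    unfolding nxt_def corner_parity[OF assms] using mult_s_cancel(1)[OF A] corner_mult[OF assms] by simp
qed

lemma corner_exists:
  assumes g: "g \<in> G"
  obtains w j where "corner_at w j" "g = w @ winv (take j s)" "foldr push g s = w @ drop j s"
proof -
  obtain w p r where d: "g = w @ winv p" "s = p @ r" "foldr push g s = w @ r" "reduced_word (w @ r)"
    using foldr_push_cancel[OF reduced_G[OF g] reduced_G[OF s_carrier]] .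
  have t: "take (length p) s = p" "drop (length p) s = r" using d(2) by simp_all
  have "w @ r \<in> G" using mult_G[OF g s_carrier] d(3) by simp
  moreover have "w \<in> G" using g d(1) by (simp add: carrier_append)
  moreover have "length p \<le> 2 * n" using d(2) length_s by simp
  ultimately have "corner_at w (length p)"
    using g unfolding corner_at_def t d(1) by blast
  then show ?thesis by (rule that) (unfold t, fact d(1), fact d(3))
qed

lemma nxt_G: "g \<in> G \<Longrightarrow> nxt g \<in> G"
  using mult_G s_carrier winv_s_G by (simp add: nxt_def)

lemma prv_G: "g \<in> G \<Longrightarrow> prv g \<in> G"
  using mult_G s_carrier winv_s_G by (simp add: prv_def)

lemma mult_s_parity:
  assumes "g \<in> G"
  shows "eps ^ length (foldr push g s) = eps ^ length g" "eps ^ length (foldr push g (winv s)) = eps ^ length g"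
proof -
  have *: "eps ^ length (foldr push h s) = eps ^ length h" if h: "h \<in> G" for h
    using corner_exists[OF h] corner_parity by metis
  show "eps ^ length (foldr push g s) = eps ^ length g" using * assms .
  show "eps ^ length (foldr push g (winv s)) = eps ^ length g"
    using *[OF mult_G[OF assms winv_s_G]] mult_s_cancel(2)[OF assms] by simp
qed

lemma nxt_prv: "g \<in> G \<Longrightarrow> nxt (prv g) = g"
  using mult_s_parity[of g] mult_s_cancel[of g] by (simp add: nxt_def prv_def)

lemma prv_nxt: "g \<in> G \<Longrightarrow> prv (nxt g) = g"
  using mult_s_parity[of g] mult_s_cancel[of g] by (simp add: nxt_def prv_def)

text \<open>A shift by \<open>M\<close> digits on the first level: it moves the slot of the root
  from digit \<open>0\<close> to digit \<open>M\<close>, just beyond the last slot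
  \<open>2n\<close>. A line that arrives at the root from the left ends at this translate, hence
  \<open>lo_leaf'\<close>.\<close>

definition per :: real where "per = 2 * of_int M * wid 1"

definition hi_leaf :: "nat letter list \<Rightarrow> real" where
  "hi_leaf g = item g 0 + wid (Suc (length g))"

definition lo_leaf' :: "nat letter list \<Rightarrow> real" where
  "lo_leaf' g = item g 0 + (if g = [] then per else 0)"

text \<open>Successive digits bound a gap unless they wrap from \<open>2n\<close> to
  \<open>0\<close>. Away from the root the digit \<open>0\<close> is the direction back and does not
  occur, so wrapping is possible at the root only.\<close>

lemma consecutive_items:
  assumes step: "dig w r = (dig w l + 1) mod M"
    and ne: "w \<noteq> [] \<Longrightarrow> 1 \<le> dig w l \<and> 1 \<le> dig w r"
  shows "item w l + wid (Suc (length w)) = lo w + (2 * of_int (dig w l) - 1) * wid (Suc (length w))"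
    and "gap_digit w (dig w l)"
    and "dig w l < 2 * int n \<and> item w r = lo w + 2 * of_int (dig w l) * wid (Suc (length w)) \<or>
      w = [] \<and> dig w l = 2 * int n \<and> dig w r = 0"
proof -
  show "item w l + wid (Suc (length w)) = lo w + (2 * of_int (dig w l) - 1) * wid (Suc (length w))"
    by (simp add: item_def algebra_simps)
  have l: "0 \<le> dig w l" "dig w l \<le> 2 * int n" using dig_range by auto
  have *: "dig w l < 2 * int n \<or> w = [] \<and> dig w l = 2 * int n \<and> dig w r = 0"
    using step ne l by (cases "w = []"; cases "dig w l = 2 * int n") (auto simp: M_def)
  then show "gap_digit w (dig w l)" using l ne by (auto simp: gap_digit_def)
  have "dig w r = dig w l + 1" if "dig w l < 2 * int n" using that step l by simp
  then show "dig w l < 2 * int n \<and> item w r = lo w + 2 * of_int (dig w l) * wid (Suc (length w)) \<or>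
      w = [] \<and> dig w l = 2 * int n \<and> dig w r = 0"
    using * by (auto simp: item_def)
qed

definition is_gap :: "nat letter list \<Rightarrow> nat letter list \<Rightarrow> int \<Rightarrow> bool" where
  "is_gap g w e \<longleftrightarrow> gap_digit w e \<and>
     hi_leaf g = lo w + (2 * of_int e - 1) * wid (Suc (length w)) \<and>
     lo_leaf' (nxt g) = lo w + 2 * of_int e * wid (Suc (length w))"

lemma corner_dig:
  assumes "corner_at w j"
  shows "dig w (out j) = (dig w (inn j) + eps ^ (length w + j)) mod M"
    "dig w (inn j) = (dig w (out j) - eps ^ (length w + j)) mod M"
proof -
  let ?E = "eps ^ length w"
  have "M dvd ?E * (out j - inn j - eps ^ j)" using turn_mod assms by (simp add: corner_at_def)
  then have *: "M dvd ?E * (out j - q w) - (?E * (inn j - q w) + eps ^ (length w + j))"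
    by (simp add: algebra_simps power_add)
  then show "dig w (out j) = (dig w (inn j) + eps ^ (length w + j)) mod M"
    unfolding dig_def mod_add_left_eq mod_eq_dvd_iff .
  from * have "M dvd - (?E * (out j - q w) - (?E * (inn j - q w) + eps ^ (length w + j)))"
    by (simp only: dvd_minus_iff)
  then have "M dvd ?E * (inn j - q w) - (?E * (out j - q w) - eps ^ (length w + j))"
    by (simp add: algebra_simps)
  then show "dig w (inn j) = (dig w (out j) - eps ^ (length w + j)) mod M"
    unfolding dig_def mod_diff_left_eq mod_eq_dvd_iff .
qed

lemma corner_dig_pos:
  assumes "corner_at w j" "w \<noteq> []"
  shows "1 \<le> dig w (inn j)" "1 \<le> dig w (out j)"
proof -
  have w: "w \<in> G" "j \<le> 2 * n" "w @ winv (take j s) \<in> G" "w @ drop j s \<in> G"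
    using assms by (auto simp: corner_at_def)
  show "1 \<le> dig w (inn j)"
  proof (cases j)
    case (Suc i)
    then have "w @ [flip (s ! i)] \<in> G"
      using w winv_take_Suc[of i] carrier_append[of "w @ [flip (s ! i)]" "winv (take i s)" base] by simp
    then show ?thesis using dig_child Suc by (simp add: inn_def)
  qed (use w assms dig_vertex in \<open>simp add: inn_def\<close>)
  show "1 \<le> dig w (out j)"
  proof (cases "j < 2 * n")
    case True
    then have "w @ [s ! j] \<in> G"
      using w length_s carrier_append[of "w @ [s ! j]" "drop (Suc j) s" base] by (simp add: Cons_nth_drop_Suc)
    then show ?thesis using dig_child True by (simp add: out_def)
  qed (use w assms dig_vertex in \<open>simp add: out_def\<close>)
qed

text \<open>From \<open>w\<close> the path to either end of the line edge hugs one side, so the slot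
  of the end vertex touches the same end point as the slot of the first step. The gap between two
  adjacent items at \<open>w\<close> is thereby a gap between the leaves of two vertices.\<close>

lemma corner_leaves:
  assumes c: "corner_at w j"
  defines "A \<equiv> w @ winv (take j s)" and "B \<equiv> w @ drop j s"
  shows "eps ^ (length w + j) = 1 \<Longrightarrow> hi_leaf A = item w (inn j) + wid (Suc (length w))"
    and "eps ^ (length w + j) = 1 \<Longrightarrow> item B 0 = item w (out j)"
    and "eps ^ (length w + j) = - 1 \<Longrightarrow> item A 0 = item w (inn j)"
    and "eps ^ (length w + j) = - 1 \<Longrightarrow> hi_leaf B = item w (out j) + wid (Suc (length w))"
proof -
  have w: "w \<in> G" "j \<le> 2 * n" "A \<in> G" "B \<in> G"
    using c by (auto simp: corner_at_def A_def B_def)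
  have A: "item A 0 = item w (inn j) \<and> eps ^ (length w + j) = - 1 \<or>
      hi_leaf A = item w (inn j) + wid (Suc (length w)) \<and> eps ^ (length w + j) = 1 \<or>
      j = 0"
  proof (cases j)
    case (Suc i)
    then have A_eq: "A = w @ flip (s ! i) # winv (take i s)" using winv_take_Suc[of i] w by (simp add: A_def)
    have hug: "hug (- (eps ^ i)) (flip (s ! i) # winv (take i s))"
      using hug_take[of i] winv_take_Suc[of i] w Suc by simp
    have e: "eps ^ Suc (length w) * - (eps ^ i) = - (eps ^ (length w + j))"
      by (simp add: Suc power_add)
    from eps_abs[of "length w + j"] show ?thesis
    proof
      assume "eps ^ (length w + j) = 1"
      then show ?thesis
        using hug_hi[of w _ _ "- (eps ^ i)"] hug e w(3) unfolding A_eq hi_leaf_def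
        by (simp add: Suc inn_def)
    next
      assume "eps ^ (length w + j) = - 1"
      then show ?thesis
        using hug_lo[of w _ _ "- (eps ^ i)"] hug e w(3) unfolding A_eq
        by (simp add: Suc inn_def)
    qed
  qed simp
  have B: "item B 0 = item w (out j) \<and> eps ^ (length w + j) = 1 \<or>
      hi_leaf B = item w (out j) + wid (Suc (length w)) \<and> eps ^ (length w + j) = - 1 \<or>
      j = 2 * n"
  proof (cases "j < 2 * n")
    case True
    then have B_eq: "B = w @ s ! j # drop (Suc j) s" "drop j s = s ! j # drop (Suc j) s"
      using length_s by (simp_all add: B_def Cons_nth_drop_Suc)
    have hug: "hug (eps ^ Suc j) (s ! j # drop (Suc j) s)"
      using hug_drop[of j] w B_eq by simp
    have e: "eps ^ Suc (length w) * eps ^ Suc j = eps ^ (length w + j)"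
      by (simp add: power_add mult.left_commute)
    from eps_abs[of "length w + j"] show ?thesis
    proof
      assume "eps ^ (length w + j) = 1"
      then show ?thesis
        using hug_lo[of w _ _ "eps ^ Suc j"] hug e w(4) True unfolding B_eq
        by (simp add: out_def)
    next
      assume "eps ^ (length w + j) = - 1"
      then show ?thesis
        using hug_hi[of w _ _ "eps ^ Suc j"] hug e w(4) True unfolding B_eq hi_leaf_def
        by (simp add: out_def)
    qed
  qed (use w in simp)
  \<comment> \<open>If \<open>j = 0\<close> or \<open>j = 2n\<close>, one end of the edge is
    \<open>w\<close> itself; its item is \<open>0\<close> and there is no path to follow.\<close>
  have A0: "A = w" "inn j = 0" if "j = 0" using that by (simp_all add: A_def inn_def)
  have B0: "B = w" "out j = 0" if "j = 2 * n" using that length_s by (simp_all add: B_def out_def)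
  show "eps ^ (length w + j) = 1 \<Longrightarrow> hi_leaf A = item w (inn j) + wid (Suc (length w))"
    using A A0 by (auto simp: hi_leaf_def)
  show "eps ^ (length w + j) = 1 \<Longrightarrow> item B 0 = item w (out j)" using B B0 by auto
  show "eps ^ (length w + j) = - 1 \<Longrightarrow> item A 0 = item w (inn j)" using A A0 by auto
  show "eps ^ (length w + j) = - 1 \<Longrightarrow> hi_leaf B = item w (out j) + wid (Suc (length w))"
    using B B0 by (auto simp: hi_leaf_def)
qed

lemma dig_Nil: "0 \<le> i \<Longrightarrow> i \<le> 2 * int n \<Longrightarrow> dig [] i = i"
  by (simp add: dig_def q_def)

lemma corner_is_gap:
  assumes c: "corner_at w j"
  shows "eps ^ (length w + j) = 1 \<Longrightarrow> is_gap (w @ winv (take j s)) w (dig w (inn j))"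
    and "eps ^ (length w + j) = - 1 \<Longrightarrow> is_gap (w @ drop j s) w (dig w (out j))"
proof -
  let ?A = "w @ winv (take j s)" and ?B = "w @ drop j s"
  have j: "j \<le> 2 * n" using c by (simp add: corner_at_def)
  { assume o: "eps ^ (length w + j) = 1"
    note ci = consecutive_items[OF corner_dig(1)[OF c, unfolded o]] 
    have ci3: "dig w (inn j) < 2 * int n \<and> item w (out j) = lo w + 2 * of_int (dig w (inn j)) * wid (Suc (length w)) \<or>
      w = [] \<and> dig w (inn j) = 2 * int n \<and> dig w (out j) = 0"
      by (rule ci(3)) (use corner_dig_pos[OF c] in auto)
    have "lo_leaf' ?B = lo w + 2 * of_int (dig w (inn j)) * wid (Suc (length w))"
      using ci3
    proof
      assume a: "dig w (inn j) < 2 * int n \<and> item w (out j) = lo w + 2 * of_int (dig w (inn j)) * wid (Suc (length w))"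
      have "?B \<noteq> []"
      proof
        assume B: "?B = []"
        then have "w = []" "j = 2 * n" using j length_s by auto
        then have "dig w (inn j) = 2 * int n" using pos_last n_ge by (simp add: inn_def dig_Nil)
        then show False using a by simp
      qed
      then have "lo_leaf' ?B = item ?B 0" by (simp only: lo_leaf'_def if_False add_0_right)
      then show ?thesis using a corner_leaves(2)[OF c o] by simp
    next
      \<comment> \<open>Here the line returns to the root: its last gap ends at the translate of the
        slot of the root, whose left end is \<open>2 * (M - 1) = 4n\<close> units of level
        one.\<close>
      assume a: "w = [] \<and> dig w (inn j) = 2 * int n \<and> dig w (out j) = 0"
      then have "out j = 0" using out_range[of j] dig_Nil[of "out j"] by metis
      then have "?B = []" using out_range[of j] j a length_s by simp
      moreover have "item [] 0 = - 2 * wid 1" by (simp add: item_def dig_Nil)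
      moreover have "real_of_int (dig [] (inn j)) = 2 * real n" using a by auto
      ultimately show ?thesis using a by (simp add: lo_leaf'_def per_def M_def algebra_simps)
    qed
    then show "is_gap ?A w (dig w (inn j))"
      unfolding is_gap_def corner_nxt(1)[OF c o]
      using ci(1,2) corner_leaves(1)[OF c o] corner_dig_pos[OF c] by simp }
  { assume o: "eps ^ (length w + j) = - 1"
    have d: "dig w (inn j) = (dig w (out j) + 1) mod M" using corner_dig(2)[OF c] o by simp
    note ci = consecutive_items[OF d]
    have ci3: "dig w (out j) < 2 * int n \<and> item w (inn j) = lo w + 2 * of_int (dig w (out j)) * wid (Suc (length w)) \<or>
      w = [] \<and> dig w (out j) = 2 * int n \<and> dig w (inn j) = 0"
      by (rule ci(3)) (use corner_dig_pos[OF c] in auto)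
    \<comment> \<open>With this orientation there is no wrapping: at the root
      \<open>inn j = 0\<close> only for \<open>j = 0\<close>, and then the sign would be
      \<open>1\<close>.\<close>
    have j0: "\<not> (w = [] \<and> j = 0)" using o by (cases "j = 0") auto
    have "inn j \<noteq> 0" if "w = []" using that inn_range[OF j] j0 by simp
    then have "item w (inn j) = lo w + 2 * of_int (dig w (out j)) * wid (Suc (length w))"
      using ci3 dig_Nil inn_range[OF j] by auto
    moreover have "?A \<noteq> []" using j0 n_ge length_s by auto
    then have "lo_leaf' ?A = item ?A 0" by (simp only: lo_leaf'_def if_False add_0_right)
    ultimately have "lo_leaf' ?A = lo w + 2 * of_int (dig w (out j)) * wid (Suc (length w))"
      using corner_leaves(3)[OF c o] by simp
    then show "is_gap ?B w (dig w (out j))"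
      unfolding is_gap_def corner_nxt(2)[OF c o]
      using ci(1,2) corner_leaves(4)[OF c o] corner_dig_pos[OF c] by simp }
qed

text \<open>The gap filled by the edge from \<open>g\<close> to \<open>nxt g\<close> sits at the
  corner of that edge. For orientation \<open>-1\<close> the corner is taken for
  \<open>nxt g\<close>, from which \<open>g\<close> is reached by \<open>s\<close>.\<close>

lemma gap_of:
  assumes g: "g \<in> G"
  obtains w e z z' where "w \<in> G" "is_gap g w e" "g = w @ z" "nxt g = w @ z'"
proof (cases "eps ^ length g = 1")
  case True
  obtain w j where c: "corner_at w j" "g = w @ winv (take j s)" "foldr push g s = w @ drop j s"
    using corner_exists[OF g] .
  have o: "eps ^ (length w + j) = 1" using corner_parity(1)[OF c(1)] True c(2) by simp
  show ?thesis
    using that[of w _ "winv (take j s)" "drop j s"] c corner_is_gap(1)[OF c(1) o] corner_nxt(1)[OF c(1) o]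
    by (simp add: corner_at_def)
next
  case False
  define a where "a = foldr push g (winv s)"
  have a: "a \<in> G" "foldr push a s = g"
    using mult_G[OF g winv_s_G] mult_s_cancel(2)[OF g] by (simp_all add: a_def)
  obtain w j where c: "corner_at w j" "a = w @ winv (take j s)" "foldr push a s = w @ drop j s"
    using corner_exists[OF a(1)] .
  have gw: "g = w @ drop j s" using c a by simp
  have "eps ^ (length w + j) \<noteq> 1" using corner_parity(2)[OF c(1)] False gw by metis
  then have o: "eps ^ (length w + j) = - 1" using eps_abs by blast
  show ?thesis
    using that[of w _ "drop j s" "winv (take j s)"] c gw corner_is_gap(2)[OF c(1) o] corner_nxt(2)[OF c(1) o]
    by (simp add: corner_at_def)
qed

lemma corner_cover:
  assumes "0 \<le> c" "c \<le> 2 * int n"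
  obtains j where "j \<le> 2 * n" "eps ^ j = 1 \<and> inn j = c \<or> eps ^ j = - 1 \<and> out j = c"
proof -
  consider "c = 0" | "c = 2 * int n" | "1 \<le> c" "c < 2 * int n" using assms by linarith
  then show ?thesis
  proof cases
    case 1
    then show ?thesis using that[of 0] by (simp add: inn_def)
  next
    case 2
    then show ?thesis using that[of "2 * n"] n_ge pos_last by (simp add: inn_def)
  next
    case 3
    obtain j where "0 < j" "j < 2 * n" "if eps ^ j = 1 then pos (flip (s ! (j - 1))) = c else pos (s ! j) = c"
      using corner[OF 3] by blast
    then show ?thesis using that[of j] eps_abs[of j] by (auto simp: inn_def out_def split: if_splits)
  qed
qed

text \<open>A turn of \<open>s\<close> can be placed at \<open>w\<close> as soon as neither of its
  two items is the direction back to the root, because then nothing cancels on either side.\<close>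

lemma corner_at_iff:
  assumes w: "w \<in> G" and j: "j \<le> 2 * n" and d: "1 \<le> dig w (inn j)" "1 \<le> dig w (out j)"
  shows "corner_at w j"
proof -
  have "w @ winv (take j s) \<in> G"
  proof (cases j)
    case (Suc i)
    have "pos (flip (s ! i)) \<noteq> q w" using d(1) Suc dig_0_iff[of w "inn j"] by (auto simp: inn_def)
    then have "w @ [flip (s ! i)] \<in> G" using w letter_s[of i] j Suc by (simp add: snoc_carrier)
    moreover have "flip (s ! i) # winv (take i s) \<in> G"
      using winv_carrier[OF carrier_take[OF s_carrier, of "Suc i"]] winv_take_Suc[of i] j Suc by simp
    ultimately show ?thesis
      using winv_take_Suc[of i] j Suc by (simp add: carrier_append)
  qed (use w in simp)
  moreover have "w @ drop j s \<in> G"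
  proof (cases "j < 2 * n")
    case True
    have "pos (s ! j) \<noteq> q w" using d(2) True dig_0_iff[of w "out j"] by (auto simp: out_def)
    then have "w @ [s ! j] \<in> G" using w letter_s[of j] True by (simp add: snoc_carrier)
    moreover have ds: "drop j s = s ! j # drop (Suc j) s" using True length_s by (simp add: Cons_nth_drop_Suc)
    moreover have "drop j s \<in> G" using s_carrier carrier_append[of "take j s" "drop j s" base] by simp
    ultimately show ?thesis by (simp add: carrier_append)
  qed (use w length_s in simp)
  ultimately show ?thesis using w j by (simp add: corner_at_def)
qed

lemma index_of_dig:
  assumes "0 \<le> e" "e \<le> 2 * int n"
  obtains i where "0 \<le> i" "i \<le> 2 * int n" "dig w i = e" "i = (q w + eps ^ length w * e) mod M"
proof (rule that)
  let ?i = "(q w + eps ^ length w * e) mod M"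
  show "0 \<le> ?i" by simp
  show "?i \<le> 2 * int n" using pos_mod_bound[OF M_pos, of "q w + eps ^ length w * e"] by (simp add: M_def)
  have "dig w ?i = dig w (q w + eps ^ length w * e)" by (simp add: dig_eq_iff)
  also have "\<dots> = (eps ^ length w * eps ^ length w * e) mod M" by (simp add: dig_def mult.assoc)
  also have "\<dots> = e" using assms by simp
  finally show "dig w ?i = e" .
qed simp

text \<open>The converse of \<open>gap_of\<close>: the items in the slots \<open>e\<close> and
  \<open>e + 1\<close> are cyclically adjacent, \<open>corner\<close> provides a turn of
  \<open>s\<close> between them, and the line making this turn at \<open>w\<close> fills the
  gap.\<close>

lemma gap_exists:
  assumes w: "w \<in> G" and e: "1 \<le> e" "e < 2 * int n"
  obtains g where "g \<in> G" "is_gap g w e"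
proof -
  let ?E = "eps ^ length w"
  obtain l where l: "0 \<le> l" "l \<le> 2 * int n" "dig w l = e" "l = (q w + ?E * e) mod M"
    using index_of_dig[of e w] e by auto
  obtain r where r: "0 \<le> r" "r \<le> 2 * int n" "dig w r = e + 1" "r = (q w + ?E * (e + 1)) mod M"
    using index_of_dig[of "e + 1" w] e by auto
  have lr: "r = (l + ?E) mod M"
    unfolding l(4) r(4) mod_add_left_eq by (simp add: algebra_simps)
  \<comment> \<open>\<open>c\<close> is the item that comes first in the numbering by
    \<open>pos\<close>: the left one if \<open>w\<close> has orientation \<open>1\<close>, the right
    one otherwise. The other item is \<open>c + 1\<close> modulo \<open>M\<close>.\<close>
  define c where "c = (if ?E = 1 then l else r)"
  have c: "0 \<le> c" "c \<le> 2 * int n" using l r by (auto simp: c_def)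
  obtain j where j: "j \<le> 2 * n" "eps ^ j = 1 \<and> inn j = c \<or> eps ^ j = - 1 \<and> out j = c"
    using corner_cover[OF c] .
  have t: "out j mod M = (inn j + eps ^ j) mod M"
    using turn_mod[OF j(1)] by (simp add: mod_eq_dvd_iff algebra_simps)
  then have t': "out j = (inn j + eps ^ j) mod M" using out_range[of j] by simp
  have t2: "inn j mod M = (out j - eps ^ j) mod M"
    using turn_mod[OF j(1)] dvd_minus_iff[of M "out j - inn j - eps ^ j"] by (simp add: mod_eq_dvd_iff algebra_simps)
  then have t2': "inn j = (out j - eps ^ j) mod M" using inn_range[OF j(1)] by simp
  have rl: "l = (r - ?E) mod M"
  proof -
    have "(r - ?E) mod M = l mod M" unfolding lr by (simp add: mod_diff_left_eq)
    then show ?thesis using l by simp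
  qed
  have sides: "eps ^ (length w + j) = 1 \<and> inn j = l \<and> out j = r \<or> eps ^ (length w + j) = - 1 \<and> out j = l \<and> inn j = r"
    using eps_abs[of "length w"]
  proof
    assume E: "?E = 1"
    have "c = l" using E by (simp add: c_def)
    have "eps ^ j = 1 \<Longrightarrow> inn j = l \<Longrightarrow> out j = r" using t' lr E by simp
    moreover have "eps ^ j = - 1 \<Longrightarrow> out j = l \<Longrightarrow> inn j = r" using t2' lr E by simp
    ultimately show ?thesis using j(2) E \<open>c = l\<close> unfolding power_add by auto
  next
    assume E: "?E = - 1"
    have "c = r" using E by (simp add: c_def)
    have "eps ^ j = 1 \<Longrightarrow> inn j = r \<Longrightarrow> out j = l" using t' rl E by simp
    moreover have "eps ^ j = - 1 \<Longrightarrow> out j = r \<Longrightarrow> inn j = l" using t2' rl E by simp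
    ultimately show ?thesis using j(2) E \<open>c = r\<close> unfolding power_add by auto
  qed
  have ca: "corner_at w j" using corner_at_iff[OF w j(1)] sides l r e by auto
  then have "w @ winv (take j s) \<in> G" "w @ drop j s \<in> G" by (auto simp: corner_at_def)
  then show ?thesis using that corner_is_gap[OF ca] sides l by auto
qed

end

section \<open>Segments of the parameter interval that carry the line edges\<close>

context surface_word
begin

text \<open>A vertex sits in the middle of its slot, and the two halves of the slot belong to the
  two line edges at this vertex. This spreads each vertex over an interval, so an edge occupies a
  gap together with a half slot at either side.\<close>

definition phi :: "nat letter list \<Rightarrow> real" where
  "phi g = item g 0 + wid (Suc (length g)) / 2"

definition phi' :: "nat letter list \<Rightarrow> real" where
  "phi' g = phi g + (if g = [] then per else 0)"

definition seg :: "nat letter list \<Rightarrow> real set" where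
  "seg g = {phi g..phi' (nxt g)}"

lemma phi'_eq: "phi' g = lo_leaf' g + wid (Suc (length g)) / 2"
  by (simp add: phi'_def phi_def lo_leaf'_def)

lemma phi'_phi: "g \<noteq> [] \<Longrightarrow> phi' g = phi g"
  by (simp add: phi'_def)

definition del :: real where "del = wid (Suc 0)"

lemma wid_Suc_0 [simp]: "wid (Suc 0) = del"
  by (simp add: del_def)

lemma del_pos: "0 < del"
  unfolding del_def by (rule wid_pos)

lemma wid_1: "W * del = 1"
  using wid_Suc[of 0] by (simp add: wid_def[of 0])

lemma item_Nil_0: "item [] 0 = - 2 * del"
  by (simp add: item_def dig_Nil)

lemma per_eq: "per = 1 + 3 * del"
proof -
  have "per = (W + 3) * del" by (simp add: per_def M_def W_def)
  then show ?thesis using wid_1 by (simp add: distrib_right)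
qed

lemma phi_Nil: "phi [] = - 3 / 2 * del" "phi' [] = 1 + 3 / 2 * del"
  using item_Nil_0 per_eq by (simp_all add: phi_def phi'_def)

lemma phi_in_leaf: "phi g \<in> leaf g"
  by (simp add: phi_def leaf_def)

lemma node_Nil: "node [] = {0..1}"
  by (simp add: node_def wid_def)

lemma node_bounds: "u \<in> G \<Longrightarrow> node u \<subseteq> {0..1}"
  using node_append_subset[of "[]" u] node_Nil by simp

lemma leaf_bounds: "g \<in> G \<Longrightarrow> g \<noteq> [] \<Longrightarrow> leaf g \<subseteq> {0..1}"
  using node_bounds leaf_subset_node by blast

lemma phi_bounds:
  assumes "g \<in> G"
  shows "phi [] \<le> phi g" "phi g \<le> 1" "phi' g \<le> phi' []" "0 \<le> phi' g"
proof -
  note w = del_pos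
  have *: "0 \<le> phi g \<and> phi g \<le> 1" if "g \<noteq> []"
    using leaf_bounds[OF assms that] phi_in_leaf[of g] by auto
  show "phi [] \<le> phi g" using * phi_Nil w by (cases "g = []") auto
  show "phi g \<le> 1" using * phi_Nil w by (cases "g = []") auto
  show "phi' g \<le> phi' []" using * phi_Nil w phi'_phi[of g] by (cases "g = []") auto
  show "0 \<le> phi' g" using * phi_Nil w phi'_phi[of g] by (cases "g = []") auto
qed

lemma phi_inj: "g \<in> G \<Longrightarrow> h \<in> G \<Longrightarrow> phi g = phi h \<Longrightarrow> g = h"
  using leaf_disjoint[of g h "phi g"] phi_in_leaf[of g] phi_in_leaf[of h] by simp

lemma is_gap_less: "is_gap g w e \<Longrightarrow> hi_leaf g < lo_leaf' (nxt g)"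
proof -
  assume "is_gap g w e"
  then have "hi_leaf g = lo w + (2 * of_int e - 1) * wid (Suc (length w))"
    "lo_leaf' (nxt g) = lo w + 2 * of_int e * wid (Suc (length w))"
    by (auto simp: is_gap_def)
  then show ?thesis using wid_pos[of "Suc (length w)"] by (simp add: left_diff_distrib)
qed

lemma phi_hi: "phi g < hi_leaf g" "lo_leaf' g < phi' g"
  using wid_pos[of "Suc (length g)"] by (auto simp: phi_def hi_leaf_def phi'_eq)

lemma phi_less_nxt: "g \<in> G \<Longrightarrow> phi g < hi_leaf g \<and> hi_leaf g < lo_leaf' (nxt g) \<and> lo_leaf' (nxt g) < phi' (nxt g)"
proof -
  assume g: "g \<in> G"
  obtain w e z z' where "is_gap g w e" using gap_of[OF g] .
  then show ?thesis using is_gap_less phi_hi by blast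
qed

text \<open>A segment consists of the right half of one slot, a gap, and the left half of the next
  slot. If the next vertex is the root, that last half belongs to its translate and lies beyond
  \<open>1\<close>.\<close>

lemma seg_cases:
  assumes g: "g \<in> G" and x: "x \<in> seg g"
  obtains (left) "x \<in> leaf g" "x < phi' (nxt g)"
  | (mid) w e z z' where "w \<in> G" "gap_digit w e" "x \<in> gap w e" "g = w @ z" "nxt g = w @ z'" "phi g < x" "x < phi' (nxt g)"
  | (right) "nxt g \<noteq> []" "x \<in> leaf (nxt g)" "phi g < x"
  | (wrap) "nxt g = []" "1 < x" "phi g < x"
proof -
  obtain w e z z' where w: "w \<in> G" "is_gap g w e" "g = w @ z" "nxt g = w @ z'" using gap_of[OF g] .
  note less = phi_less_nxt[OF g]
  have x': "phi g \<le> x" "x \<le> phi' (nxt g)" using x by (auto simp: seg_def)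
  consider "x \<le> hi_leaf g" | "hi_leaf g < x" "x < lo_leaf' (nxt g)" | "lo_leaf' (nxt g) \<le> x" by linarith
  then show ?thesis
  proof cases
    case 1
    then show ?thesis using left x' less phi_in_leaf[of g] by (auto simp: leaf_def hi_leaf_def)
  next
    case 2
    then have "x \<in> gap w e" using w(2) by (simp add: gap_def is_gap_def)
    then show ?thesis using mid[of w e z z'] w 2 less by (auto simp: is_gap_def)
  next
    case 3
    show ?thesis
    proof (cases "nxt g = []")
      case True
      have "lo_leaf' [] = 1 + del" using item_Nil_0 per_eq by (simp add: lo_leaf'_def)
      then have "1 < x" using 3 True del_pos by simp
      then show ?thesis using wrap True 3 less by auto
    next
      case False
      have "x \<in> leaf (nxt g)"
        using 3 x' wid_pos[of "Suc (length (nxt g))"] False by (auto simp: leaf_def phi'_eq lo_leaf'_def)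
      then show ?thesis using right False 3 less by auto
    qed
  qed
qed

lemma seg_no_phi:
  assumes g: "g \<in> G" and h: "h \<in> G" and x: "phi g < phi h" "phi h < phi' (nxt g)"
  shows False
proof -
  have "phi h \<in> seg g" using x by (simp add: seg_def)
  with g show False
  proof (cases rule: seg_cases)
    case left
    then show ?thesis using leaf_disjoint[OF g h] phi_in_leaf x by blast
  next
    case (mid w e z z')
    then show ?thesis using gap_not_leaf[OF _ h] phi_in_leaf by blast
  next
    case right
    then have "nxt g = h" using leaf_disjoint[OF nxt_G[OF g] h] phi_in_leaf by blast
    then show ?thesis using x right phi'_phi by simp
  next
    case wrap
    then show ?thesis using phi_bounds(2)[OF h] by simp
  qed
qed

text \<open>By \<open>seg_no_phi\<close> the later segment can only start where the earlier one
  stops. The common vertex is not the root: the translate of the root lies beyond \<open>1\<close>,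
  while all values of \<open>phi\<close> are at most \<open>1\<close>.\<close>

lemma seg_overlap:
  assumes "g \<in> G" "h \<in> G" "x \<in> seg g" "x \<in> seg h" "phi g < phi h"
  shows "h = nxt g \<and> x = phi h \<and> h \<noteq> [] \<and> x = phi' (nxt g)"
proof -
  have x: "phi h \<le> x" "x \<le> phi' (nxt g)" using assms by (auto simp: seg_def)
  then have "\<not> phi h < phi' (nxt g)" using seg_no_phi[OF assms(1,2,5)] by blast
  then have eq: "phi h = phi' (nxt g)" "x = phi h" using x by auto
  have "nxt g \<noteq> []"
    using eq(1) phi_Nil(2) phi_bounds(2)[OF assms(2)] del_pos by auto
  then have "phi h = phi (nxt g)" using eq phi'_phi by simp
  then have "h = nxt g" using phi_inj[OF assms(2) nxt_G[OF assms(1)]] by simp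
  then show ?thesis using eq \<open>nxt g \<noteq> []\<close> by simp
qed

definition lam :: "nat letter list \<Rightarrow> real \<Rightarrow> real" where
  "lam g x = (x - phi g) / (phi' (nxt g) - phi g)"

lemma phi_lt: "g \<in> G \<Longrightarrow> phi g < phi' (nxt g)"
  using phi_less_nxt[of g] by linarith

lemma lam_range:
  assumes "g \<in> G"
  shows "x \<in> seg g \<Longrightarrow> 0 \<le> lam g x \<and> lam g x \<le> 1"
    "phi g < x \<Longrightarrow> 0 < lam g x" "x < phi' (nxt g) \<Longrightarrow> lam g x < 1"
    "lam g (phi g) = 0" "lam g (phi' (nxt g)) = 1"
  using phi_lt[OF assms] by (auto simp: lam_def seg_def field_simps)

lemma nxt_ne: "g \<in> G \<Longrightarrow> nxt g \<noteq> g"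
proof
  assume g: "g \<in> G" "nxt g = g"
  interpret group F by (rule group_free_group)
  have "s \<noteq> []" using length_s n_ge by auto
  moreover have "winv s \<noteq> []" using \<open>s \<noteq> []\<close> by simp
  ultimately show False
    using g l_cancel_one[of g s] l_cancel_one[of g "winv s"] s_carrier winv_s_G
    by (auto simp: nxt_def mult_free_group one_free_group split: if_splits)
qed

text \<open>What continuity at an end requires: a parameter in \<open>node u\<close> is sent into
  the open star of the set of words that begin with \<open>u\<close>.\<close>

lemma seg_node_star:
  assumes g: "g \<in> G" and u: "u \<in> G" and x: "x \<in> seg g" "x \<in> node u"
  shows "\<exists>z. u @ z \<in> G \<and> u @ z \<in> {g, nxt g} \<and> 0 < edge_point g (nxt g) (lam g x) (u @ z)"
proof -
  have e: "edge_point g (nxt g) t g = 1 - t" "edge_point g (nxt g) t (nxt g) = t" for t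
    using nxt_ne[OF g] by (auto simp: edge_point_def)
  have G: "g \<in> G" "nxt g \<in> G" using g nxt_G by auto
  from g x(1) show ?thesis
  proof (cases rule: seg_cases)
    case left
    then obtain z where "g = u @ z" using leaf_node[OF g u _ x(2)] by blast
    then show ?thesis using e(1)[of "lam g x"] lam_range(3)[OF g] left G by (intro exI[of _ z]) auto
  next
    \<comment> \<open>The point is in a gap of \<open>w\<close>. Such a gap avoids the intervals of
      longer words, so \<open>u\<close> is not longer than \<open>w\<close>, and by disjointness it
      is a prefix of \<open>w\<close>.\<close>
    case (mid w c z z')
    have "length u \<le> length w"
      using gap_not_node[OF mid(1) u mid(2,3)] x(2) by (meson not_le)
    have "\<exists>y. w = u @ y"
    proof (cases "w = []")
      case False
      then have "x \<in> node w" using mid gap_subset_node by (auto simp: gap_digit_def)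
      then have "x \<in> node (take (length u) w)"
        using node_append_subset[of "take (length u) w" "drop (length u) w"] mid(1) by auto
      then have "u = take (length u) w"
        using node_disjoint[OF u carrier_take[OF mid(1)] _ x(2)] \<open>length u \<le> length w\<close> by simp
      then show ?thesis by (metis append_take_drop_id)
    qed (use \<open>length u \<le> length w\<close> in simp)
    then obtain y where "g = u @ (y @ z)" using mid by auto
    then show ?thesis using e(1)[of "lam g x"] lam_range(3)[OF g] mid G by (intro exI[of _ "y @ z"]) auto
  next
    case right
    then obtain z where "nxt g = u @ z" using leaf_node[OF G(2) u _ x(2)] by blast
    then show ?thesis using e(2)[of "lam g x"] lam_range(2)[OF g] right G by (intro exI[of _ z]) auto
  next
    case wrap
    then show ?thesis using node_bounds[OF u] x(2) by auto
  qed
qed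

lemma leaf_covered:
  assumes h: "h \<in> G" "h \<noteq> []" and x: "x \<in> leaf h"
  shows "x \<in> seg h \<or> x \<in> seg (prv h)"
proof (cases "phi h \<le> x")
  case True
  then show ?thesis using x phi_less_nxt[OF h(1)] by (auto simp: seg_def leaf_def hi_leaf_def)
next
  case False
  have "phi (prv h) < lo_leaf' h" using phi_less_nxt[OF prv_G[OF h(1)]] nxt_prv[OF h(1)] by simp
  then show ?thesis
    using False x h phi'_phi[of h] nxt_prv[OF h(1)] by (auto simp: seg_def leaf_def lo_leaf'_def)
qed

text \<open>The line edges at the root fill the two outermost gaps, \<open>0\<close> here and
  \<open>2n\<close> in \<open>is_gap_prv_Nil\<close>. The digit is found by comparing the end of the
  slot of the root, or of its translate, with the formula for gaps.\<close>

lemma is_gap_Nil: "is_gap [] [] 0"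
proof -
  obtain w e z z' where w: "w \<in> G" "is_gap [] w e" "[] = w @ z" "nxt [] = w @ z'" using gap_of[OF carrier_Nil] .
  then have [simp]: "w = []" by simp
  have "- 1 * del = (2 * of_int e - 1) * del"
    using w(2) item_Nil_0 by (simp add: is_gap_def hi_leaf_def)
  then have "(- 1 :: real) = 2 * of_int e - 1" using del_pos by (simp only: mult_cancel_right) simp
  then have "e = 0" by simp
  then show ?thesis using w by simp
qed

lemma is_gap_prv_Nil: "is_gap (prv []) [] (2 * int n)"
proof -
  obtain w e z z' where w: "w \<in> G" "is_gap (prv []) w e" "prv [] = w @ z" "nxt (prv []) = w @ z'"
    using gap_of[OF prv_G[OF carrier_Nil]] .
  have nx: "nxt (prv []) = []" by (rule nxt_prv) simp
  then have [simp]: "w = []" using w by simp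
  have "lo_leaf' [] = 2 * of_int e * del" using w(2) nx by (simp add: is_gap_def)
  moreover have "lo_leaf' [] = (W + 1) * del"
    using item_Nil_0 per_eq wid_1 by (simp add: lo_leaf'_def distrib_right)
  ultimately have "(W + 1) * del = (2 * of_int e) * del" by simp
  then have "W + 1 = 2 * of_int e" using del_pos by (simp only: mult_cancel_right) simp
  then have "real_of_int e = real_of_int (2 * int n)" by (simp add: W_def)
  then have "e = 2 * int n" by (simp only: of_int_eq_iff)
  then show ?thesis using w by simp
qed

text \<open>The left end of an interval is either inherited from its parent or preceded by a gap,
  and the line filling that gap ends at a leaf. Together with \<open>last_leaf\<close> this puts a
  parameter outside all segments in the interior of every node containing it.\<close>

lemma first_leaf: "u \<in> G \<Longrightarrow> \<exists>h\<in>G. h \<noteq> [] \<and> lo u \<in> leaf h"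
proof (induction u rule: rev_induct)
  case Nil
  have "nxt [] \<noteq> []" using nxt_ne by simp
  moreover have "lo_leaf' (nxt []) = 0" using is_gap_Nil by (simp add: is_gap_def)
  ultimately have "item (nxt []) 0 = 0" by (simp add: lo_leaf'_def)
  then have "lo [] \<in> leaf (nxt [])" by (simp add: leaf_def)
  then show ?case using \<open>nxt [] \<noteq> []\<close> nxt_G[OF carrier_Nil] by blast
next
  case (snoc x w)
  have w: "w \<in> G" using snoc_carrierD[OF snoc.prems] by simp
  let ?e = "dig w (pos x)"
  show ?case
  proof (cases "?e = 1")
    case True
    then have "lo (w @ [x]) = lo w" using lo_snoc item_first by simp
    then show ?thesis using snoc.IH w by simp
  next
    case False
    then have e: "1 \<le> ?e - 1" "?e - 1 < 2 * int n" using dig_child[OF snoc.prems] dig_range(2)[of w "pos x"] by linarith+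
    obtain g where g: "g \<in> G" "is_gap g w (?e - 1)" using gap_exists[OF w e] .
    have lo: "lo_leaf' (nxt g) = lo (w @ [x])" using g(2) by (simp add: is_gap_def lo_snoc item_def)
    have "lo (w @ [x]) \<in> node (w @ [x])" by (simp add: node_def)
    then have "lo (w @ [x]) \<le> 1" using node_bounds[OF snoc.prems] by auto
    then have "nxt g \<noteq> []" using lo item_Nil_0 per_eq del_pos by (auto simp: lo_leaf'_def)
    then have "lo (w @ [x]) \<in> leaf (nxt g)" using lo by (simp add: leaf_def lo_leaf'_def)
    then show ?thesis using \<open>nxt g \<noteq> []\<close> nxt_G[OF g(1)] by blast
  qed
qed

lemma last_leaf: "u \<in> G \<Longrightarrow> \<exists>h\<in>G. h \<noteq> [] \<and> lo u + wid (length u) \<in> leaf h"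
proof (induction u rule: rev_induct)
  case Nil
  have G: "prv [] \<in> G" using prv_G by simp
  have ne: "prv [] \<noteq> []" using nxt_prv[of "[]"] nxt_ne[of "[]"] by auto
  have "hi_leaf (prv []) = W * del" using is_gap_prv_Nil by (simp add: is_gap_def W_def)
  then have "hi_leaf (prv []) = lo [] + wid (length [])" using wid_1 by (simp add: wid_def)
  then have hi: "hi_leaf (prv []) = lo [] + wid (length [])" .
  have "lo [] + wid (length []) \<in> leaf (prv [])"
    unfolding hi[symmetric] by (simp add: leaf_def hi_leaf_def)
  then show ?case using G ne by blast
next
  case (snoc x w)
  have w: "w \<in> G" using snoc_carrierD[OF snoc.prems] by simp
  let ?e = "dig w (pos x)"
  show ?case
  proof (cases "?e = 2 * int n")
    case True
    then have "lo (w @ [x]) + wid (length (w @ [x])) = lo w + wid (length w)" using lo_snoc item_last by simp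
    then show ?thesis using snoc.IH w by simp
  next
    case False
    then have e: "1 \<le> ?e" "?e < 2 * int n" using dig_child[OF snoc.prems] dig_range(2)[of w "pos x"] by linarith+
    obtain g where g: "g \<in> G" "is_gap g w ?e" using gap_exists[OF w e] .
    have hi: "hi_leaf g = lo (w @ [x]) + wid (length (w @ [x]))"
      using g(2) by (simp add: is_gap_def lo_snoc item_def algebra_simps)
    have "lo (w @ [x]) \<in> node (w @ [x])" by (simp add: node_def)
    then have "0 \<le> lo (w @ [x])" using node_bounds[OF snoc.prems] by auto
    then have "0 \<le> hi_leaf g" using hi by (metis add_nonneg_nonneg wid_nonneg)
    then have "g \<noteq> []" using item_Nil_0 del_pos by (auto simp: hi_leaf_def)
    moreover have "lo (w @ [x]) + wid (length (w @ [x])) \<in> leaf g"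
      unfolding hi[symmetric] by (simp add: leaf_def hi_leaf_def)
    ultimately show ?thesis using g(1) by blast
  qed
qed

section \<open>Tree rays and the parameters not covered by segments\<close>

definition tree_ray :: "(nat \<Rightarrow> nat letter list) \<Rightarrow> bool" where
  "tree_ray \<tau> \<longleftrightarrow> \<tau> 0 = [] \<and> (\<forall>k. \<tau> k \<in> G \<and> (\<exists>x. \<tau> (Suc k) = \<tau> k @ [x]))"

lemma tree_ray_length: "tree_ray \<tau> \<Longrightarrow> length (\<tau> k) = k"
proof (induction k)
  case (Suc k)
  then obtain x where "\<tau> (Suc k) = \<tau> k @ [x]" unfolding tree_ray_def by blast
  then show ?case using Suc by simp
qed (simp add: tree_ray_def)

lemma tree_ray_extend: "tree_ray \<tau> \<Longrightarrow> k \<le> i \<Longrightarrow> \<exists>z. \<tau> i = \<tau> k @ z"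
proof (induction i)
  case (Suc i)
  obtain x where x: "\<tau> (Suc i) = \<tau> i @ [x]" using Suc.prems unfolding tree_ray_def by blast
  show ?case
  proof (cases "k = Suc i")
    case False
    then obtain z where "\<tau> i = \<tau> k @ z" using Suc by auto
    then show ?thesis using x by simp
  qed simp
qed simp

text \<open>Gaps are covered by segments, and so is the slot of \<open>w\<close> itself for
  \<open>w \<noteq> []\<close>; hence an uncovered parameter in \<open>node w\<close> must lie in
  the slot of a child.\<close>

lemma descend:
  assumes w: "w \<in> G" and t: "t \<in> node w" and no: "\<And>g. g \<in> G \<Longrightarrow> t \<notin> seg g"
  shows "\<exists>x. w @ [x] \<in> G \<and> t \<in> node (w @ [x])"
proof -
  let ?d = "wid (Suc (length w))"
  define r where "r = (t - lo w) / ?d"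
  have "?d \<noteq> 0" using wid_pos[of "Suc (length w)"] by linarith
  then have tr: "t = lo w + r * ?d" by (simp add: r_def)
  have r: "0 \<le> r" "r \<le> W"
  proof -
    show "0 \<le> r" using t by (simp add: r_def node_def)
    have "t - lo w \<le> W * ?d" using t wid_Suc[of "length w"] by (simp add: node_def)
    then show "r \<le> W" by (simp add: r_def divide_le_eq)
  qed
  have slot: ?thesis if e: "1 \<le> e" "e \<le> 2 * int n" and re: "2 * (of_int e - 1) \<le> r" "r \<le> 2 * (of_int e - 1) + 1" for e
  proof -
    have "0 \<le> e" using e by simp
    then obtain i where i: "0 \<le> i" "i \<le> 2 * int n" "dig w i = e"
      by (rule index_of_dig[OF _ e(2), of w])
    have "2 * (of_int e - 1) * ?d \<le> r * ?d" "r * ?d \<le> (2 * (of_int e - 1) + 1) * ?d"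
      using re by (intro mult_right_mono; simp)+
    then have ti: "t \<in> {item w i..item w i + ?d}"
      unfolding tr item_def i(3) by (simp only: distrib_right atLeastAtMost_iff mult_1) linarith
    show ?thesis
    proof (cases "i = 0")
      case True
      then have "w \<noteq> []" using i(3) e dig_Nil[of 0] by auto
      moreover have "t \<in> leaf w" using ti True by (simp add: leaf_def)
      ultimately show ?thesis using leaf_covered[OF w] no w prv_G by blast
    next
      case False
      then obtain x where x: "fst x \<in> base" "pos x = i" using pos_surj[of i] i by auto
      have "pos x \<noteq> q w" using i x e dig_0_iff[of w i] by auto
      then have "w @ [x] \<in> G" using w x by (simp add: snoc_carrier)
      moreover have "t \<in> node (w @ [x])" using ti x by (simp add: node_snoc)
      ultimately show ?thesis by blast
    qed
  qed
  \<comment> \<open>In units of the next level, an even integer part puts the parameter into a slot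
    and an odd one puts it into the closed gap that follows.\<close>
  define N where "N = \<lfloor>r\<rfloor>"
  have N: "of_int N \<le> r" "r < of_int N + 1" by (simp_all add: N_def)
  have "real_of_int N \<le> real_of_int (4 * int n - 1)" using N r by (simp add: W_def)
  then have N0: "0 \<le> N" "N \<le> 4 * int n - 1"
    using r unfolding of_int_le_iff by (auto simp: N_def)
  show ?thesis
  proof (cases "even N")
    case True
    then obtain k where k: "N = 2 * k" by blast
    show ?thesis using slot[of "k + 1"] k N N0 by auto
  next
    case False
    then obtain k where k: "N = 2 * k + 1" by (auto elim: oddE)
    show ?thesis
    proof (cases "k + 1 < 2 * int n")
      case True
      obtain g where g: "g \<in> G" "is_gap g w (k + 1)" using gap_exists[OF w, of "k + 1"] True k N0 by auto
      have "(2 * of_int (k + 1) - 1) * ?d \<le> r * ?d" "r * ?d \<le> 2 * of_int (k + 1) * ?d"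
        using k N by (intro mult_right_mono; simp)+
      then have "hi_leaf g \<le> t" "t \<le> lo_leaf' (nxt g)" using g(2) unfolding tr is_gap_def by auto
      then have "t \<in> seg g" using phi_less_nxt[OF g(1)] by (auto simp: seg_def)
      then show ?thesis using no g(1) by blast
    next
      case False
      \<comment> \<open>The one odd value without a gap: \<open>r = W\<close> is the right end of
        the last slot.\<close>
      then have "k + 1 = 2 * int n" using k N0 by linarith
      then have "real_of_int k + 1 = 2 * real n" by (metis of_int_1 of_int_add of_int_mult of_int_numeral of_int_of_nat_eq)
      then have "r = 2 * (of_int (2 * int n) - 1) + 1" using N k r by (simp add: W_def)
      then show ?thesis using slot[of "2 * int n"] n_ge by simp
    qed
  qed
qed

lemma segs_or_ray:
  assumes t: "phi [] \<le> t" "t \<le> phi' []" and no: "\<And>g. g \<in> G \<Longrightarrow> t \<notin> seg g"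
  shows "\<exists>\<tau>. tree_ray \<tau> \<and> (\<forall>k. t \<in> node (\<tau> k))"
proof -
  \<comment> \<open>Parameters to the left of the unit interval lie on the segment leaving the root;
    likewise, those to the right lie on the segment that arrives at its translate.\<close>
  have "0 \<le> t"
  proof (rule ccontr)
    assume "\<not> 0 \<le> t"
    then have "t \<in> seg []" using t phi_bounds(4)[OF nxt_G[OF carrier_Nil]] by (simp add: seg_def)
    then show False using no by simp
  qed
  moreover have "t \<le> 1"
  proof (rule ccontr)
    assume "\<not> t \<le> 1"
    then have "t \<in> seg (prv [])"
      using t phi_bounds(2)[OF prv_G[OF carrier_Nil]] nxt_prv[OF carrier_Nil] by (simp add: seg_def)
    then show False using no prv_G[OF carrier_Nil] by blast
  qed
  ultimately have 0: "t \<in> node []" by (simp add: node_Nil)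
  have "\<exists>\<tau>. (\<tau> 0 = [] \<and> (\<tau> 0 \<in> G \<and> t \<in> node (\<tau> 0))) \<and>
      (\<forall>k. (\<tau> (Suc k) \<in> G \<and> t \<in> node (\<tau> (Suc k))) \<and> (\<exists>x. \<tau> (Suc k) = \<tau> k @ [x]))"
  proof -
    have "\<exists>f. \<forall>k. ((f k \<in> G \<and> t \<in> node (f k)) \<and> (k = 0 \<longrightarrow> f k = [])) \<and> (\<exists>x. f (Suc k) = f k @ [x])"
    proof (rule dependent_nat_choice)
      show "\<exists>x. (x \<in> G \<and> t \<in> node x) \<and> (0 = (0::nat) \<longrightarrow> x = [])" using 0 by auto
      fix w and k :: nat assume "(w \<in> G \<and> t \<in> node w) \<and> (k = 0 \<longrightarrow> w = [])"
      then show "\<exists>y. ((y \<in> G \<and> t \<in> node y) \<and> (Suc k = 0 \<longrightarrow> y = [])) \<and> (\<exists>x. y = w @ [x])"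
        using descend[of w t] no by blast
    qed
    then obtain f where "\<forall>k. ((f k \<in> G \<and> t \<in> node (f k)) \<and> (k = 0 \<longrightarrow> f k = [])) \<and> (\<exists>x. f (Suc k) = f k @ [x])" ..
    then show ?thesis by (intro exI[of _ f]) auto
  qed
  then obtain \<tau> where tau: "\<tau> 0 = []" "t \<in> node (\<tau> 0)" "\<And>k. \<tau> (Suc k) \<in> G \<and> t \<in> node (\<tau> (Suc k)) \<and> (\<exists>x. \<tau> (Suc k) = \<tau> k @ [x])"
    by blast
  have "\<tau> k \<in> G \<and> t \<in> node (\<tau> k)" for k
    using tau by (cases k) auto
  then show ?thesis using tau unfolding tree_ray_def by blast
qed

lemma wid_tendsto: "wid \<longlonglongrightarrow> 0"
proof -
  have "(\<lambda>k. (1 / W) ^ k) \<longlonglongrightarrow> 0" using W_gt by (intro LIMSEQ_power_zero) auto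
  moreover have "wid = (\<lambda>k. (1 / W) ^ k)" by (auto simp: wid_def power_one_over)
  ultimately show ?thesis by simp
qed

lemma nodes_converge:
  assumes \<tau>: "tree_ray \<tau>" "\<And>k. t \<in> node (\<tau> k)" "\<And>k. x k \<in> node (\<tau> k)"
  shows "x \<longlonglongrightarrow> t"
proof (rule Lim_null_comparison[of "\<lambda>k. x k - t" wid, THEN LIM_zero_cancel])
  have "\<bar>x k - t\<bar> \<le> wid k" for k
    using \<tau>(2,3)[of k] tree_ray_length[OF \<tau>(1), of k] by (auto simp: node_def)
  then show "\<forall>\<^sub>F k in sequentially. norm (x k - t) \<le> wid k" by simp
  show "wid \<longlonglongrightarrow> 0" by (rule wid_tendsto)
qed

lemma nodes_unique:
  assumes "tree_ray \<tau>" "\<And>k. t \<in> node (\<tau> k)" "\<And>k. t' \<in> node (\<tau> k)"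
  shows "t = t'"
  using LIMSEQ_unique[OF nodes_converge[OF assms(1), of t "\<lambda>_. t'"] tendsto_const] assms by auto

end

section \<open>The circle through the lines\<close>

lemma cayley_edges:
  assumes "group G" "S \<subseteq> carrier G"
  shows "edges (cayley_graph G S) = {{x, x \<otimes>\<^bsub>G\<^esub> t} |x t. x \<in> carrier G \<and> t \<in> S}"
proof -
  interpret group G by fact
  have "\<exists>t. y = x \<otimes>\<^bsub>G\<^esub> t \<and> t \<in> S" if "x \<in> carrier G" "y \<in> carrier G" "inv\<^bsub>G\<^esub> x \<otimes>\<^bsub>G\<^esub> y \<in> S" for x y
    using that by (intro exI[of _ "inv\<^bsub>G\<^esub> x \<otimes>\<^bsub>G\<^esub> y"]) (simp add: m_assoc[symmetric])
  moreover have "x \<otimes>\<^bsub>G\<^esub> t \<in> carrier G \<and> inv\<^bsub>G\<^esub> x \<otimes>\<^bsub>G\<^esub> (x \<otimes>\<^bsub>G\<^esub> t) \<in> S" if "x \<in> carrier G" "t \<in> S" for x t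
    using that assms(2) by (auto simp: m_assoc[symmetric] subset_iff)
  ultimately show ?thesis unfolding cayley_graph_def by (simp, blast)
qed

context surface_word
begin

section \<open>The two Cayley graphs\<close>

definition X :: "nat letter list ugraph" where
  "X = cayley_graph F (with_inverses F (gen ` base) \<union> with_inverses F {s})"

definition H :: "nat letter list ugraph" where
  "H = cayley_graph F (with_inverses F {s})"

lemma with_inverses_gen: "with_inverses F (gen ` base) = {[x] |x. fst x \<in> base}"
proof
  show "with_inverses F (gen ` base) \<subseteq> {[x] |x. fst x \<in> base}"
    by (auto simp: with_inverses_def inv_gen) (auto simp: gen_def)
  show "{[x] |x. fst x \<in> base} \<subseteq> with_inverses F (gen ` base)"
  proof clarify
    fix a :: nat and b :: bool assume a: "fst (a, b) \<in> base"
    have "gen a \<in> with_inverses F (gen ` base)" "inv\<^bsub>F\<^esub> gen a \<in> with_inverses F (gen ` base)"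
      using a unfolding with_inverses_def by auto
    moreover have "[(a, b)] = (if b then gen a else inv\<^bsub>F\<^esub> gen a)"
      using a inv_gen[of a base] by (simp add: gen_def)
    ultimately show "[(a, b)] \<in> with_inverses F (gen ` base)" by simp
  qed
qed

lemma with_inverses_s: "with_inverses F {s} = {s, winv s}"
  using inv_free_group[OF s_carrier] by (auto simp: with_inverses_def)

lemma letter_G: "fst x \<in> base \<Longrightarrow> [x] \<in> G"
  by (simp add: carrier_free_group reduced_word_def)

lemma mult_letter:
  assumes "g \<in> G" "fst x \<in> base"
  shows "foldr push g [x] = g @ [x] \<and> g @ [x] \<in> G \<or> foldr push g [x] @ [flip x] = g"
proof (cases "g @ [x] \<in> G")
  case True
  then show ?thesis using foldr_push_reduced[OF reduced_G] by blast
next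
  case False
  then have g: "g \<noteq> []" "x = flip (last g)"
    using assms letter_G[OF assms(2)] by (auto simp: carrier_append)
  define h where "h = butlast g"
  have gh: "g = h @ [flip x]" using g by (simp add: h_def)
  then have "reduced_word h" using assms(1) carrier_append[of h "[flip x]" base] reduced_G by simp
  moreover have "push (flip x) [x] = []" by (simp add: push_def)
  ultimately have "foldr push g [x] = h" using gh foldr_push_Nil by simp
  then show ?thesis using gh by simp
qed

lemma verts_X [simp]: "verts X = G" and verts_H [simp]: "verts H = G"
  by (simp_all add: X_def H_def cayley_graph_def)

lemma edges_H_mult: "edges H = {{g, foldr push g s} |g. g \<in> G}"
proof -
  have "edges H = {{x, foldr push x t} |x t. x \<in> G \<and> t \<in> {s, winv s}}"
    unfolding H_def with_inverses_s
    by (subst cayley_edges[OF group_free_group]) (use s_carrier winv_s_G in \<open>auto simp: mult_free_group\<close>)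
  moreover have "\<exists>h\<in>G. {x, foldr push x (winv s)} = {h, foldr push h s}" if "x \<in> G" for x
    using mult_s_cancel(2)[OF that] mult_G[OF that winv_s_G]
    by (intro bexI[of _ "foldr push x (winv s)"]) (auto simp: insert_commute)
  ultimately show ?thesis by fastforce
qed

text \<open>Replacing \<open>s\<close> by \<open>nxt\<close> only reverses the sense in which lines
  of orientation \<open>-1\<close> are run through; the unordered pairs stay the same.\<close>

lemma edges_H: "edges H = {{g, nxt g} |g. g \<in> G}"
proof -
  have "\<exists>h\<in>G. {g, foldr push g s} = {h, nxt h}" if g: "g \<in> G" for g
  proof (cases "eps ^ length g = 1")
    case True
    then show ?thesis using g by (intro bexI[of _ g]) (simp_all add: nxt_def)
  next
    case False
    then have "prv g = foldr push g s" by (simp add: prv_def)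
    then show ?thesis using nxt_prv[OF g] prv_G[OF g] by (intro bexI[of _ "prv g"]) auto
  qed
  moreover have "\<exists>h\<in>G. {g, nxt g} = {h, foldr push h s}" if g: "g \<in> G" for g
  proof (cases "eps ^ length g = 1")
    case True
    then show ?thesis using g by (intro bexI[of _ g]) (simp_all add: nxt_def)
  next
    case False
    then have "nxt g = foldr push g (winv s)" by (simp add: nxt_def)
    then show ?thesis using mult_s_cancel(2)[OF g] nxt_G[OF g] by (intro bexI[of _ "nxt g"]) auto
  qed
  ultimately show ?thesis unfolding edges_H_mult by blast
qed

lemma edges_X: "edges X = edges H \<union> {{w, w @ [x]} |w x. w @ [x] \<in> G}"
proof -
  have "edges X = {{g, foldr push g t} |g t. g \<in> G \<and> t \<in> {[x] |x. fst x \<in> base} \<union> {s, winv s}}"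
    unfolding X_def with_inverses_s with_inverses_gen
    by (subst cayley_edges[OF group_free_group])
      (use s_carrier winv_s_G letter_G in \<open>auto simp: mult_free_group\<close>)
  moreover have "edges H = {{g, foldr push g t} |g t. g \<in> G \<and> t \<in> {s, winv s}}"
    unfolding H_def with_inverses_s
    by (subst cayley_edges[OF group_free_group]) (use s_carrier winv_s_G in \<open>auto simp: mult_free_group\<close>)
  moreover have "{{g, foldr push g t} |g t. g \<in> G \<and> t \<in> {[x] |x. fst x \<in> base} \<union> {s, winv s}} =
      {{g, foldr push g t} |g t. g \<in> G \<and> t \<in> {s, winv s}} \<union> {{g, foldr push g [x]} |g x. g \<in> G \<and> fst x \<in> base}"
    by blast
  ultimately have "edges X = edges H \<union> {{g, foldr push g [x]} |g x. g \<in> G \<and> fst x \<in> base}" by simp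
  moreover have "{{g, foldr push g [x]} |g x. g \<in> G \<and> fst x \<in> base} = {{w, w @ [x]} |w x. w @ [x] \<in> G}"
    (is "?L = ?R")
  proof
    show "?L \<subseteq> ?R"
    proof
      fix e assume "e \<in> ?L"
      then obtain g x where g: "g \<in> G" "fst x \<in> base" and e: "e = {g, foldr push g [x]}" by blast
      from mult_letter[OF g] have "\<exists>w y. {g, foldr push g [x]} = {w, w @ [y]} \<and> w @ [y] \<in> G"
      proof
        assume "foldr push g [x] = g @ [x] \<and> g @ [x] \<in> G"
        then show ?thesis by metis
      next
        assume a: "foldr push g [x] @ [flip x] = g"
        have "{g, foldr push g [x]} = {foldr push g [x], foldr push g [x] @ [flip x]}"
          unfolding a by (rule insert_commute)
        moreover have "foldr push g [x] @ [flip x] \<in> G" using a g(1) by simp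
        ultimately show ?thesis by blast
      qed
      then show "e \<in> ?R" using e by blast
    qed
    show "?R \<subseteq> ?L"
    proof
      fix e assume "e \<in> ?R"
      then obtain w x where wx: "w @ [x] \<in> G" and e: "e = {w, w @ [x]}" by blast
      then have "foldr push w [x] = w @ [x]" using foldr_push_reduced[OF reduced_G] by blast
      then have "e = {w, foldr push w [x]}" using e by simp
      then show "e \<in> ?L" using snoc_carrierD(1,2)[OF wx] by blast
    qed
  qed
  ultimately show ?thesis by simp
qed

lemma tree_edge: "w @ [x] \<in> G \<Longrightarrow> {w, w @ [x]} \<in> edges X"
  unfolding edges_X by blast

lemma H_edge: "g \<in> G \<Longrightarrow> {g, nxt g} \<in> edges X"
  unfolding edges_X edges_H by blast

lemma edge_X_cases:
  assumes "{u, v} \<in> edges X"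
  obtains g where "g \<in> G" "{u, v} = {g, nxt g}" | w x where "w @ [x] \<in> G" "{u, v} = {w, w @ [x]}"
  using assms unfolding edges_X edges_H by blast

sublocale cay: lf_graph X
proof
  fix e assume "e \<in> edges X"
  then consider g where "g \<in> G" "e = {g, nxt g}" | w x where "w @ [x] \<in> G" "e = {w, w @ [x]}"
    unfolding edges_X edges_H by blast
  then show "\<exists>u\<in>verts X. \<exists>v\<in>verts X. u \<noteq> v \<and> e = {u, v}"
  proof cases
    case 1
    show ?thesis
    proof (intro bexI conjI)
      show "nxt g \<noteq> g" by (rule nxt_ne[OF 1(1)])
      show "e = {nxt g, g}" using 1(2) by (simp add: insert_commute)
    qed (use 1(1) nxt_G[OF 1(1)] in simp_all)
  next
    case 2
    show ?thesis
    proof (intro bexI conjI)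
      show "w \<noteq> w @ [x]" by simp
      show "w \<in> verts X" "w @ [x] \<in> verts X" using 2(1) snoc_carrierD[OF 2(1)] by simp_all
    qed fact
  qed
next
  fix v assume v: "v \<in> verts X"
  have "{w. {v, w} \<in> edges X} \<subseteq> {nxt v, prv v, butlast v} \<union> (\<lambda>x. v @ [x]) ` (base \<times> UNIV)"
  proof
    fix w assume "w \<in> {w. {v, w} \<in> edges X}"
    then have "{v, w} \<in> edges X" by simp
    then show "w \<in> {nxt v, prv v, butlast v} \<union> (\<lambda>x. v @ [x]) ` (base \<times> UNIV)"
    proof (cases rule: edge_X_cases)
      case (1 g)
      then consider "v = g" "w = nxt g" | "w = g" "v = nxt g" by (auto simp: doubleton_eq_iff)
      then show ?thesis using prv_nxt[OF 1(1)] by cases auto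
    next
      case (2 u x)
      then consider "v = u" "w = u @ [x]" | "w = u" "v = u @ [x]" by (auto simp: doubleton_eq_iff)
      then show ?thesis
      proof cases
        case 1
        have "x \<in> base \<times> UNIV" using snoc_carrierD(2)[OF 2(1)] by (cases x) auto
        then show ?thesis using 1 by blast
      qed simp
    qed
  qed
  moreover have "finite ({nxt v, prv v, butlast v} \<union> (\<lambda>x. v @ [x]) ` (base \<times> UNIV))" by (simp add: base_def)
  ultimately show "finite {w. {v, w} \<in> edges X}" by (rule finite_subset)
qed

section \<open>Tree rays as ends of the Cayley graph\<close>

lemma tree_rayD:
  assumes "tree_ray \<tau>"
  shows "\<tau> k \<in> G" "ray X \<tau>"
proof -
  show *: "\<tau> k \<in> G" for k using assms by (simp add: tree_ray_def)
  have "inj \<tau>" using tree_ray_length[OF assms] by (metis injI)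
  moreover have "{\<tau> i, \<tau> (Suc i)} \<in> edges X" for i
  proof -
    obtain x where "\<tau> (Suc i) = \<tau> i @ [x]" using assms unfolding tree_ray_def by blast
    then show ?thesis using tree_edge *[of "Suc i"] by simp
  qed
  ultimately show "ray X \<tau>" using * by (simp add: ray_def)
qed

definition tree_end :: "(nat \<Rightarrow> nat letter list) \<Rightarrow> (nat \<Rightarrow> nat letter list) set" where
  "tree_end \<tau> = ray_equiv X `` {\<tau>}"

lemma tree_end: "tree_ray \<tau> \<Longrightarrow> tree_end \<tau> \<in> ends X \<and> \<tau> \<in> tree_end \<tau>"
  using tree_rayD(2) equiv_class_self[OF equiv_ray_equiv, of \<tau> X]
  by (auto simp: tree_end_def ends_def intro: quotientI)

text \<open>A tree edge changes the last letter only, and a line edge replaces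
  \<open>winv (take j s)\<close> by \<open>drop j s\<close> after a common prefix, so at most
  \<open>2n\<close> letters at the end are affected.\<close>

lemma edge_take:
  assumes "{u, v} \<in> edges X" "k + 2 * n < length u" "k + 2 * n < length v"
  shows "take k u = take k v"
proof -
  consider g where "g \<in> G" "{u, v} = {g, foldr push g s}" | w x where "{u, v} = {w, w @ [x]}"
    using assms(1) unfolding edges_X edges_H_mult by blast
  then show ?thesis
  proof cases
    case (1 g)
    obtain w j where w: "corner_at w j" "g = w @ winv (take j s)" "foldr push g s = w @ drop j s"
      using corner_exists[OF 1(1)] .
    have "k + 2 * n < length g" using 1(2) assms(2,3) by (auto simp: doubleton_eq_iff)
    then have "k \<le> length w" using w(1,2) length_s by (auto simp: corner_at_def)
    then have "take k g = take k w" "take k (foldr push g s) = take k w" unfolding w(2) w(3)[unfolded w(2)] by simp_all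
    then show ?thesis using 1(2) by (auto simp: doubleton_eq_iff)
  next
    case (2 w x)
    then have "length w \<ge> k" using assms(2,3) by (auto simp: doubleton_eq_iff)
    then show ?thesis using 2 by (auto simp: doubleton_eq_iff)
  qed
qed

lemma finite_ball: "finite {u \<in> G. length u \<le> k}"
proof (rule finite_subset)
  show "{u \<in> G. length u \<le> k} \<subseteq> {u. set u \<subseteq> base \<times> UNIV \<and> length u \<le> k}"
    by (auto simp: carrier_free_group subset_iff mem_Times_iff image_subset_iff)
  show "finite {u. set u \<subseteq> base \<times> (UNIV :: bool set) \<and> length u \<le> k}"
    by (rule finite_lists_length_le) (simp add: base_def)
qed

lemma tree_ray_take: "tree_ray \<tau> \<Longrightarrow> k \<le> i \<Longrightarrow> take k (\<tau> i) = \<tau> k"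
  using tree_ray_extend[of \<tau> k i] tree_ray_length[of \<tau> k] by auto

text \<open>Outside the ball of radius \<open>k + 2n\<close> the first \<open>k\<close> letters are
  constant on components, by \<open>edge_take\<close>. Hence tree rays that differ at level
  \<open>k\<close> remain separated by a finite set even with the lines added.\<close>

lemma tree_end_inj:
  assumes \<tau>: "tree_ray \<tau>" and \<sigma>: "tree_ray \<sigma>" and eq: "tree_end \<tau> = tree_end \<sigma>"
  shows "\<tau> = \<sigma>"
proof
  fix k
  define S where "S = {u \<in> G. length u \<le> k + 2 * n}"
  have "(\<tau>, \<sigma>) \<in> ray_equiv X"
    using eq tree_end[OF \<sigma>] by (auto simp: tree_end_def)
  moreover have "finite S" "S \<subseteq> verts X" using finite_ball by (auto simp: S_def)
  ultimately obtain C where C: "C \<in> graph_components (del_verts X S)" "has_tail_in \<tau> C" "has_tail_in \<sigma> C"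
    unfolding ray_equiv_def by blast
  obtain y where y: "y \<in> G - S" "C = graph_component (del_verts X S) y"
    using C(1) by (auto simp: graph_components_def)
  have const: "take k x = take k y \<and> x \<in> G - S" if "x \<in> C" for x
  proof (rule graph_component_induct[of x "del_verts X S" y])
    fix u v assume "take k u = take k y \<and> u \<in> G - S" "{u, v} \<in> edges (del_verts X S)"
    then show "take k v = take k y \<and> v \<in> G - S"
      using edge_take[of u v k] cay.edgeD[of u v] by (auto simp: edges_del_verts S_def)
  qed (use that y in auto)
  obtain N N' where N: "\<And>i. i \<ge> N \<Longrightarrow> \<tau> i \<in> C" "\<And>i. i \<ge> N' \<Longrightarrow> \<sigma> i \<in> C"
    using C(2,3) by (auto simp: has_tail_in_def)
  have "\<tau> k = take k (\<tau> (N + k))" "\<sigma> k = take k (\<sigma> (N' + k))" using tree_ray_take \<tau> \<sigma> by simp_all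
  moreover have "\<tau> (N + k) \<in> C" "\<sigma> (N' + k) \<in> C" using N by simp_all
  ultimately show "\<tau> k = \<sigma> k" using const by metis
qed

text \<open>Below a vertex that is deeper than all of \<open>S\<close>, the whole subtree is
  connected by tree edges avoiding \<open>S\<close>, so it stays in the component containing the
  tail of the ray.\<close>

lemma tree_end_nbhd:
  assumes \<tau>: "tree_ray \<tau>" and S: "finite S" "S \<subseteq> G" and C: "C \<in> graph_components (del_verts X S)"
    and mem: "End (tree_end \<tau>) \<in> end_nbhd X C"
  shows "\<exists>k. \<forall>z. \<tau> k @ z \<in> G \<longrightarrow> \<tau> k @ z \<in> C"
proof -
  obtain r where r: "r \<in> tree_end \<tau>" "has_tail_in r C" using mem by (auto simp: end_nbhd_def)
  have "(\<tau>, r) \<in> ray_equiv X" using r(1) by (simp add: tree_end_def)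
  then obtain D where D: "D \<in> graph_components (del_verts X S)" "has_tail_in \<tau> D" "has_tail_in r D"
    using S unfolding ray_equiv_def by auto
  have "D = C" by (rule has_tail_in_unique[OF D(1) C D(3) r(2)])
  then obtain N where N: "\<And>i. i \<ge> N \<Longrightarrow> \<tau> i \<in> C" using D by (auto simp: has_tail_in_def)
  obtain m where m: "\<And>u. u \<in> S \<Longrightarrow> length u < m"
    using finite_nat_set_iff_bounded[of "length ` S"] S(1) by auto
  define k where "k = max N m"
  have "\<tau> k @ z \<in> C" if "\<tau> k @ z \<in> G" for z
    using that
  proof (induction z rule: rev_induct)
    case Nil
    then show ?case using N by (simp add: k_def)
  next
    case (snoc x z)
    then have G: "(\<tau> k @ z) @ [x] \<in> G" by simp
    then have "\<tau> k @ z \<in> C" using snoc.IH snoc_carrierD(1) by blast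
    moreover have "u \<notin> S" if "length u \<ge> k" for u using m[of u] that by (auto simp: k_def)
    then have "{\<tau> k @ z, (\<tau> k @ z) @ [x]} \<in> edges (del_verts X S)"
      using tree_edge[OF G] tree_ray_length[OF \<tau>, of k] by (simp add: edges_del_verts)
    ultimately show ?case using graph_components_closed[OF C] by simp
  qed
  then show ?thesis by blast
qed

section \<open>The parametrisation of the circle\<close>

abbreviation D :: "real set" where "D \<equiv> {phi []..phi' []}"

text \<open>The choice of \<open>g\<close> does not matter: two segments share at most the parameter
  of a common vertex, where both formulas give this vertex. A parameter on no segment determines its
  tree ray, because nodes of equal level are disjoint.\<close>

definition Psi :: "real \<Rightarrow> nat letter list fpoint" where
  "Psi t = (if \<exists>g\<in>G. t \<in> seg g
     then let g = SOME g. g \<in> G \<and> t \<in> seg g in Pt (edge_point g (nxt g) (lam g t))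
     else End (tree_end (SOME \<tau>. tree_ray \<tau> \<and> (\<forall>k. t \<in> node (\<tau> k)))))"

lemma edge_point_overlap:
  assumes "g \<in> G" "h \<in> G" "t \<in> seg g" "t \<in> seg h"
  shows "edge_point g (nxt g) (lam g t) = edge_point h (nxt h) (lam h t)"
proof -
  have *: "edge_point g (nxt g) (lam g t) = edge_point h (nxt h) (lam h t)"
    if "g \<in> G" "h \<in> G" "t \<in> seg g" "t \<in> seg h" "phi g < phi h" for g h
  proof -
    have o: "h = nxt g" "t = phi h" "t = phi' (nxt g)" using seg_overlap[OF that] by auto
    have "lam g t = 1" unfolding o(3) using lam_range(5)[OF that(1)] .
    moreover have "lam h t = 0" unfolding o(2) using lam_range(4)[OF that(2)] .
    ultimately show ?thesis using edge_point_1[of g h] vertex_point_eq_edge_point[of h "nxt h"] o(1) by simp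
  qed
  consider "phi g < phi h" | "phi h < phi g" | "g = h" using phi_inj assms(1,2) by fastforce
  then show ?thesis
  proof cases
    case 1
    then show ?thesis using *[OF assms] by blast
  next
    case 2
    then show ?thesis using *[OF assms(2,1,4,3)] by simp
  qed simp
qed

lemma Psi_seg:
  assumes "g \<in> G" "t \<in> seg g"
  shows "Psi t = Pt (edge_point g (nxt g) (lam g t))"
proof -
  define h where "h = (SOME g. g \<in> G \<and> t \<in> seg g)"
  have "h \<in> G \<and> t \<in> seg h" unfolding h_def by (rule someI[of _ g]) (use assms in blast)
  then show ?thesis
    using edge_point_overlap[of g h t] assms unfolding Psi_def h_def[symmetric] by auto
qed

lemma Psi_ray:
  assumes "t \<in> D" "\<not> (\<exists>g\<in>G. t \<in> seg g)"
  obtains \<tau> where "tree_ray \<tau>" "\<And>k. t \<in> node (\<tau> k)" "Psi t = End (tree_end \<tau>)"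
proof -
  define \<tau> where "\<tau> = (SOME \<tau>. tree_ray \<tau> \<and> (\<forall>k. t \<in> node (\<tau> k)))"
  have "\<exists>\<tau>. tree_ray \<tau> \<and> (\<forall>k. t \<in> node (\<tau> k))"
    using segs_or_ray[of t] assms by auto
  from someI_ex[OF this] have "tree_ray \<tau>" "\<And>k. t \<in> node (\<tau> k)" unfolding \<tau>_def by blast+
  moreover have "Psi t = End (tree_end \<tau>)" unfolding Psi_def \<tau>_def if_not_P[OF assms(2)] ..
  ultimately show ?thesis using that by blast
qed

lemma Psi_Pt:
  assumes "t \<in> D" "Psi t = Pt p"
  shows "\<exists>g\<in>G. t \<in> seg g"
proof (rule ccontr)
  assume "\<not> ?thesis"
  then obtain \<tau> where "Psi t = End (tree_end \<tau>)" using Psi_ray[OF assms(1)] by blast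
  then show False using assms(2) by simp
qed

text \<open>A parameter at the right end of its segment is also the start of the next one; so,
  except at the end of \<open>D\<close>, there is a segment continuing to the right. Continuity and
  injectivity both rely on this.\<close>

lemma right_seg:
  assumes g: "g \<in> G" "t \<in> seg g" and t: "t < phi' []"
  obtains h where "h \<in> G" "t \<in> seg h" "t < phi' (nxt h)"
proof (cases "t < phi' (nxt g)")
  case False
  then have eq: "t = phi' (nxt g)" using g by (simp add: seg_def)
  then have "nxt g \<noteq> []" using t by auto
  then have "t = phi (nxt g)" using eq phi'_phi by simp
  then show ?thesis using that[of "nxt g"] phi_lt[OF nxt_G[OF g(1)]] nxt_G[OF g(1)] by (simp add: seg_def)
qed (use that g in blast)

lemma left_seg:
  assumes g: "g \<in> G" "t \<in> seg g" and t: "phi [] < t"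
  obtains h where "h \<in> G" "t \<in> seg h" "phi h < t"
proof (cases "phi g < t")
  case False
  then have eq: "t = phi g" using g by (simp add: seg_def)
  then have "g \<noteq> []" using t by auto
  then have "t = phi' (nxt (prv g))" using eq phi'_phi nxt_prv[OF g(1)] by simp
  then show ?thesis using that[of "prv g"] phi_lt[OF prv_G[OF g(1)]] prv_G[OF g(1)] by (simp add: seg_def)
qed (use that g in blast)

lemma continuous_Psi_seg:
  assumes g: "g \<in> G"
  shows "continuous_map (top_of_set (seg g)) (freudenthal X) Psi"
proof (rule continuous_map_eq)
  have "continuous_map (top_of_set (seg g)) (top_of_set {0..1}) (lam g)"
    using lam_range(1)[OF g] by (auto simp: lam_def[abs_def] intro!: continuous_intros) (use phi_lt[OF g] in auto)
  from continuous_map_compose[OF this cay.continuous_map_edge_point[OF H_edge[OF g]]]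
  show "continuous_map (top_of_set (seg g)) (freudenthal X) ((\<lambda>t. Pt (edge_point g (nxt g) t)) \<circ> lam g)" .
qed (use Psi_seg[OF g] in simp)

lemma Psi_local_seg:
  assumes Q: "openin (freudenthal X) Q" and g: "g \<in> G" "t \<in> seg g" and mem: "Psi t \<in> Q"
  obtains V where "open V" "t \<in> V" "\<And>u. u \<in> V \<Longrightarrow> u \<in> seg g \<Longrightarrow> Psi u \<in> Q"
proof -
  have "openin (top_of_set (seg g)) {u \<in> seg g. Psi u \<in> Q}"
    using openin_continuous_map_preimage[OF continuous_Psi_seg[OF g(1)] Q] by simp
  then obtain V where V: "open V" "{u \<in> seg g. Psi u \<in> Q} = seg g \<inter> V" by (auto simp: openin_open)
  show ?thesis
  proof (rule that[OF V(1)])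
    show "t \<in> V" using V(2) g mem by blast
    show "Psi u \<in> Q" if "u \<in> V" "u \<in> seg g" for u using V(2) that by blast
  qed
qed

text \<open>As \<open>t\<close> may be a common end of two segments, neighbourhoods are found
  separately to the right and to the left of \<open>t\<close> and then intersected.\<close>

lemma Psi_local:
  assumes Q: "openin (freudenthal X) Q" and g: "g \<in> G" "t \<in> seg g" and t: "t \<in> D" and mem: "Psi t \<in> Q"
  obtains V where "open V" "t \<in> V" "\<And>u. u \<in> V \<Longrightarrow> u \<in> D \<Longrightarrow> Psi u \<in> Q"
proof -
  have "\<exists>V. open V \<and> t \<in> V \<and> (\<forall>u\<in>V. u \<in> D \<longrightarrow> t \<le> u \<longrightarrow> Psi u \<in> Q)"
  proof (cases "t < phi' []")
    case True
    obtain h where h: "h \<in> G" "t \<in> seg h" "t < phi' (nxt h)" using right_seg[OF g True] .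
    obtain V where V: "open V" "t \<in> V" "\<And>u. u \<in> V \<Longrightarrow> u \<in> seg h \<Longrightarrow> Psi u \<in> Q"
      using Psi_local_seg[OF Q h(1,2) mem] by blast
    show ?thesis
      by (rule exI[of _ "V \<inter> {..<phi' (nxt h)}"]) (use V h in \<open>auto simp: seg_def\<close>)
  next
    case False
    then have "u = t" if "u \<in> D" "t \<le> u" for u using that t by auto
    then show ?thesis using mem by (intro exI[of _ UNIV]) auto
  qed
  then obtain V where V: "open V" "t \<in> V" "\<And>u. u \<in> V \<Longrightarrow> u \<in> D \<Longrightarrow> t \<le> u \<Longrightarrow> Psi u \<in> Q" by blast
  have "\<exists>V. open V \<and> t \<in> V \<and> (\<forall>u\<in>V. u \<in> D \<longrightarrow> u \<le> t \<longrightarrow> Psi u \<in> Q)"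
  proof (cases "phi [] < t")
    case True
    obtain h where h: "h \<in> G" "t \<in> seg h" "phi h < t" using left_seg[OF g True] .
    obtain V where V: "open V" "t \<in> V" "\<And>u. u \<in> V \<Longrightarrow> u \<in> seg h \<Longrightarrow> Psi u \<in> Q"
      using Psi_local_seg[OF Q h(1,2) mem] by blast
    show ?thesis
      by (rule exI[of _ "V \<inter> {phi h<..}"]) (use V h in \<open>auto simp: seg_def\<close>)
  next
    case False
    then have "u = t" if "u \<in> D" "u \<le> t" for u using that t by auto
    then show ?thesis using mem by (intro exI[of _ UNIV]) auto
  qed
  then obtain V' where V': "open V'" "t \<in> V'" "\<And>u. u \<in> V' \<Longrightarrow> u \<in> D \<Longrightarrow> u \<le> t \<Longrightarrow> Psi u \<in> Q" by blast
  show ?thesis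
  proof (rule that[of "V \<inter> V'"])
    show "Psi u \<in> Q" if "u \<in> V \<inter> V'" "u \<in> D" for u
      using V(3)[of u] V'(3)[of u] that by (cases "t \<le> u") auto
  qed (use V V' in auto)
qed

text \<open>Both end points of a node lie on leaves of nonempty words, hence on segments. So the
  open interval of a node is a neighbourhood of every uncovered parameter in it.\<close>

lemma node_interior:
  assumes u: "u \<in> G" and t: "t \<in> node u" "\<And>g. g \<in> G \<Longrightarrow> t \<notin> seg g"
  shows "lo u < t" "t < lo u + wid (length u)"
proof -
  have no: "t \<notin> leaf h" if "h \<in> G" "h \<noteq> []" for h
    using leaf_covered[OF that] t(2) that prv_G by blast
  have "t \<noteq> lo u" using first_leaf[OF u] no by blast
  then show "lo u < t" using t(1) by (simp add: node_def)
  have "t \<noteq> lo u + wid (length u)" using last_leaf[OF u] no by blast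
  then show "t < lo u + wid (length u)" using t(1) by (simp add: node_def)
qed

text \<open>For a parameter on a segment this is \<open>seg_node_star\<close>; for an uncovered one,
  the tree ray passes through \<open>u\<close> and then stays among the continuations of
  \<open>u\<close>.\<close>

lemma Psi_node_nbhd:
  assumes u: "u \<in> G" and cone: "\<And>z. u @ z \<in> G \<Longrightarrow> u @ z \<in> C" and t: "t \<in> node u" "t \<in> D"
  shows "Psi t \<in> end_nbhd X C"
proof (cases "\<exists>g\<in>G. t \<in> seg g")
  case True
  then obtain g where g: "g \<in> G" "t \<in> seg g" by blast
  obtain z where z: "u @ z \<in> G" "0 < edge_point g (nxt g) (lam g t) (u @ z)"
    using seg_node_star[OF g(1) u g(2) t(1)] by blast
  have "edge_point g (nxt g) (lam g t) \<in> complex_points X"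
    using cay.edge_point_in_complex[OF H_edge[OF g(1)]] lam_range(1)[OF g] by blast
  then show ?thesis using z cone[OF z(1)] Psi_seg[OF g] unfolding end_nbhd_def by auto
next
  case False
  then obtain \<sigma> where \<sigma>: "tree_ray \<sigma>" "\<And>k. t \<in> node (\<sigma> k)" "Psi t = End (tree_end \<sigma>)"
    using Psi_ray[OF t(2)] by blast
  have su: "\<sigma> (length u) = u"
    using node_disjoint[OF tree_rayD(1)[OF \<sigma>(1)] u _ \<sigma>(2) t(1)] tree_ray_length[OF \<sigma>(1)] by simp
  have "\<sigma> i \<in> C" if i: "length u \<le> i" for i
  proof -
    obtain z where z: "\<sigma> i = u @ z" using tree_ray_extend[OF \<sigma>(1) i] su by auto
    then show ?thesis using cone tree_rayD(1)[OF \<sigma>(1), of i] by simp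
  qed
  then have "has_tail_in \<sigma> C" by (auto simp: has_tail_in_def)
  then show ?thesis using \<sigma>(3) tree_end[OF \<sigma>(1)] unfolding end_nbhd_def by auto
qed

lemma Psi_topspace: "t \<in> D \<Longrightarrow> Psi t \<in> topspace (freudenthal X)"
proof (cases "\<exists>g\<in>G. t \<in> seg g")
  case True
  then obtain g where g: "g \<in> G" "t \<in> seg g" by blast
  have "edge_point g (nxt g) (lam g t) \<in> complex_points X"
    using cay.edge_point_in_complex[OF H_edge[OF g(1)]] lam_range(1)[OF g] by blast
  then show ?thesis using Psi_seg[OF g] by (simp add: topspace_freudenthal)
next
  case False
  assume "t \<in> D"
  then obtain \<tau> where "tree_ray \<tau>" "Psi t = End (tree_end \<tau>)" using Psi_ray[of t] False by blast
  then show ?thesis using tree_end by (simp add: topspace_freudenthal)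
qed

theorem continuous_Psi: "continuous_map (top_of_set D) (freudenthal X) Psi"
proof (rule continuous_map_into_freudenthal)
  show "Psi \<in> topspace (top_of_set D) \<rightarrow> topspace (freudenthal X)" using Psi_topspace by simp
next
  fix U assume "complex_open X U"
  then have Q: "openin (freudenthal X) (Pt ` U)" by (rule openin_Pt)
  show "openin (top_of_set D) {t \<in> topspace (top_of_set D). Psi t \<in> Pt ` U}"
  proof (subst openin_subopen, intro ballI)
    fix t assume "t \<in> {t \<in> topspace (top_of_set D). Psi t \<in> Pt ` U}"
    then have t: "t \<in> D" "Psi t \<in> Pt ` U" by auto
    then obtain g where g: "g \<in> G" "t \<in> seg g" using Psi_Pt[OF t(1)] by blast
    obtain V where V: "open V" "t \<in> V" "\<And>u. u \<in> V \<Longrightarrow> u \<in> D \<Longrightarrow> Psi u \<in> Pt ` U"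
      using Psi_local[OF Q g t] by blast
    show "\<exists>T. openin (top_of_set D) T \<and> t \<in> T \<and> T \<subseteq> {t \<in> topspace (top_of_set D). Psi t \<in> Pt ` U}"
      by (rule exI[of _ "D \<inter> V"]) (use V t in \<open>auto intro: openin_open_Int\<close>)
  qed
next
  fix S C assume S: "finite S" "S \<subseteq> verts X" and C: "C \<in> graph_components (del_verts X S)"
  have Q: "openin (freudenthal X) (end_nbhd X C)" using openin_end_nbhd[OF S C] .
  show "openin (top_of_set D) {t \<in> topspace (top_of_set D). Psi t \<in> end_nbhd X C}"
  proof (subst openin_subopen, intro ballI)
    fix t assume "t \<in> {t \<in> topspace (top_of_set D). Psi t \<in> end_nbhd X C}"
    then have t: "t \<in> D" "Psi t \<in> end_nbhd X C" by auto
    have "\<exists>V. open V \<and> t \<in> V \<and> (\<forall>u\<in>V. u \<in> D \<longrightarrow> Psi u \<in> end_nbhd X C)"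
    proof (cases "\<exists>g\<in>G. t \<in> seg g")
      case True
      then obtain g where g: "g \<in> G" "t \<in> seg g" by blast
      show ?thesis by (rule Psi_local[OF Q g t]) blast
    next
      \<comment> \<open>At an end, some node on its ray has its whole subtree in \<open>C\<close>,
        and the interior of the interval of this node is the required neighbourhood.\<close>
      case False
      then obtain \<tau> where \<tau>: "tree_ray \<tau>" "\<And>k. t \<in> node (\<tau> k)" "Psi t = End (tree_end \<tau>)"
        using Psi_ray[OF t(1)] by blast
      obtain k where k: "\<And>z. \<tau> k @ z \<in> G \<Longrightarrow> \<tau> k @ z \<in> C"
        using tree_end_nbhd[OF \<tau>(1) S(1) _ C] S(2) t(2) \<tau>(3) by auto
      have u: "\<tau> k \<in> G" by (rule tree_rayD(1)[OF \<tau>(1)])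
      show ?thesis
      proof (rule exI[of _ "{lo (\<tau> k)<..<lo (\<tau> k) + wid (length (\<tau> k))}"], intro conjI ballI impI)
        show "t \<in> {lo (\<tau> k)<..<lo (\<tau> k) + wid (length (\<tau> k))}"
          using node_interior[OF u \<tau>(2)] False by auto
        fix x assume "x \<in> {lo (\<tau> k)<..<lo (\<tau> k) + wid (length (\<tau> k))}" "x \<in> D"
        then show "Psi x \<in> end_nbhd X C" by (intro Psi_node_nbhd[OF u k]) (auto simp: node_def)
      qed simp
    qed
    then obtain V where V: "open V" "t \<in> V" "\<And>u. u \<in> V \<Longrightarrow> u \<in> D \<Longrightarrow> Psi u \<in> end_nbhd X C" by blast
    show "\<exists>T. openin (top_of_set D) T \<and> t \<in> T \<and> T \<subseteq> {t \<in> topspace (top_of_set D). Psi t \<in> end_nbhd X C}"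
      by (rule exI[of _ "D \<inter> V"]) (use V t in \<open>auto intro: openin_open_Int\<close>)
  qed
qed

lemma phi_mem_seg: "g \<in> G \<Longrightarrow> phi g \<in> seg g" "g \<in> G \<Longrightarrow> phi' (nxt g) \<in> seg g"
  using phi_lt[of g] by (simp_all add: seg_def less_imp_le)

lemma Psi_phi: "g \<in> G \<Longrightarrow> Psi (phi g) = Pt (vertex_point g)"
  using Psi_seg[of g "phi g"] phi_mem_seg(1)[of g] lam_range(4)[of g] vertex_point_eq_edge_point[of g "nxt g"] by simp

lemma seg_subset_D: "g \<in> G \<Longrightarrow> seg g \<subseteq> D"
  using phi_bounds(1)[of g] phi_bounds(3)[OF nxt_G, of g] by (auto simp: seg_def)

lemma Psi_closed: "Psi (phi []) = Psi (phi' [])"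
proof -
  note p = prv_G[OF carrier_Nil]
  have "Psi (phi' (nxt (prv []))) = Pt (edge_point (prv []) (nxt (prv [])) 1)"
    using Psi_seg[OF p phi_mem_seg(2)[OF p]] lam_range(5)[OF p] by simp
  then show ?thesis using Psi_phi[OF carrier_Nil] unfolding nxt_prv[OF carrier_Nil] by (simp add: edge_point_1)
qed

text \<open>Parameters increase strictly along \<open>nxt\<close> except at the return to the root,
  so a cycle of length two would contain the root and its two segments would fill \<open>D\<close>;
  but the parameter of a third vertex lies strictly inside \<open>D\<close>. As a consequence, an
  edge \<open>{g, nxt g}\<close> determines \<open>g\<close>.\<close>

lemma nxt_nxt_ne:
  assumes "g \<in> G" 
  shows "nxt (nxt g) \<noteq> g"
proof
  assume eq2: "nxt (nxt g) = g"
  have key: False if h: "h \<in> G" "h \<noteq> []" and n: "nxt [] = h" "nxt h = []" for h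
  proof -
    have b: "1 \<in> base" "2 \<in> base" using n_ge by (auto simp: base_def)
    obtain k where k: "k \<in> G" "k \<noteq> []" "k \<noteq> h"
    proof (cases "h = [(1, True)]")
      case True
      then show ?thesis using that[of "[(2, True)]"] letter_G[of "(2, True)"] b by simp
    next
      case False
      then show ?thesis using that[of "[(1, True)]"] letter_G[of "(1, True)"] b by simp
    qed
    have "phi [] < phi k" using phi_bounds(1)[OF k(1)] phi_inj[OF carrier_Nil k(1)] k(2) by fastforce
    moreover have "phi k < phi' []"
      using phi_bounds(2)[OF k(1)] phi_Nil(2) del_pos by linarith
    moreover have "phi k \<noteq> phi h" using phi_inj[OF k(1) h(1)] k by blast
    ultimately consider "phi [] < phi k" "phi k < phi h" | "phi h < phi k" "phi k < phi' []" by linarith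
    then show False
      using seg_no_phi[OF carrier_Nil k(1)] seg_no_phi[OF h(1) k(1)] phi'_phi[OF h(2)] unfolding n by cases auto
  qed
  note G = assms nxt_G[OF assms]
  have ne: "nxt g \<noteq> g" by (rule nxt_ne[OF assms])
  consider "g = []" | "nxt g = []" | "g \<noteq> []" "nxt g \<noteq> []" by blast
  then show False
  proof cases
    case 1
    show ?thesis by (rule key[OF G(2)]) (use eq2 ne 1 in simp_all)
  next
    case 2
    show ?thesis by (rule key[OF G(1)]) (use eq2 ne 2 in auto)
  next
    case 3
    then show ?thesis using phi_lt[OF G(1)] phi_lt[OF G(2)] phi'_phi unfolding eq2 by simp
  qed
qed

lemma lam_inj: "g \<in> G \<Longrightarrow> lam g t = lam g t' \<Longrightarrow> t = t'"
  using phi_lt[of g] by (simp add: lam_def divide_eq_eq)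

lemma inj_Psi: "inj_on Psi {phi []..<phi' []}"
proof (rule inj_onI)
  fix t t' assume t: "t \<in> {phi []..<phi' []}" "t' \<in> {phi []..<phi' []}" and eq: "Psi t = Psi t'"
  have tD: "t \<in> D" "t' \<in> D" using t by auto
  show "t = t'"
  proof (cases "\<exists>g\<in>G. t \<in> seg g")
    case True
    then obtain g where g: "g \<in> G" "t \<in> seg g" "t < phi' (nxt g)" using right_seg t by (metis atLeastLessThan_iff)
    have "\<exists>g\<in>G. t' \<in> seg g"
      using Psi_Pt[OF tD(2)] Psi_seg[OF g(1,2)] eq by simp
    then obtain h where h: "h \<in> G" "t' \<in> seg h" "t' < phi' (nxt h)" using right_seg t by (metis atLeastLessThan_iff)
    have ep: "edge_point g (nxt g) (lam g t) = edge_point h (nxt h) (lam h t')"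
      using Psi_seg[OF g(1,2)] Psi_seg[OF h(1,2)] eq by simp
    note lt = lam_range(3)[OF g(1) g(3)] lam_range(3)[OF h(1) h(3)]
    note ge = lam_range(1)[OF g(1,2)] lam_range(1)[OF h(1,2)]
    \<comment> \<open>With the right end of the segment excluded, the support is \<open>{g}\<close>
      or \<open>{g, nxt g}\<close>, and in both cases it determines \<open>g\<close>.\<close>
    have supp: "{x. edge_point g (nxt g) c x \<noteq> 0} = (if c = 0 then {g} else {g, nxt g})"
      if "g \<in> G" "c < 1" for g c
      using that nxt_ne[OF that(1)] by (auto simp: edge_point_def)
    have seq: "(if lam g t = 0 then {g} else {g, nxt g}) = (if lam h t' = 0 then {h} else {h, nxt h})"
      using supp[OF g(1) lt(1)] supp[OF h(1) lt(2)] ep by simp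
    have "g = h"
    proof (cases "lam g t = 0")
      case True
      then show ?thesis using seq nxt_ne[OF h(1)] by (auto split: if_splits)
    next
      case False
      then have "{g, nxt g} = {h, nxt h}" using seq nxt_ne[OF g(1)] by (auto split: if_splits)
      then show ?thesis using nxt_nxt_ne[OF g(1)] by (auto simp: doubleton_eq_iff)
    qed
    then have "lam g t = lam g t'" using ep edge_point_inj[of g "nxt g"] nxt_ne[OF g(1)] by auto
    then show ?thesis using lam_inj[OF g(1)] by blast
  next
    case False
    then obtain \<tau> where \<tau>: "tree_ray \<tau>" "\<And>k. t \<in> node (\<tau> k)" "Psi t = End (tree_end \<tau>)"
      using Psi_ray[OF tD(1)] by blast
    have "\<not> (\<exists>g\<in>G. t' \<in> seg g)" using Psi_seg[of _ t'] eq \<tau>(3) by auto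
    then obtain \<sigma> where \<sigma>: "tree_ray \<sigma>" "\<And>k. t' \<in> node (\<sigma> k)" "Psi t' = End (tree_end \<sigma>)"
      using Psi_ray[OF tD(2)] by blast
    have "\<tau> = \<sigma>" using tree_end_inj[OF \<tau>(1) \<sigma>(1)] \<tau>(3) \<sigma>(3) eq by simp
    then show ?thesis using nodes_unique[OF \<tau>(1,2)] \<sigma>(2) by blast
  qed
qed

section \<open>The image as the closure of the lines\<close>

lemma H_subgraph: "subgraph H X"
proof -
  have "e \<subseteq> G" if "e \<in> edges H" for e using that nxt_G unfolding edges_H by blast
  then show ?thesis by (simp add: subgraph_def edges_X)
qed

lemma complex_H_subset: "Pt ` complex_points H \<subseteq> Psi ` D"
proof
  fix y assume "y \<in> Pt ` complex_points H"
  then consider g where "g \<in> G" "y = Pt (vertex_point g)"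
    | u v c where "{u, v} \<in> edges H" "0 \<le> c" "c \<le> 1" "y = Pt (edge_point u v c)"
    by (auto simp: complex_points_def)
  then show "y \<in> Psi ` D"
  proof cases
    case (1 g)
    then have "y = Psi (phi g)" "phi g \<in> D"
      using Psi_phi[OF 1(1)] phi_mem_seg(1)[OF 1(1)] seg_subset_D[OF 1(1)] by auto
    then show ?thesis by blast
  next
    case (2 u v c)
    then obtain g where g: "g \<in> G" "{u, v} = {g, nxt g}" by (auto simp: edges_H)
    have "\<exists>c. 0 \<le> c \<and> c \<le> 1 \<and> y = Pt (edge_point g (nxt g) c)"
    proof (cases "u = g")
      case True
      then show ?thesis using g 2 by (auto simp: doubleton_eq_iff)
    next
      case False
      then have "u = nxt g" "v = g" using g by (auto simp: doubleton_eq_iff)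
      then show ?thesis using 2 edge_point_swap[of "nxt g" g c] by (intro exI[of _ "1 - c"]) auto
    qed
    then obtain c where c: "0 \<le> c" "c \<le> 1" "y = Pt (edge_point g (nxt g) c)" by blast
    define t where "t = phi g + c * (phi' (nxt g) - phi g)"
    have "c * (phi' (nxt g) - phi g) \<le> 1 * (phi' (nxt g) - phi g)"
      using c phi_lt[OF g(1)] by (intro mult_right_mono) auto
    moreover have "0 \<le> c * (phi' (nxt g) - phi g)" using c phi_lt[OF g(1)] by simp
    ultimately have "t \<in> seg g" by (simp add: t_def seg_def)
    moreover have "lam g t = c" using phi_lt[OF g(1)] by (simp add: lam_def t_def)
    ultimately have "y = Psi t" "t \<in> D" using Psi_seg[OF g(1)] c seg_subset_D[OF g(1)] by auto
    then show ?thesis by blast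
  qed
qed

lemma Psi_seg_H: "g \<in> G \<Longrightarrow> t \<in> seg g \<Longrightarrow> Psi t \<in> Pt ` complex_points H"
proof -
  assume g: "g \<in> G" "t \<in> seg g"
  then have "edge_point g (nxt g) (lam g t) \<in> complex_points H"
    using lam_range(1)[OF g] unfolding complex_points_def edges_H by blast
  then show ?thesis using Psi_seg[OF g] by simp
qed

text \<open>The image is compact, hence closed, and contains the lines. Conversely, an end in the
  image is approached by the vertices on its tree ray, which lie on the lines.\<close>

lemma closure_H: "closure_in X H = Psi ` D"
proof
  have "compactin (freudenthal X) (Psi ` D)"
    by (rule image_compactin[OF _ continuous_Psi]) (simp add: compactin_subtopology)
  then have "closedin (freudenthal X) (Psi ` D)" using compactin_imp_closedin[OF cay.Hausdorff_freudenthal] by blast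
  then show "closure_in X H \<subseteq> Psi ` D"
    unfolding closure_in_def using complex_H_subset by (rule closure_of_minimal[rotated])
  show "Psi ` D \<subseteq> closure_in X H"
  proof clarify
    fix t assume t: "t \<in> D"
    show "Psi t \<in> closure_in X H"
      unfolding closure_in_def in_closure_of
    proof (intro conjI allI impI)
      show "Psi t \<in> topspace (freudenthal X)" using Psi_topspace[OF t] .
      fix T assume T: "Psi t \<in> T \<and> openin (freudenthal X) T"
      show "\<exists>y. y \<in> Pt ` complex_points H \<and> y \<in> T"
      proof (cases "\<exists>g\<in>G. t \<in> seg g")
        case True
        then show ?thesis using Psi_seg_H T by blast
      next
        case False
        then obtain \<tau> where \<tau>: "tree_ray \<tau>" "\<And>k. t \<in> node (\<tau> k)"
          using Psi_ray[OF t] by blast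
        have "openin (top_of_set D) {u \<in> D. Psi u \<in> T}"
          using openin_continuous_map_preimage[OF continuous_Psi] T by simp
        then obtain V where V: "open V" "{u \<in> D. Psi u \<in> T} = D \<inter> V" by (auto simp: openin_open)
        have "t \<in> V" using V(2) t T by blast
        have G: "\<tau> (Suc k) \<in> G \<and> \<tau> (Suc k) \<noteq> []" for k
          using tree_rayD(1)[OF \<tau>(1)] tree_ray_length[OF \<tau>(1), of "Suc k"] by auto
        \<comment> \<open>The value at \<open>k = 0\<close> is replaced by \<open>t\<close>, since
          the parameter of the root is outside \<open>node []\<close>.\<close>
        have "(\<lambda>k. if k = 0 then t else phi (\<tau> k)) \<longlonglongrightarrow> t"
        proof (rule nodes_converge[OF \<tau>])
          fix k show "(if k = 0 then t else phi (\<tau> k)) \<in> node (\<tau> k)"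
            using \<tau>(2)[of k] G[of "k - 1"] leaf_subset_node[of "\<tau> k"] phi_in_leaf[of "\<tau> k"] by (cases k) auto
        qed
        then have "\<forall>\<^sub>F k in sequentially. (if k = 0 then t else phi (\<tau> k)) \<in> V"
          using V(1) \<open>t \<in> V\<close> by (rule topological_tendstoD)
        then obtain N where "\<forall>k\<ge>N. (if k = 0 then t else phi (\<tau> k)) \<in> V"
          unfolding eventually_sequentially ..
        then have "phi (\<tau> (Suc N)) \<in> V" by (metis Suc_n_not_le_n le_SucI nat.distinct(1) order_refl)
        moreover have "phi (\<tau> (Suc N)) \<in> seg (\<tau> (Suc N))" using phi_mem_seg G by blast
        ultimately have "Psi (phi (\<tau> (Suc N))) \<in> T" "Psi (phi (\<tau> (Suc N))) \<in> Pt ` complex_points H"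
          using V(2) seg_subset_D G Psi_seg_H by blast+
        then show ?thesis by blast
      qed
    qed
  qed
qed

theorem hamiltonian_H: "hamiltonian_circle X (closure_in X H)"
proof -
  have "phi [] < phi' []" using phi_Nil del_pos by linarith
  then have "circle_in (freudenthal X) (Psi ` D)"
    using continuous_Psi Psi_closed inj_Psi cay.Hausdorff_freudenthal by (intro circle_in_closed_path)
  moreover have "Pt ` vertex_point ` verts X \<subseteq> Psi ` D"
  proof clarify
    fix v assume "v \<in> verts X"
    then have v: "v \<in> G" by simp
    have "Pt (vertex_point v) = Psi (phi v)" "phi v \<in> D"
      using Psi_phi[OF v] phi_mem_seg(1)[OF v] seg_subset_D[OF v] by auto
    then show "Pt (vertex_point v) \<in> Psi ` D" by blast
  qed
  ultimately show ?thesis unfolding closure_H cay.ham_circle_vertices by blast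
qed

end

section \<open>Uniqueness\<close>

context surface_word
begin

definition cone :: "nat letter list \<Rightarrow> nat letter list set" where
  "cone u = {u @ z |z. u @ z \<in> G}"

lemma mult_cancel:
  assumes "g \<in> G" "t \<in> G"
  shows "foldr push (foldr push g t) (winv t) = g"
proof -
  interpret group F by (rule group_free_group)
  have "foldr push t (winv t) = []"
    using r_inv[OF assms(2)] inv_free_group[OF assms(2)] by (simp add: mult_free_group one_free_group)
  then show ?thesis
    using foldr_push_assoc[OF reduced_G[OF winv_carrier[OF assms(2)]], of g t] assms(1) reduced_G
    by (simp add: foldr_push_Nil)
qed

text \<open>The vertices of the tree path from \<open>g\<close> to \<open>g s\<close>, one tree edge
  for each letter of \<open>s\<close>.\<close>

definition walk :: "nat letter list \<Rightarrow> nat \<Rightarrow> nat letter list" where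
  "walk g j = foldr push g (take j s)"

lemma walk_G: "g \<in> G \<Longrightarrow> walk g j \<in> G"
  unfolding walk_def using mult_G carrier_take[OF s_carrier] by blast

lemma walk_0 [simp]: "g \<in> G \<Longrightarrow> walk g 0 = g"
  using reduced_G by (simp add: walk_def foldr_push_Nil)

lemma walk_end: "walk g (2 * n) = foldr push g s"
  using length_s by (simp add: walk_def)

lemma walk_back: "g \<in> G \<Longrightarrow> foldr push (walk g j) (winv (take j s)) = g"
  unfolding walk_def by (rule mult_cancel[OF _ carrier_take[OF s_carrier]])

lemma walk_Suc: "j < 2 * n \<Longrightarrow> walk g (Suc j) = foldr push (walk g j) [s ! j]"
proof -
  assume j: "j < 2 * n"
  have "take (Suc j) s = take j s @ [s ! j]" using j length_s by (simp add: take_Suc_conv_app_nth)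
  then have "take (Suc j) s = foldr push (take j s) [s ! j]"
    using foldr_push_reduced[of "take j s" "[s ! j]"] reduced_G[OF carrier_take[OF s_carrier, of "Suc j"]] by simp
  moreover have "reduced_word [s ! j]" by (simp add: reduced_word_def)
  ultimately show ?thesis using foldr_push_assoc unfolding walk_def by metis
qed

lemma walk_step:
  assumes "g \<in> G" "j < 2 * n"
  obtains (down) "walk g (Suc j) = walk g j @ [s ! j]" "walk g j @ [s ! j] \<in> G"
  | (up) "walk g j = walk g (Suc j) @ [flip (s ! j)]" "walk g (Suc j) @ [flip (s ! j)] \<in> G"
  using mult_letter[OF walk_G[OF assms(1), of j] letter_s[OF assms(2)]] walk_Suc[OF assms(2)]
    walk_G[OF assms(1), of j] by metis

text \<open>The words that begin with \<open>w @ [x]\<close> form a subtree joined to the rest of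
  the tree by a single edge.\<close>

lemma cone_crossing:
  assumes u: "w @ [x] \<in> G" and v: "v @ [y] \<in> G" and cross: "(v \<in> cone (w @ [x])) \<noteq> (v @ [y] \<in> cone (w @ [x]))"
  shows "v = w \<and> y = x"
proof -
  have "v @ [y] \<in> cone (w @ [x])" "v \<notin> cone (w @ [x])"
    using cross v by (auto simp: cone_def)
  then obtain z where z: "v @ [y] = (w @ [x]) @ z" by (auto simp: cone_def)
  show ?thesis
  proof (cases z rule: rev_cases)
    case (snoc z' a)
    then have "v = (w @ [x]) @ z'" using z by simp
    then show ?thesis using \<open>v \<notin> cone (w @ [x])\<close> snoc_carrierD(1)[OF v] by (auto simp: cone_def)
  qed (use z in simp)
qed

text \<open>The left endpoint of the line edge crossing the tree edge \<open>{w, w @ [x]}\<close> with its \<open>i\<close>-th letter.\<close>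

definition crosser :: "nat letter list \<Rightarrow> nat letter \<Rightarrow> nat \<Rightarrow> nat letter list" where
  "crosser w x i = foldr push (w @ [x]) (winv (take (if s ! i = flip x then i else Suc i) s))"

lemma crosser_G: "w @ [x] \<in> G \<Longrightarrow> crosser w x i \<in> G"
  unfolding crosser_def by (intro mult_G winv_carrier carrier_take s_carrier)

text \<open>If the letter is \<open>x\<close> the path is at \<open>w @ [x]\<close> after this
  letter, and if it is \<open>flip x\<close> the path is there before it. Undoing the letters read
  so far recovers \<open>g\<close> in both cases.\<close>

lemma walk_crosser:
  assumes g: "g \<in> G" and i: "i < 2 * n" and e: "{walk g i, walk g (Suc i)} = {w, w @ [x]}"
  shows "fst (s ! i) = fst x \<and> g = crosser w x i"
  using g i
proof (cases rule: walk_step)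
  case down
  then have "walk g i = w" "walk g (Suc i) = w @ [x]" "s ! i = x" using e by (auto simp: doubleton_eq_iff)
  then show ?thesis using walk_back[OF g, of "Suc i"] by (simp add: crosser_def)
next
  case up
  then have "walk g i = w @ [x]" "walk g (Suc i) = w" "flip (s ! i) = x" using e by (auto simp: doubleton_eq_iff)
  moreover from this have "s ! i = flip x" by (metis flip_flip)
  ultimately show ?thesis using walk_back[OF g, of i] by (simp add: crosser_def)
qed

lemma line_crossing:
  assumes u: "w @ [x] \<in> G" and g: "g \<in> G"
    and cross: "(g \<in> cone (w @ [x])) \<noteq> (foldr push g s \<in> cone (w @ [x]))"
  obtains i where "i < 2 * n" "fst (s ! i) = fst x" "g = crosser w x i"
proof -
  have "\<exists>i<2 * n. (walk g i \<in> cone (w @ [x])) \<noteq> (walk g (Suc i) \<in> cone (w @ [x]))"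
  proof (rule ccontr)
    assume no: "\<not> ?thesis"
    have "i \<le> 2 * n \<Longrightarrow> (walk g i \<in> cone (w @ [x])) = (walk g 0 \<in> cone (w @ [x]))" for i
      by (induction i) (use no in auto)
    then show False using cross walk_end[of g] walk_0[OF g] by (metis order_refl)
  qed
  then obtain i where i: "i < 2 * n" "(walk g i \<in> cone (w @ [x])) \<noteq> (walk g (Suc i) \<in> cone (w @ [x]))" by blast
  have "{walk g i, walk g (Suc i)} = {w, w @ [x]}"
    using g i(1)
  proof (cases rule: walk_step)
    case down
    then show ?thesis using cone_crossing[OF u down(2)] i(2) by auto
  next
    case up
    then show ?thesis using cone_crossing[OF u up(2)] i(2) by auto
  qed
  then show ?thesis using that walk_crosser[OF g i(1)] i(1) by blast
qed

lemma mid_sym: "{a, b} = {c, d} \<Longrightarrow> edge_point a b (1/2) = edge_point c d (1/2)"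
  using edge_point_swap[of a b "1/2"] by (auto simp: doubleton_eq_iff)

lemma unused_line_forces_path:
  assumes K: "hamiltonian_circle X K" and g: "g \<in> G" and j: "j < 2 * n"
    and unused: "Pt (edge_point g (foldr push g s) (1/2)) \<notin> K"
  shows "Pt (edge_point (walk g j) (walk g (Suc j)) (1/2)) \<in> K"
proof (rule ccontr)
  assume notK: "\<not> ?thesis"
  obtain w x where wx: "w @ [x] \<in> G" "{walk g j, walk g (Suc j)} = {w, w @ [x]}"
    using g j
  proof (cases rule: walk_step)
    case down
    then show ?thesis using that[of "walk g j" "s ! j"] by simp
  next
    case up
    then show ?thesis using that[of "walk g (Suc j)" "flip (s ! j)"] by (simp add: insert_commute)
  qed
  have gj: "fst (s ! j) = fst x" "g = crosser w x j" using walk_crosser[OF g j wx(2)] by auto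
  obtain j' where j': "\<And>i. i < 2 * n \<Longrightarrow> fst (s ! i) = fst (s ! j) \<Longrightarrow> i = j \<or> i = j'"
    using twice[OF j] by blast
  define A where "A = cone (w @ [x])"
  define h where "h = crosser w x j'"
  have h: "h \<in> G" "foldr push h s \<in> G" using crosser_G[OF wx(1)] mult_G s_carrier by (auto simp: h_def)
  have cut: "{a, b} \<in> {{w, w @ [x]}, {g, foldr push g s}, {h, foldr push h s}}" if ab: "(a, b) \<in> cay.cut A" for a b
  proof -
    have "{a, b} \<in> edges X" and side: "a \<in> A" "b \<notin> A" using ab by (auto simp: cay.cut_def)
    then consider g' where "g' \<in> G" "{a, b} = {g', foldr push g' s}" | v y where "v @ [y] \<in> G" "{a, b} = {v, v @ [y]}"
      unfolding edges_X edges_H_mult by blast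
    then show ?thesis
    proof cases
      case (1 g')
      then have "(g' \<in> A) \<noteq> (foldr push g' s \<in> A)" using side by (auto simp: doubleton_eq_iff)
      then obtain i where i: "i < 2 * n" "fst (s ! i) = fst x" "g' = crosser w x i"
        using line_crossing[OF wx(1) 1(1)] unfolding A_def by blast
      then have "g' = g \<or> g' = h" using j'[of i] gj by (auto simp: h_def)
      then show ?thesis using 1 by auto
    next
      case (2 v y)
      then have "(v \<in> A) \<noteq> (v @ [y] \<in> A)" using side by (auto simp: doubleton_eq_iff)
      then have "v = w \<and> y = x" using cone_crossing[OF wx(1) 2(1)] by (simp add: A_def)
      then show ?thesis using 2 by simp
    qed
  qed
  define V where "V = {w, w @ [x], g, foldr push g s, h, foldr push h s}"
  have "cay.cut A \<subseteq> V \<times> V"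
  proof clarify
    fix a b assume "(a, b) \<in> cay.cut A"
    from cut[OF this] show "a \<in> V \<and> b \<in> V" unfolding V_def by (auto simp: doubleton_eq_iff)
  qed
  then have fin: "finite (cay.cut A)" by (rule finite_subset) (simp add: V_def)
  \<comment> \<open>Taking out the midpoint of the other line edge leaves the tree edge as the only
    possible crossing.\<close>
  let ?z = "Pt (edge_point h (foldr push h s) (1/2))"
  have hne: "h \<noteq> foldr push h s"
  proof -
    have "{h, foldr push h s} \<in> edges X" unfolding edges_X edges_H_mult using h by blast
    then show ?thesis using cay.edgeD by blast
  qed
  have z: "?z \<notin> Pt ` vertex_point ` verts X"
  proof
    assume "?z \<in> Pt ` vertex_point ` verts X"
    then obtain v where "edge_point h (foldr push h s) (1/2) = vertex_point v" by auto
    from fun_cong[OF this, of h] show False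
      using hne by (auto simp: edge_point_def vertex_point_def of_bool_def split: if_splits)
  qed
  have A: "w @ [x] \<in> A" "A \<subseteq> verts X" "[] \<in> verts X - A"
    using wx(1) by (auto simp: A_def cone_def intro!: exI[of _ "[]"])
  obtain a b where ab: "(a, b) \<in> cay.cut A" "Pt (edge_point a b (1/2)) \<in> K - {?z}"
    using cay.circle_crosses_cut_twice[OF K fin A z] by blast
  from cut[OF ab(1)] consider "{a, b} = {walk g j, walk g (Suc j)}" | "{a, b} = {g, foldr push g s}"
    | "{a, b} = {h, foldr push h s}" using wx(2) by blast
  then show False
  proof cases
    case 1
    then show ?thesis using mid_sym[OF 1] ab(2) notK by simp
  next
    case 2
    then show ?thesis using mid_sym[OF 2] ab(2) unused by simp
  next
    case 3
    then show ?thesis using mid_sym[OF 3] ab(2) by simp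
  qed
qed

lemma mult_left_cancel:
  assumes "v \<in> G" "a \<in> G" "b \<in> G" "foldr push v a = foldr push v b"
  shows "a = b"
proof -
  interpret group F by (rule group_free_group)
  show ?thesis using Units_l_cancel[of v a b] assms by (simp add: mult_free_group)
qed

lemma three_used_edges:
  assumes K: "hamiltonian_circle X K" and v: "v \<in> G"
    and G: "a \<in> G" "b \<in> G" "c \<in> G" and ne: "a \<noteq> b" "a \<noteq> c" "b \<noteq> c"
    and e: "{v, foldr push v a} \<in> edges X" "{v, foldr push v b} \<in> edges X" "{v, foldr push v c} \<in> edges X"
    and mem: "Pt (edge_point v (foldr push v a) (1/2)) \<in> K" "Pt (edge_point v (foldr push v b) (1/2)) \<in> K"
      "Pt (edge_point v (foldr push v c) (1/2)) \<in> K"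
  shows False
  using cay.circle_degree_le_2[OF K e _ _ _ mem] mult_left_cancel[OF v] G ne by blast

lemma line_edge: "g \<in> G \<Longrightarrow> {g, foldr push g s} \<in> edges X"
  unfolding edges_X edges_H_mult by blast

lemma letter_edge: "g \<in> G \<Longrightarrow> fst x \<in> base \<Longrightarrow> {g, foldr push g [x]} \<in> edges X"
  using mult_letter[of g x] tree_edge[of g x] tree_edge[of "foldr push g [x]" "flip x"]
  by (auto simp: insert_commute)

lemma circle_uses_lines:
  assumes K: "hamiltonian_circle X K" and g: "g \<in> G"
  shows "Pt (edge_point g (foldr push g s) (1/2)) \<in> K"
proof (rule ccontr)
  assume unused: "\<not> ?thesis"
  define v where "v = walk g 1"
  let ?m = "2 * n - 1"
  have n: "0 < 2 * n" "1 < 2 * n" "?m < 2 * n" "Suc ?m = 2 * n" using n_ge by auto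
  have v: "v \<in> G" using walk_G[OF g] by (simp add: v_def)
  note l0 = letter_s[OF n(1)] and l1 = letter_s[OF n(2)] and lm = letter_s[OF n(3)]
  have flG: "[x] \<in> G" "[flip x] \<in> G" "fst (flip x) \<in> base" if "fst x \<in> base" for x
    using letter_G[of x] letter_G[of "flip x"] that by auto
  have undo: "foldr push (foldr push h [x]) [flip x] = h" if "h \<in> G" "fst x \<in> base" for h x
    using mult_cancel[OF that(1) letter_G[OF that(2)]] by simp
  have v_eq: "v = foldr push g [s ! 0]" using walk_Suc[OF n(1), of g] walk_0[OF g] by (simp add: v_def)
  have g_eq: "g = foldr push v [flip (s ! 0)]" using undo[OF g l0] v_eq by simp
  have sl: "s \<noteq> [x]" "winv s \<noteq> [x]" for x
    using length_s n_ge by (auto dest: arg_cong[of _ _ length])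
  have e0: "Pt (edge_point v (foldr push v [flip (s ! 0)]) (1/2)) \<in> K"
  proof -
    have "{walk g 0, walk g (Suc 0)} = {v, foldr push v [flip (s ! 0)]}"
      using g_eq walk_0[OF g] by (simp add: v_def insert_commute)
    then show ?thesis using unused_line_forces_path[OF K g n(1) unused] mid_sym by metis
  qed
  have e1: "Pt (edge_point v (foldr push v [s ! 1]) (1/2)) \<in> K"
    using unused_line_forces_path[OF K g n(2) unused] walk_Suc[OF n(2), of g] by (simp add: v_def)
  \<comment> \<open>By \<open>turn\<close> the positions of the two letters differ by
    \<open>eps\<close>, so there is no backtracking at \<open>v\<close>.\<close>
  have ne01: "flip (s ! 0) \<noteq> s ! 1"
    using turn[of 0] n eps by (auto)
  have un1: "Pt (edge_point v (foldr push v s) (1/2)) \<notin> K"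
    by (rule notI, rule three_used_edges[OF K v, of "[flip (s ! 0)]" "[s ! 1]" s])
      (use flG[OF l0] flG[OF l1] s_carrier ne01 sl letter_edge[OF v] l0 l1 line_edge[OF v] e0 e1 in \<open>auto simp: eq_commute[of _ s]\<close>)
  have e2: "Pt (edge_point v (foldr push v [s ! 0]) (1/2)) \<in> K"
    using unused_line_forces_path[OF K v n(1) un1] walk_Suc[OF n(1), of v] walk_0[OF v] by simp
  define v' where "v' = foldr push v (winv s)"
  have v': "v' \<in> G" "foldr push v' s = v"
    using mult_G[OF v winv_s_G] mult_s_cancel(2)[OF v] by (auto simp: v'_def)
  have sw: "{v', foldr push v' s} = {v, foldr push v (winv s)}" using v' by (simp add: v'_def insert_commute)
  have un2: "Pt (edge_point v' (foldr push v' s) (1/2)) \<notin> K"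
  proof
    assume "Pt (edge_point v' (foldr push v' s) (1/2)) \<in> K"
    then have a: "Pt (edge_point v (foldr push v (winv s)) (1/2)) \<in> K" using mid_sym[OF sw] by simp
    have b: "{v, foldr push v (winv s)} \<in> edges X" using line_edge[OF v'(1)] sw by simp
    show False
      by (rule three_used_edges[OF K v, of "[flip (s ! 0)]" "[s ! 1]" "winv s"])
        (use flG[OF l0] flG[OF l1] winv_s_G ne01 sl letter_edge[OF v] l0 l1 b a e0 e1 in \<open>auto simp: eq_commute[of _ "winv s"]\<close>)
  qed
  have e3: "Pt (edge_point v (foldr push v [flip (s ! ?m)]) (1/2)) \<in> K"
  proof -
    have "walk v' (Suc ?m) = v" using walk_end[of v'] v'(2) n(4) by simp
    moreover have "walk v' ?m = foldr push v [flip (s ! ?m)]"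
      using undo[OF walk_G[OF v'(1)] lm, of ?m] walk_Suc[OF n(3), of v'] calculation by simp
    ultimately have "{walk v' ?m, walk v' (Suc ?m)} = {v, foldr push v [flip (s ! ?m)]}"
      by (simp add: insert_commute)
    then show ?thesis using unused_line_forces_path[OF K v'(1) n(3) un2] mid_sym by metis
  qed
  \<comment> \<open>The first and the last letter of \<open>s\<close> belong to different
    generators, so the three directions are distinct.\<close>
  have ne: "fst (s ! 0) \<noteq> fst (s ! ?m)" by (rule fst_ends)
  then have ne': "flip (s ! 0) \<noteq> flip (s ! ?m)" "s ! 0 \<noteq> flip (s ! ?m)" by (auto dest: arg_cong[of _ _ fst])
  show False
    by (rule three_used_edges[OF K v, of "[flip (s ! 0)]" "[s ! 0]" "[flip (s ! ?m)]"])
      (use flG[OF l0] flG[OF lm] ne' letter_edge[OF v] l0 e0 e2 e3 in auto)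
qed

text \<open>Once all midpoints of line edges are on \<open>K\<close>, so is the closure of the
  lines. This is itself a circle, and a circle contains no smaller one.\<close>

theorem unique_circle:
  assumes K: "hamiltonian_circle X K"
  shows "K = closure_in X H"
proof -
  have K': "circle_in (freudenthal X) K" "Pt ` vertex_point ` verts X \<subseteq> K"
    using K cay.ham_circle_vertices by blast+
  have "Pt ` complex_points H \<subseteq> K"
  proof
    fix y assume "y \<in> Pt ` complex_points H"
    then consider g where "g \<in> G" "y = Pt (vertex_point g)"
      | u v t where "{u, v} \<in> edges H" "0 \<le> t" "t \<le> 1" "y = Pt (edge_point u v t)"
      by (auto simp: complex_points_def)
    then show "y \<in> K"
    proof cases
      case 1
      then show ?thesis using K'(2) by auto
    next
      case (2 u v t)
      then obtain g where g: "g \<in> G" "{u, v} = {g, foldr push g s}" by (auto simp: edges_H_mult)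
      have "Pt (edge_point u v (1/2)) \<in> K" using circle_uses_lines[OF K g(1)] mid_sym[OF g(2)] by simp
      moreover have "{u, v} \<in> edges X" using 2(1) by (simp add: edges_X)
      ultimately show ?thesis using cay.circle_contains_edge[OF K] 2 by blast
    qed
  qed
  then have "closure_in X H \<subseteq> K"
    unfolding closure_in_def by (rule closure_of_minimal) (rule cay.closedin_circle[OF K'(1)])
  moreover have "circle_in (freudenthal X) (closure_in X H)"
    using hamiltonian_H cay.ham_circle_vertices by blast
  ultimately show ?thesis using circle_subset_circle[OF K'(1)] by blast
qed

text \<open>Equal closures give equal edge sets, and every group element is an end of some line
  edge, which fixes the vertex set.\<close>

theorem unique_subgraph:
  assumes "hamiltonian_circle_subgraph X H'"
  shows "H' = H"
proof -
  have H': "subgraph H' X" "closure_in X H' = closure_in X H"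
    using assms unique_circle by (auto simp: hamiltonian_circle_subgraph_def)
  have edges: "edges H' = edges H"
    using cay.closure_in_edges_subset[OF H'(1) H_subgraph] cay.closure_in_edges_subset[OF H_subgraph H'(1)] H'(2) by auto
  have "G \<subseteq> verts H'"
  proof
    fix g assume "g \<in> G"
    then have "{g, nxt g} \<in> edges H'" unfolding edges edges_H by blast
    then show "g \<in> verts H'" using H'(1) by (auto simp: subgraph_def)
  qed
  then have "verts H' = verts H" using H'(1) by (auto simp: subgraph_def)
  then show ?thesis using edges by (intro ugraph.equality) simp_all
qed

end

section \<open>The two words\<close>

theorem (in surface_word) unique_hamiltonian_circle:
  assumes "X' = cayley_graph (free_group {1..n})
      (with_inverses (free_group {1..n}) (gen ` {1..n}) \<union> with_inverses (free_group {1..n}) {s})"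
    and "H' = cayley_graph (free_group {1..n}) (with_inverses (free_group {1..n}) {s})"
  shows "hamiltonian_circle_subgraph X' H'
   \<and> (\<forall>H''. hamiltonian_circle_subgraph X' H'' \<longrightarrow> H'' = H')
   \<and> (\<forall>K. hamiltonian_circle X' K \<longrightarrow> K = closure_in X' H')"
proof -
  have eq: "X' = X" "H' = H" unfolding assms X_def H_def base_def by (rule refl)+
  have "hamiltonian_circle_subgraph X H"
    using hamiltonian_H H_subgraph by (simp add: hamiltonian_circle_subgraph_def)
  then show ?thesis unfolding eq using unique_circle unique_subgraph by blast
qed

lemma list_product_concat:
  "reduced_word (concat ws) \<Longrightarrow> list_product (free_group B) ws = concat ws"
proof (induction ws)
  case Nil
  then show ?case by (simp add: list_product_def one_free_group)
next
  case (Cons w ws)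
  have "reduced_word (concat ws)" using Cons.prems by (simp add: reduced_word_append)
  then have "list_product (free_group B) (w # ws) = foldr push w (concat ws)"
    using Cons.IH by (simp add: list_product_def mult_free_group)
  then show ?case using foldr_push_reduced Cons.prems by simp
qed

section \<open>The letters of the two words and their positions\<close>

definition squares_letter :: "nat \<Rightarrow> nat letter" where
  "squares_letter j = (j div 2 + 1, True)"

definition commutators_letter :: "nat \<Rightarrow> nat letter" where
  "commutators_letter j = (2 * (j div 4) + j mod 2 + 1, j mod 4 < 2)"

lemma reduced_word_map_upt:
  assumes "\<And>j. f (Suc j) \<noteq> flip (f j)"
  shows "reduced_word (map f [0..<m])"
  using assms by (simp add: reduced_word_def successively_conv_nth)

lemma gen_square:
  "gen i [^]\<^bsub>free_group B\<^esub> (2::nat) = [(i, True), (i, True)]"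
proof -
  have "gen i [^]\<^bsub>free_group B\<^esub> (2::nat) = foldr push (foldr push [] (gen i)) (gen i)"
    by (simp add: numeral_2_eq_2 mult_free_group one_free_group)
  then show ?thesis by (simp add: gen_def push_def flip_def)
qed

lemma commutator_gen:
  assumes "a \<noteq> b" "a \<in> B" "b \<in> B"
  shows "commutator (free_group B) (gen a) (gen b) = [(a, True), (b, True), (a, False), (b, False)]"
  using assms by (simp add: commutator_def inv_gen mult_free_group) (simp add: gen_def push_def flip_def)

lemma squares_product:
  "list_product (free_group B) (map (\<lambda>i. gen i [^]\<^bsub>free_group B\<^esub> (2::nat)) [1..<n + 1]) =
    map squares_letter [0..<2 * n]"
proof -
  have "concat (map (\<lambda>i. gen i [^]\<^bsub>free_group B\<^esub> (2::nat)) [1..<n + 1]) = map squares_letter [0..<2 * n]"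
    by (induction n) (simp_all add: gen_square squares_letter_def)
  moreover have "reduced_word (map squares_letter [0..<2 * n])"
    by (rule reduced_word_map_upt) (simp add: squares_letter_def flip_def)
  ultimately show ?thesis using list_product_concat by metis
qed

lemma commutators_letter_simps:
  "commutators_letter (4 * k) = (2 * k + 1, True)"
  "commutators_letter (4 * k + 1) = (2 * k + 2, True)"
  "commutators_letter (4 * k + 2) = (2 * k + 1, False)"
  "commutators_letter (4 * k + 3) = (2 * k + 2, False)"
  by (simp_all add: commutators_letter_def, presburger+)

lemma mod4_cases:
  fixes j :: nat
  obtains k where "j = 4 * k" | k where "j = 4 * k + 1" | k where "j = 4 * k + 2" | k where "j = 4 * k + 3"
proof -
  have "j = 4 * (j div 4) + j mod 4" "j mod 4 < 4" by simp_all
  then consider "j = 4 * (j div 4)" | "j = 4 * (j div 4) + 1" | "j = 4 * (j div 4) + 2" | "j = 4 * (j div 4) + 3"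
    by linarith
  then show ?thesis using that by cases blast+
qed

lemma commutators_product:
  assumes "{1..2 * m} \<subseteq> B"
  shows "list_product (free_group B)
      (map (\<lambda>k. commutator (free_group B) (gen (2 * k - 1)) (gen (2 * k))) [1..<m + 1]) =
    map commutators_letter [0..<4 * m]"
proof -
  have "concat (map (\<lambda>k. commutator (free_group B) (gen (2 * k - 1)) (gen (2 * k))) [1..<m + 1]) =
      map commutators_letter [0..<4 * m]"
    using assms
  proof (induction m)
    case (Suc m)
    have "2 * m + 1 \<in> B" "2 * m + 2 \<in> B" using Suc.prems by auto
    then have c: "commutator (free_group B) (gen (2 * Suc m - 1)) (gen (2 * Suc m)) =
        [(2 * m + 1, True), (2 * m + 2, True), (2 * m + 1, False), (2 * m + 2, False)]"
      by (subst commutator_gen) auto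
    have e1: "[1..<Suc m + 1] = [1..<m + 1] @ [Suc m]" by simp
    have IH: "concat (map (\<lambda>k. commutator (free_group B) (gen (2 * k - 1)) (gen (2 * k))) [1..<m + 1]) =
        map commutators_letter [0..<4 * m]"
      by (rule Suc.IH) (use Suc.prems in auto)
    have e2: "[0..<4 * Suc m] = [0..<4 * m] @ [4 * m, 4 * m + 1, 4 * m + 2, 4 * m + 3]"
      by (simp add: upt_rec[of "4 * m"] numeral_eq_Suc)
    have e3: "map commutators_letter [4 * m, 4 * m + 1, 4 * m + 2, 4 * m + 3] =
        [(2 * m + 1, True), (2 * m + 2, True), (2 * m + 1, False), (2 * m + 2, False)]"
      by (simp add: commutators_letter_def) presburger
    show ?case
      unfolding e1 e2 map_append concat_append IH e3
      by (simp only: list.map concat.simps append_Nil2 c)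
  qed simp
  moreover have "reduced_word (map commutators_letter [0..<4 * m])"
  proof (rule reduced_word_map_upt)
    fix j
    have "fst (commutators_letter (Suc j)) \<noteq> fst (commutators_letter j)"
    proof (cases j rule: mod4_cases)
      case (1 k)
      then have eq: "Suc j = 4 * k + 1" by simp
      show ?thesis unfolding eq unfolding 1 commutators_letter_simps by simp
    next
      case (2 k)
      then have eq: "Suc j = 4 * k + 2" by simp
      show ?thesis unfolding eq unfolding 2 commutators_letter_simps by simp
    next
      case (3 k)
      then have eq: "Suc j = 4 * k + 3" by simp
      show ?thesis unfolding eq unfolding 3 commutators_letter_simps by simp
    next
      case (4 k)
      then have eq: "Suc j = 4 * (k + 1)" by simp
      show ?thesis unfolding eq unfolding 4 commutators_letter_simps by simp
    qed
    then show "commutators_letter (Suc j) \<noteq> flip (commutators_letter j)" by auto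
  qed
  ultimately show ?thesis using list_product_concat by metis
qed

text \<open>The cyclic order in which each generator is followed by its inverse, block by block.
  Inside a square the turn goes one step back, between squares one step forward, which matches
  \<open>eps = -1\<close>.\<close>

definition squares_pos :: "nat letter \<Rightarrow> int" where
  "squares_pos x = 2 * int (fst x) - (if snd x then 1 else 0)"

text \<open>For a commutator of \<open>a\<close> and \<open>b\<close> the order is \<open>a\<close>,
  inverse of \<open>b\<close>, inverse of \<open>a\<close>, \<open>b\<close>, block after block, so
  that every turn of the word is one step forward.\<close>

definition commutators_pos :: "nat letter \<Rightarrow> int" where
  "commutators_pos x = 2 * int (fst x) +
     (if odd (fst x) then (if snd x then - 1 else 1) else (if snd x then 0 else - 2))"

lemma letters_bij:
  fixes pos :: "nat letter \<Rightarrow> int"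
  assumes inj: "inj_on pos {x. fst x \<in> {1..n}}" and sub: "\<And>x. fst x \<in> {1..n} \<Longrightarrow> pos x \<in> {1..2 * int n}"
  shows "bij_betw pos {x. fst x \<in> {1..n}} {1..2 * int n}"
  unfolding bij_betw_def
proof (intro conjI inj card_subset_eq)
  have eq: "{x :: nat letter. fst x \<in> {1..n}} = {1..n} \<times> UNIV" by auto
  show "pos ` {x. fst x \<in> {1..n}} \<subseteq> {1..2 * int n}" using sub by auto
  show "card (pos ` {x. fst x \<in> {1..n}}) = card {1..2 * int n}"
    unfolding card_image[OF inj] unfolding eq by (simp add: card_cartesian_product card_UNIV_bool)
qed simp

lemma surface_word_squares:
  assumes "2 \<le> n"
  shows "surface_word n (map squares_letter [0..<2 * n]) squares_pos (- 1)"
proof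
  show "fst ` set (map squares_letter [0..<2 * n]) \<subseteq> {1..n}" by (auto simp: squares_letter_def)
  show "bij_betw squares_pos {x. fst x \<in> {1..n}} {1..2 * int n}"
  proof (rule letters_bij)
    show "inj_on squares_pos {x. fst x \<in> {1..n}}"
      by (auto simp: inj_on_def squares_pos_def split: if_splits; presburger)
  qed (auto simp: squares_pos_def)
  have "(2 * n - 1) div 2 + 1 = n" using assms by presburger
  then have last: "map squares_letter [0..<2 * n] ! (2 * n - 1) = (n, True)"
    using assms by (simp add: squares_letter_def)
  show "squares_pos (map squares_letter [0..<2 * n] ! 0) = 1"
    using assms by (simp add: squares_letter_def squares_pos_def)
  show "squares_pos (flip (map squares_letter [0..<2 * n] ! (2 * n - 1))) = 2 * int n"
    unfolding last by (simp add: squares_pos_def flip_def)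
  show "squares_pos (map squares_letter [0..<2 * n] ! Suc j) =
      squares_pos (flip (map squares_letter [0..<2 * n] ! j)) + (- 1) ^ Suc j" if "Suc j < 2 * n" for j
  proof (cases "even j")
    case True
    then obtain i where "j = 2 * i" by blast
    then show ?thesis using that by (simp add: squares_letter_def squares_pos_def flip_def)
  next
    case False
    then obtain i where "j = 2 * i + 1" by (rule oddE)
    then show ?thesis using that by (simp add: squares_letter_def squares_pos_def flip_def)
  qed
  show "\<exists>j. 0 < j \<and> j < 2 * n \<and>
      (if (- 1 :: int) ^ j = 1 then squares_pos (flip (map squares_letter [0..<2 * n] ! (j - 1))) = c
       else squares_pos (map squares_letter [0..<2 * n] ! j) = c)" if c: "1 \<le> c" "c < 2 * int n" for c
  proof (intro exI conjI)
    \<comment> \<open>The pair of positions \<open>c\<close> and \<open>c + 1\<close> is passed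
      right before the letter with index \<open>c\<close>: for even \<open>c\<close> between two
      squares, for odd \<open>c\<close> inside one.\<close>
    define j where "j = nat c"
    have j: "0 < j" "j < 2 * n" "c = int j" using c by (auto simp: j_def)
    show "0 < j" "j < 2 * n" using j by auto
    show "if (- 1 :: int) ^ j = 1 then squares_pos (flip (map squares_letter [0..<2 * n] ! (j - 1))) = c
       else squares_pos (map squares_letter [0..<2 * n] ! j) = c"
    proof (cases "even j")
      case True
      then obtain i where "j = 2 * i" by blast
      then show ?thesis using j by (cases i) (auto simp: squares_letter_def squares_pos_def flip_def)
    next
      case False
      then obtain i where "j = 2 * i + 1" by (rule oddE)
      then show ?thesis using j by (auto simp: squares_letter_def squares_pos_def)
    qed
  qed
  show "\<exists>j'. \<forall>i<2 * n. fst (map squares_letter [0..<2 * n] ! i) = fst (map squares_letter [0..<2 * n] ! j) \<longrightarrow>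
      i = j \<or> i = j'" if "j < 2 * n" for j
  proof (intro exI allI impI)
    fix i assume "i < 2 * n" "fst (map squares_letter [0..<2 * n] ! i) = fst (map squares_letter [0..<2 * n] ! j)"
    then have "i div 2 = j div 2" using that by (simp add: squares_letter_def)
    \<comment> \<open>The partner is the other letter of the same square.\<close>
    then show "i = j \<or> i = (if even j then j + 1 else j - 1)" by presburger
  qed
  show "fst (map squares_letter [0..<2 * n] ! 0) \<noteq> fst (map squares_letter [0..<2 * n] ! (2 * n - 1))"
    unfolding last using assms by (simp add: squares_letter_def)
qed (use assms in simp_all)

lemma surface_word_commutators:
  assumes "1 \<le> m"
  shows "surface_word (2 * m) (map commutators_letter [0..<4 * m]) commutators_pos 1"
proof
  let ?s = "map commutators_letter [0..<4 * m]"
  have nth: "?s ! j = commutators_letter j" if "j < 4 * m" for j using that by simp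
  show "fst ` set ?s \<subseteq> {1..2 * m}"
  proof clarsimp
    fix j assume "j < 4 * m"
    then show "Suc 0 \<le> fst (commutators_letter j) \<and> fst (commutators_letter j) \<le> 2 * m"
      by (simp add: commutators_letter_def) presburger
  qed
  show "bij_betw commutators_pos {x. fst x \<in> {1..2 * m}} {1..2 * int (2 * m)}"
  proof (rule letters_bij)
    show "inj_on commutators_pos {x. fst x \<in> {1..2 * m}}"
      by (auto simp: inj_on_def commutators_pos_def split: if_splits; presburger)
    show "commutators_pos x \<in> {1..2 * int (2 * m)}" if "fst x \<in> {1..2 * m}" for x
      using that by (auto simp: commutators_pos_def split: if_splits; presburger)
  qed
  show "commutators_pos (?s ! 0) = 1"
    using assms commutators_letter_simps(1)[of 0] by (simp add: commutators_pos_def)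
  have "2 * (2 * m) - 1 = 4 * (m - 1) + 3" using assms by simp
  then have last: "?s ! (2 * (2 * m) - 1) = (2 * m, False)"
    using nth[of "4 * (m - 1) + 3"] commutators_letter_simps(4)[of "m - 1"] assms by simp
  show "commutators_pos (flip (?s ! (2 * (2 * m) - 1))) = 2 * int (2 * m)"
    unfolding last by (simp add: commutators_pos_def flip_def)
  show "fst (?s ! 0) \<noteq> fst (?s ! (2 * (2 * m) - 1))"
    unfolding last using assms commutators_letter_simps(1)[of 0] by simp
  have turn: "commutators_pos (commutators_letter (Suc j)) = commutators_pos (flip (commutators_letter j)) + 1" for j
  proof (cases j rule: mod4_cases)
    case (1 k)
    then have eq: "Suc j = 4 * k + 1" by simp
    show ?thesis
      unfolding eq unfolding 1 commutators_letter_simps by (simp add: commutators_pos_def flip_def)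
  next
    case (2 k)
    then have eq: "Suc j = 4 * k + 2" by simp
    show ?thesis
      unfolding eq unfolding 2 commutators_letter_simps by (simp add: commutators_pos_def flip_def)
  next
    case (3 k)
    then have eq: "Suc j = 4 * k + 3" by simp
    show ?thesis
      unfolding eq unfolding 3 commutators_letter_simps by (simp add: commutators_pos_def flip_def)
  next
    case (4 k)
    then have eq: "Suc j = 4 * (k + 1)" by simp
    show ?thesis
      unfolding eq unfolding 4 commutators_letter_simps by (simp add: commutators_pos_def flip_def)
  qed
  show "commutators_pos (?s ! Suc j) = commutators_pos (flip (?s ! j)) + 1 ^ Suc j" if "Suc j < 2 * (2 * m)" for j
    using turn[of j] that by simp
  show "\<exists>j. 0 < j \<and> j < 2 * (2 * m) \<and>
      (if (1 :: int) ^ j = 1 then commutators_pos (flip (?s ! (j - 1))) = c else commutators_pos (?s ! j) = c)"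
    if c: "1 \<le> c" "c < 2 * int (2 * m)" for c
  proof -
    define i where "i = nat (c - 1)"
    have i: "c = int i + 1" "i + 1 < 4 * m" using c by (auto simp: i_def)
    \<comment> \<open>The letter whose inverse has position \<open>c\<close> is found by the residue
      of \<open>c - 1\<close> modulo \<open>4\<close>. The corner is the one just after this letter,
      whence the later shift by one.\<close>
    have "\<exists>j. j + 1 < 4 * m \<and> commutators_pos (flip (commutators_letter j)) = c"
    proof (cases i rule: mod4_cases)
      case (1 k)
      then show ?thesis using i commutators_letter_simps(3)[of k]
        by (intro exI[of _ "4 * k + 2"]) (simp add: commutators_pos_def flip_def, presburger)
    next
      case (2 k)
      then show ?thesis using i commutators_letter_simps(2)[of k]
        by (intro exI[of _ "4 * k + 1"]) (simp add: commutators_pos_def flip_def)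
    next
      case (3 k)
      then show ?thesis using i commutators_letter_simps(1)[of k]
        by (intro exI[of _ "4 * k"]) (simp add: commutators_pos_def flip_def)
    next
      case (4 k)
      then show ?thesis using i commutators_letter_simps(4)[of k]
        by (intro exI[of _ "4 * k + 3"]) (simp add: commutators_pos_def flip_def)
    qed
    then obtain j where "j + 1 < 4 * m" "commutators_pos (flip (commutators_letter j)) = c" by blast
    then show ?thesis by (intro exI[of _ "j + 1"]) simp
  qed
  show "\<exists>j'. \<forall>i<2 * (2 * m). fst (?s ! i) = fst (?s ! j) \<longrightarrow> i = j \<or> i = j'" if "j < 2 * (2 * m)" for j
  proof (intro exI allI impI)
    fix i assume "i < 2 * (2 * m)" "fst (?s ! i) = fst (?s ! j)"
    then have eq: "2 * (i div 4) + i mod 2 = 2 * (j div 4) + j mod 2"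
      using that by (simp add: commutators_letter_def)
    have "a = c \<and> x = y" if "2 * a + x = 2 * c + y" "x < 2" "y < 2" for a c x y :: nat
      using that by arith
    from this[OF eq] have d: "i div 4 = j div 4" and "i mod 2 = j mod 2" by simp_all
    then have r: "i mod 4 mod 2 = j mod 4 mod 2" by (simp add: mod_mod_cancel)
    have "r = r' \<or> r' < 2 \<and> r = r' + 2 \<or> \<not> r' < 2 \<and> r + 2 = r'" if "r mod 2 = r' mod 2" "r < 4" "r' < 4" for r r' :: nat
      using that by presburger
    from this[OF r] have "i mod 4 = j mod 4 \<or> j mod 4 < 2 \<and> i mod 4 = j mod 4 + 2 \<or>
        \<not> j mod 4 < 2 \<and> i mod 4 + 2 = j mod 4" by simp
    moreover have "i = 4 * (j div 4) + i mod 4" "j = 4 * (j div 4) + j mod 4" using d by (metis mult_div_mod_eq)+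
    ultimately have "i = j \<or> j mod 4 < 2 \<and> i = j + 2 \<or> \<not> j mod 4 < 2 \<and> i + 2 = j" by linarith
    \<comment> \<open>A generator and its inverse stand two places apart within a
      commutator.\<close>
    then show "i = j \<or> i = (if j mod 4 < 2 then j + 2 else j - 2)" by auto
  qed
qed (use assms in simp_all)

theorem theorem1p17:
  fixes n :: nat and F :: "nat letter list monoid" and s :: "nat letter list"
    and X H :: "nat letter list ugraph"
  assumes "n \<ge> 2"
    and "F = free_group {1..n}"
    and "s = list_product F (map (\<lambda>i. gen i [^]\<^bsub>F\<^esub> (2::nat)) [1..<n + 1]) \<or>
         even n \<and>
         s = list_product F (map (\<lambda>k. commutator F (gen (2 * k - 1)) (gen (2 * k))) [1..<n div 2 + 1])"
    and "X = cayley_graph F (with_inverses F (gen ` {1..n}) \<union> with_inverses F {s})"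
    and "H = cayley_graph F (with_inverses F {s})"
  shows "hamiltonian_circle_subgraph X H
       \<and> (\<forall>H'. hamiltonian_circle_subgraph X H' \<longrightarrow> H' = H)
       \<and> (\<forall>K. hamiltonian_circle X K \<longrightarrow> K = closure_in X H)"
proof -
  have "\<exists>pos eps. surface_word n s pos eps"
    using assms(3)
  proof
    assume "s = list_product F (map (\<lambda>i. gen i [^]\<^bsub>F\<^esub> (2::nat)) [1..<n + 1])"
    then have "s = map squares_letter [0..<2 * n]" unfolding assms(2) squares_product .
    then show ?thesis using surface_word_squares[OF assms(1)] by blast
  next
    assume a: "even n \<and> s = list_product F (map (\<lambda>k. commutator F (gen (2 * k - 1)) (gen (2 * k))) [1..<n div 2 + 1])"
    then obtain m where m: "n = 2 * m" by blast
    then have "s = map commutators_letter [0..<4 * m]"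
      using a commutators_product[of m "{1..n}"] unfolding assms(2) by simp
    then show ?thesis using surface_word_commutators[of m] m assms(1) by auto
  qed
  then obtain pos eps where "surface_word n s pos eps" by blast
  then show ?thesis
    using surface_word.unique_hamiltonian_circle[of n s pos eps X H] assms(2,4,5) by simp
qed

end
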